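(* Let $\mathfrak{g}$ be a uniformly topologically nilpotent Banach-Lie algebra over $\mathbb{K}$ with $\omega_n>0$ for all $n$, let $(\alpha_n)_{n\in\mathbb{N}}\in\mathfrak{I}_{\mathfrak{g}}$ with corresponding seminorm $p_\alpha$, and let $z\in\mathbb{K}$. Then there exists a sequence $(\beta_n)_{n\in\mathbb{N}}\in\mathfrak{I}_{\mathfrak{g}}$ such that for all $x,y\in \mathrm{T}^\bullet(\mathfrak{g})$ $$p_\alpha(x\star_zy)\le(cp)_\beta(x)\,(cp)_\beta(y)$$ with a constant $c>0$ which only depends on $\alpha$, $z$ and the Lie algebra $\mathfrak{g}$.
   Context: $\mathbb{K}$ is $\mathbb{R}$ or $\mathbb{C}$. A Banach-Lie algebra carries a complete norm with $\|[\xi,\eta]\|\le\|\xi\|\,\|\eta\|$. Let $\mathbb{B}_1(0)=\{\xi\in\mathfrak{g}:\|\xi\|=1\}$ and $\mathcal{N}(n)=\sup\{\|\mathrm{ad}_{\xi_1}\circ\cdots\circ\mathrm{ad}_{\xi_n}\|^{1/n}:\xi_1,\ldots,\xi_n\in\mathbb{B}_1(0)\}$ (operator norm). $\mathfrak{g}$ is uniformly topologically nilpotent if $\lim_{n\to\infty}\mathcal{N}(n)=0$. Put $\omega_n=\sup_{m\ge n}\mathcal{N}(m)$; as in the paper it is assumed that $\omega_n>0$ for all $n\in\mathbb{N}$ (otherwise $\mathfrak{g}$ is nilpotent). The characteristic sequence is $\chi_n^{\mathfrak{g}}=\max\{1/\omega_n,2\}$. A sequence $(\alpha_n)_{n\in\mathbb{N}}$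 in $(1,\infty)$ is $\mathfrak{g}$-rapidly increasing if $\lim_{n\to\infty}\frac{\log\alpha_n}{n}=\infty$ and there is a constant $c'>0$ with $\alpha_n\le c'^n\chi_n^{\mathfrak{g}}$ for all $n$. $\mathfrak{I}_{\mathfrak{g}}$ is the set of all such sequences. For $(\alpha_n)\in\mathfrak{I}_{\mathfrak{g}}$ and $c>0$: $p_\alpha=\sum_{n=0}^\infty\frac{n!}{\alpha_n}\|\cdot\|^{\otimes_\pi n}$ and $(cp)_\alpha=\sum_{n=0}^\infty\frac{n!}{\alpha_n}c^n\|\cdot\|^{\otimes_\pi n}$ on $\mathrm{T}^\bullet(\mathfrak{g})$, where $\|\cdot\|^{\otimes_\pi n}$ is the projective tensor power of the norm on $\mathfrak{g}^{\otimes n}$; the degree-$0$ weight uses the convention $\alpha_0=1$. $\mathrm{S}^\bullet(\mathfrak{g})\subseteq \mathrm{T}^\bullet(\mathfrak{g})$ denotes the symmetric tensors, with product $\xi_1\cdots\xi_n=\frac1{n!}\sum_\sigma\xi_{\sigma(1)}\otimes\cdots\otimes\xi_{\sigma(n)}$. The Gutt star product is, for $f\in \mathrm{S}^k(\mathfrak{g})$, $g\in \mathrm{S}^\ell(\mathfrak{g})$, $f\star_zg=\sum_{n=0}^{k+\ell}z^n\pi_{k+\ell-n}\big(\mathfrak{q}^{-1}(\mathfrak{q}(f)\odot\mathfrak{q}(g))\big)$, where $\pi_n$ is the projection onto $\mathrm{S}^n(\mathfrak{g})$, $\odot$ the product of $\mathcal{U}(\mathfrak{g})$ and $\mathfrak{q}(\xi_1\cdots\xi_n)=\frac1{n!}\sum_\sigma\xi_{\sigma(1)}\odot\cdots\odot\xi_{\sigma(n)}$;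 it is extended to $\mathrm{T}^\bullet(\mathfrak{g})$ by symmetrizing both arguments first. *)

theory Defs
  imports
    "HOL-Analysis.Analysis"
    "HOL-Algebra.QuotRing"
    "HOL-Algebra.Algebraic_Closure_Type"
    "HOL-Library.Poly_Mapping"
    "HOL-Combinatorics.Permutations"
begin

section \<open>Banach-Lie algebras\<close>

text \<open>
  The scalar field \<open>\<real>\<close> or \<open>\<complex>\<close> is represented by a type of class
  \<^class>\<open>real_normed_field\<close>: norms in this class are multiplicative, so by Gelfand-Mazur such a
  type is isometrically isomorphic to \<^typ>\<open>real\<close> or \<^typ>\<open>complex\<close>, and both are instances.
\<close>

locale banach_lie_algebra = vector_space sc
  for sc :: "'k::real_normed_field \<Rightarrow> 'a::banach \<Rightarrow> 'a" +
  fixes br :: "'a \<Rightarrow> 'a \<Rightarrow> 'a"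
  assumes scale_of_real: "sc (of_real r) \<xi> = r *\<^sub>R \<xi>"
    and norm_scale: "norm (sc c \<xi>) = norm c * norm \<xi>"
    and linear_br_right: "Vector_Spaces.linear sc sc (\<lambda>\<eta>. br \<xi> \<eta>)"
    and linear_br_left: "Vector_Spaces.linear sc sc (\<lambda>\<xi>. br \<xi> \<eta>)"
    and br_self: "br \<xi> \<xi> = 0"
    and jacobi: "br \<xi> (br \<eta> \<zeta>) + br \<eta> (br \<zeta> \<xi>) + br \<zeta> (br \<xi> \<eta>) = 0"
    and norm_br: "norm (br \<xi> \<eta>) \<le> norm \<xi> * norm \<eta>"

text \<open>
  \<open>foldr br [\<xi>\<^sub>1, \<dots>, \<xi>\<^sub>n]\<close> is the composition of the maps \<open>ad \<xi>\<^sub>1, \<dots>, ad \<xi>\<^sub>n\<close>.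
  The sequences below are indexed by \<open>n \<ge> 1\<close>; their values at \<open>0\<close> are irrelevant.
  On the zero algebra the supremum is that of the empty set, but there all \<open>ad_growth br n\<close>, \<open>n \<ge> 1\<close>, agree,
  so that the hypotheses \<open>uniformly_top_nilpotent br\<close> and \<open>\<forall>n\<ge>1. 0 < omega br n\<close>
  exclude each other.
\<close>

definition ad_growth :: "('a::real_normed_vector \<Rightarrow> 'a \<Rightarrow> 'a) \<Rightarrow> nat \<Rightarrow> real"
  where "ad_growth br n =
    Sup {root n (onorm (foldr br \<xi>s)) | \<xi>s. length \<xi>s = n \<and> (\<forall>\<xi>\<in>set \<xi>s. norm \<xi> = 1)}"

definition uniformly_top_nilpotent :: "('a::real_normed_vector \<Rightarrow> 'a \<Rightarrow> 'a) \<Rightarrow> bool"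
  where "uniformly_top_nilpotent br \<longleftrightarrow> ad_growth br \<longlonglongrightarrow> 0"

definition omega :: "('a::real_normed_vector \<Rightarrow> 'a \<Rightarrow> 'a) \<Rightarrow> nat \<Rightarrow> real"
  where "omega br n = (SUP m\<in>{n..}. ad_growth br m)"

definition char_seq :: "('a::real_normed_vector \<Rightarrow> 'a \<Rightarrow> 'a) \<Rightarrow> nat \<Rightarrow> real"
  where "char_seq br n = max (1 / omega br n) 2"

definition rapidly_increasing :: "('a::real_normed_vector \<Rightarrow> 'a \<Rightarrow> 'a) \<Rightarrow> (nat \<Rightarrow> real) set"
  where "rapidly_increasing br = {\<alpha>.
    (\<forall>n\<ge>1. 1 < \<alpha> n) \<and>
    filterlim (\<lambda>n. ln (\<alpha> n) / real n) at_top sequentially \<and>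
    (\<exists>c'>0. \<forall>n\<ge>1. \<alpha> n \<le> c' ^ n * char_seq br n)}"


section \<open>The tensor algebra\<close>

text \<open>
  Lists form the free monoid, so \<^typ>\<open>'a list \<Rightarrow>\<^sub>0 'k\<close> with its convolution product is the
  free associative algebra over \<^typ>\<open>'k\<close> on the set of all elements of \<^typ>\<open>'a\<close>, with scalars
  embedded as \<open>Poly_Mapping.single [] c\<close>.  The tensor algebra is its quotient by the relations
  making the generators linear in \<^typ>\<open>'a\<close>.
\<close>

instantiation list :: (type) monoid_add
begin

definition zero_list :: "'a list" where "zero_list = []"

definition plus_list :: "'a list \<Rightarrow> 'a list \<Rightarrow> 'a list" where "plus_list = (@)"

instance
  by standard (simp_all add: zero_list_def plus_list_def)

end

abbreviation free_algebra :: "('a list \<Rightarrow>\<^sub>0 'k::comm_ring_1) ring"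
  where "free_algebra \<equiv> ring_of_type_algebra"

definition linear_relations ::
    "('k::comm_ring_1 \<Rightarrow> 'a::ab_group_add \<Rightarrow> 'a) \<Rightarrow> ('a list \<Rightarrow>\<^sub>0 'k) set"
  where "linear_relations sc =
    {Poly_Mapping.single [\<xi> + \<eta>] 1 - Poly_Mapping.single [\<xi>] 1 - Poly_Mapping.single [\<eta>] 1 | \<xi> \<eta>. True} \<union>
    {Poly_Mapping.single [sc c \<xi>] 1 - Poly_Mapping.single [\<xi>] c | c \<xi>. True}"

definition tensor_ideal ::
    "('k::comm_ring_1 \<Rightarrow> 'a::ab_group_add \<Rightarrow> 'a) \<Rightarrow> ('a list \<Rightarrow>\<^sub>0 'k) set"
  where "tensor_ideal sc = Idl\<^bsub>free_algebra\<^esub> (linear_relations sc)"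

type_synonym ('a, 'k) tensors = "('a list \<Rightarrow>\<^sub>0 'k) set"

definition tensor_algebra ::
    "('k::comm_ring_1 \<Rightarrow> 'a::ab_group_add \<Rightarrow> 'a) \<Rightarrow> ('a, 'k) tensors ring"
  where "tensor_algebra sc = free_algebra Quot tensor_ideal sc"

definition tensor_class ::
    "('k::comm_ring_1 \<Rightarrow> 'a::ab_group_add \<Rightarrow> 'a) \<Rightarrow> ('a list \<Rightarrow>\<^sub>0 'k) \<Rightarrow> ('a, 'k) tensors"
  where "tensor_class sc p = tensor_ideal sc +>\<^bsub>free_algebra\<^esub> p"

text \<open>\<open>tensor sc [\<xi>\<^sub>1, \<dots>, \<xi>\<^sub>n]\<close> is the decomposable tensor
  \<open>\<xi>\<^sub>1 \<otimes> \<dots> \<otimes> \<xi>\<^sub>n\<close>.\<close>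

definition tensor ::
    "('k::comm_ring_1 \<Rightarrow> 'a::ab_group_add \<Rightarrow> 'a) \<Rightarrow> 'a list \<Rightarrow> ('a, 'k) tensors"
  where "tensor sc \<xi>s = tensor_class sc (Poly_Mapping.single \<xi>s 1)"

definition tensor_scalar ::
    "('k::comm_ring_1 \<Rightarrow> 'a::ab_group_add \<Rightarrow> 'a) \<Rightarrow> 'k \<Rightarrow> ('a, 'k) tensors"
  where "tensor_scalar sc c = tensor_class sc (Poly_Mapping.single [] c)"

text \<open>
  The linear map from the tensor algebra to an algebra \<open>R\<close>, with scalars embedded by \<open>s\<close>,
  that sends \<open>\<xi>\<^sub>1 \<otimes> \<dots> \<otimes> \<xi>\<^sub>n\<close> to \<open>\<phi> [\<xi>\<^sub>1, \<dots>, \<xi>\<^sub>n]\<close>.  It is used only for \<open>\<phi>\<close> that is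
  multilinear on the lists of each fixed length, so that the sum does not depend on the
  representative.
\<close>

definition tensor_induced ::
    "('b, 'c) ring_scheme \<Rightarrow> ('k::zero \<Rightarrow> 'b) \<Rightarrow> ('a list \<Rightarrow> 'b) \<Rightarrow> ('a, 'k) tensors \<Rightarrow> 'b"
  where "tensor_induced R s \<phi> x =
    the_elem ((\<lambda>p. \<Oplus>\<^bsub>R\<^esub>w\<in>Poly_Mapping.keys p. s (Poly_Mapping.lookup p w) \<otimes>\<^bsub>R\<^esub> \<phi> w) ` x)"

definition tensor_proj ::
    "('k::comm_ring_1 \<Rightarrow> 'a::ab_group_add \<Rightarrow> 'a) \<Rightarrow> nat \<Rightarrow> ('a, 'k) tensors \<Rightarrow> ('a, 'k) tensors"
  where "tensor_proj sc n =
    tensor_induced (tensor_algebra sc) (tensor_scalar sc)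
      (\<lambda>\<xi>s. if length \<xi>s = n then tensor sc \<xi>s else \<zero>\<^bsub>tensor_algebra sc\<^esub>)"

definition tensor_degrees ::
    "('k::comm_ring_1 \<Rightarrow> 'a::ab_group_add \<Rightarrow> 'a) \<Rightarrow> ('a, 'k) tensors \<Rightarrow> nat set"
  where "tensor_degrees sc x = {n. tensor_proj sc n x \<noteq> \<zero>\<^bsub>tensor_algebra sc\<^esub>}"


section \<open>Symmetric tensors\<close>

definition tensor_permute ::
    "('k::comm_ring_1 \<Rightarrow> 'a::ab_group_add \<Rightarrow> 'a) \<Rightarrow> nat \<Rightarrow> (nat \<Rightarrow> nat) \<Rightarrow>
      ('a, 'k) tensors \<Rightarrow> ('a, 'k) tensors"
  where "tensor_permute sc n \<sigma> =
    tensor_induced (tensor_algebra sc) (tensor_scalar sc)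
      (\<lambda>\<xi>s. if length \<xi>s = n then tensor sc (permute_list \<sigma> \<xi>s)
            else \<zero>\<^bsub>tensor_algebra sc\<^esub>)"

definition sym_tensors ::
    "('k::comm_ring_1 \<Rightarrow> 'a::ab_group_add \<Rightarrow> 'a) \<Rightarrow> ('a, 'k) tensors set"
  where "sym_tensors sc = {x \<in> carrier (tensor_algebra sc).
    \<forall>n \<sigma>. \<sigma> permutes {..<n} \<longrightarrow> tensor_permute sc n \<sigma> x = tensor_proj sc n x}"

definition sym_product ::
    "('k::field_char_0 \<Rightarrow> 'a::ab_group_add \<Rightarrow> 'a) \<Rightarrow> 'a list \<Rightarrow> ('a, 'k) tensors"
  where "sym_product sc \<xi>s =
    tensor_scalar sc (1 / fact (length \<xi>s)) \<otimes>\<^bsub>tensor_algebra sc\<^esub>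
    (\<Oplus>\<^bsub>tensor_algebra sc\<^esub>\<sigma>\<in>{\<sigma>. \<sigma> permutes {..<length \<xi>s}}. tensor sc (permute_list \<sigma> \<xi>s))"

definition symmetrize ::
    "('k::field_char_0 \<Rightarrow> 'a::ab_group_add \<Rightarrow> 'a) \<Rightarrow> ('a, 'k) tensors \<Rightarrow> ('a, 'k) tensors"
  where "symmetrize sc =
    tensor_induced (tensor_algebra sc) (tensor_scalar sc) (sym_product sc)"


section \<open>The universal enveloping algebra and the Gutt star product\<close>

definition env_ideal ::
    "('k::comm_ring_1 \<Rightarrow> 'a::ab_group_add \<Rightarrow> 'a) \<Rightarrow> ('a \<Rightarrow> 'a \<Rightarrow> 'a) \<Rightarrow> ('a, 'k) tensors set"
  where "env_ideal sc br = Idl\<^bsub>tensor_algebra sc\<^esub>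
    {tensor sc [\<xi>, \<eta>] \<ominus>\<^bsub>tensor_algebra sc\<^esub> tensor sc [\<eta>, \<xi>]
       \<ominus>\<^bsub>tensor_algebra sc\<^esub> tensor sc [br \<xi> \<eta>] | \<xi> \<eta>. True}"

definition env_algebra ::
    "('k::comm_ring_1 \<Rightarrow> 'a::ab_group_add \<Rightarrow> 'a) \<Rightarrow> ('a \<Rightarrow> 'a \<Rightarrow> 'a) \<Rightarrow>
      ('a, 'k) tensors set ring"
  where "env_algebra sc br = tensor_algebra sc Quot env_ideal sc br"

definition env_class ::
    "('k::comm_ring_1 \<Rightarrow> 'a::ab_group_add \<Rightarrow> 'a) \<Rightarrow> ('a \<Rightarrow> 'a \<Rightarrow> 'a) \<Rightarrow>
      ('a, 'k) tensors \<Rightarrow> ('a, 'k) tensors set"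
  where "env_class sc br x = env_ideal sc br +>\<^bsub>tensor_algebra sc\<^esub> x"

definition env_product ::
    "('k::comm_ring_1 \<Rightarrow> 'a::ab_group_add \<Rightarrow> 'a) \<Rightarrow> ('a \<Rightarrow> 'a \<Rightarrow> 'a) \<Rightarrow>
      'a list \<Rightarrow> ('a, 'k) tensors set"
  where "env_product sc br \<xi>s =
    foldr (\<lambda>\<xi> u. env_class sc br (tensor sc [\<xi>]) \<otimes>\<^bsub>env_algebra sc br\<^esub> u)
      \<xi>s \<one>\<^bsub>env_algebra sc br\<^esub>"

text \<open>
  The quantization map \<open>\<qq>\<close> is the restriction to the symmetric tensors of the linear map
  sending both \<open>\<xi>\<^sub>1 \<otimes> \<dots> \<otimes> \<xi>\<^sub>n\<close> and \<open>\<xi>\<^sub>1 \<cdots> \<xi>\<^sub>n\<close> to the average of the products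
  \<open>\<xi>\<^bsub>\<sigma>(1)\<^esub> \<odot> \<dots> \<odot> \<xi>\<^bsub>\<sigma>(n)\<^esub>\<close>.
\<close>

definition quantize ::
    "('k::field_char_0 \<Rightarrow> 'a::ab_group_add \<Rightarrow> 'a) \<Rightarrow> ('a \<Rightarrow> 'a \<Rightarrow> 'a) \<Rightarrow>
      ('a, 'k) tensors \<Rightarrow> ('a, 'k) tensors set"
  where "quantize sc br =
    tensor_induced (env_algebra sc br) (\<lambda>c. env_class sc br (tensor_scalar sc c))
      (\<lambda>\<xi>s. env_class sc br (tensor_scalar sc (1 / fact (length \<xi>s)))
        \<otimes>\<^bsub>env_algebra sc br\<^esub>
        (\<Oplus>\<^bsub>env_algebra sc br\<^esub>\<sigma>\<in>{\<sigma>. \<sigma> permutes {..<length \<xi>s}}.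
          env_product sc br (permute_list \<sigma> \<xi>s)))"

definition gutt_star_homogeneous ::
    "('k::field_char_0 \<Rightarrow> 'a::ab_group_add \<Rightarrow> 'a) \<Rightarrow> ('a \<Rightarrow> 'a \<Rightarrow> 'a) \<Rightarrow> 'k \<Rightarrow> nat \<Rightarrow> nat \<Rightarrow>
      ('a, 'k) tensors \<Rightarrow> ('a, 'k) tensors \<Rightarrow> ('a, 'k) tensors"
  where "gutt_star_homogeneous sc br z k l f g =
    (\<Oplus>\<^bsub>tensor_algebra sc\<^esub>n\<in>{0..k + l}.
      tensor_scalar sc (z ^ n) \<otimes>\<^bsub>tensor_algebra sc\<^esub>
      tensor_proj sc (k + l - n)
        (the_inv_into (sym_tensors sc) (quantize sc br)
          (quantize sc br f \<otimes>\<^bsub>env_algebra sc br\<^esub> quantize sc br g)))"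

definition gutt_star ::
    "('k::field_char_0 \<Rightarrow> 'a::ab_group_add \<Rightarrow> 'a) \<Rightarrow> ('a \<Rightarrow> 'a \<Rightarrow> 'a) \<Rightarrow> 'k \<Rightarrow>
      ('a, 'k) tensors \<Rightarrow> ('a, 'k) tensors \<Rightarrow> ('a, 'k) tensors"
  where "gutt_star sc br z x y =
    (\<Oplus>\<^bsub>tensor_algebra sc\<^esub>k\<in>tensor_degrees sc (symmetrize sc x).
      \<Oplus>\<^bsub>tensor_algebra sc\<^esub>l\<in>tensor_degrees sc (symmetrize sc y).
        gutt_star_homogeneous sc br z k l
          (tensor_proj sc k (symmetrize sc x))
          (tensor_proj sc l (symmetrize sc y)))"


section \<open>Projective norms and weighted seminorms\<close>

text \<open>
  The infimum runs over all ways of writing a homogeneous tensor \<open>x\<close> of degree \<open>n\<close> as a finite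
  sum of terms \<open>c \<xi>\<^sub>1 \<otimes> \<dots> \<otimes> \<xi>\<^sub>n\<close>: these are the representatives of \<open>x\<close> in the free algebra
  supported on words of length \<open>n\<close>.  Collecting equal words does not increase the sum of norms.
  In degree \<open>0\<close> the result is the absolute value of the scalar.
\<close>

definition proj_norm :: "nat \<Rightarrow> ('a::real_normed_vector, 'k::real_normed_field) tensors \<Rightarrow> real"
  where "proj_norm n x =
    Inf {\<Sum>\<xi>s\<in>Poly_Mapping.keys p. norm (Poly_Mapping.lookup p \<xi>s) * (\<Prod>\<xi>\<leftarrow>\<xi>s. norm \<xi>) | p.
      p \<in> x \<and> (\<forall>\<xi>s\<in>Poly_Mapping.keys p. length \<xi>s = n)}"

definition scaled_seminorm ::
    "('k::real_normed_field \<Rightarrow> 'a::real_normed_vector \<Rightarrow> 'a) \<Rightarrow> real \<Rightarrow> (nat \<Rightarrow> real) \<Rightarrow>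
      ('a, 'k) tensors \<Rightarrow> real"
  where "scaled_seminorm sc c \<alpha> x =
    suminf (\<lambda>n. fact n / (if n = 0 then 1 else \<alpha> n) * c ^ n * proj_norm n (tensor_proj sc n x))"

definition weighted_seminorm ::
    "('k::real_normed_field \<Rightarrow> 'a::real_normed_vector \<Rightarrow> 'a) \<Rightarrow> (nat \<Rightarrow> real) \<Rightarrow>
      ('a, 'k) tensors \<Rightarrow> real"
  where "weighted_seminorm sc \<alpha> x =
    suminf (\<lambda>n. fact n / (if n = 0 then 1 else \<alpha> n) * proj_norm n (tensor_proj sc n x))"

end

theory Submission
  imports Defs "HOL-Algebra.UnivPoly" "HOL-Computational_Algebra.Formal_Power_Series"
begin

text \<open>
  Left multiplication by \<open>\<xi>\<close> in the universal enveloping algebra is transported to symmetric tensors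
  by \<open>\<eta>\<^sup>k \<mapsto> \<Sum>\<^sub>j (k choose j) B\<^sub>j (ad \<eta>)\<^sup>j \<xi> \<cdot> \<eta>\<^bsup>k - j\<^esup>\<close>.  By polarization it suffices to check
  on powers that these operators satisfy the bracket relations; this comes down to the functional
  equation of \<open>1 / (exp t - 1)\<close>.  They make the symmetric tensors a module over the enveloping
  algebra, which gives the Poincare-Birkhoff-Witt theorem and computes the star product.

  Uniform topological nilpotency provides, for every \<open>\<epsilon> > 0\<close>, a gauge \<open>N\<close> with
  \<open>N \<le> \<parallel>\<cdot>\<parallel> \<le> A N\<close> and \<open>N [\<xi>, \<eta>] \<le> \<epsilon> N \<xi> N \<eta>\<close>.  In a gauge the product of \<open>k\<close> and \<open>l\<close> factors is
  bounded by \<open>k! l!\<close> times an arbitrarily small exponential in \<open>k + l\<close>, and its part of degree \<open>r\<close>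
  costs only a factor \<open>A\<^sup>r\<close>, which \<open>\<alpha>\<^sub>r\<close> absorbs.  Letting the exponential rate tend to
  infinity slowly with the degree gives the sequence \<open>\<beta>\<close>.
\<close>

section \<open>Linear maps on the free algebra\<close>

text \<open>The gain has to be superexponential: k + l factors can collapse to degree 1, where the
  weight \<open>1 / \<alpha> 1\<close> is a constant, while the right-hand side carries
  \<open>1 / (\<beta> k * \<beta> l)\<close>, which decays faster than every exponential. Only
  brackets can provide this, and in the given norm a bracket costs a factor 1; hence the change to
  gauges in which it costs an arbitrarily small \<epsilon>. One gauge yields one exponential rate,
  with a constant that depends on the rate, so the gauge is chosen anew for each total degree k + l,
  and the rate may grow only as slowly as these constants permit.

  The Bernoulli operators are explicit, so that no ordered basis is needed for
  Poincare-Birkhoff-Witt and the formula that proves it is also the one that is estimated. All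
  computations take place on polynomials in words, where weighted l1 norms are available; tensors
  enter through congruence of representatives. In bidegree (0, 0) there is no room for a constant,
  since \<open>c ^ 0 = 1\<close> and both weights are 1, so this case is computed exactly.\<close>

type_synonym ('a, 'k) free_alg = "'a list \<Rightarrow>\<^sub>0 'k"

abbreviation words :: "('a, 'k::zero) free_alg \<Rightarrow> 'a list set"
  where "words \<equiv> Poly_Mapping.keys"

abbreviation coef :: "('a, 'k::zero) free_alg \<Rightarrow> 'a list \<Rightarrow> 'k"
  where "coef \<equiv> Poly_Mapping.lookup"

definition fword :: "'a list \<Rightarrow> 'a list \<Rightarrow>\<^sub>0 'k::comm_ring_1"
  where "fword w = Poly_Mapping.single w 1"

definition fscal :: "'k::comm_ring_1 \<Rightarrow> ('a, 'k) free_alg"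
  where "fscal c = Poly_Mapping.single [] c"

lemma mult_single_list:
  "Poly_Mapping.single u a * Poly_Mapping.single v b = Poly_Mapping.single (u @ v) (a * b :: 'k::comm_ring_1)"
  by (simp add: mult_single plus_list_def)

lemma single_Nil_one: "Poly_Mapping.single [] 1 = (1 :: 'a list \<Rightarrow>\<^sub>0 'k::comm_ring_1)"
  using single_one[where ?'a = "'a list" and ?'b = 'k] by (simp only: zero_list_def)

lemma fword_append: "fword (u @ v) = fword u * fword v"
  by (simp add: fword_def mult_single_list)

lemma fword_Nil [simp]: "fword [] = 1"
  by (simp add: fword_def single_Nil_one)

lemma fword_Cons: "fword (\<xi> # v) = fword [\<xi>] * fword v"
  using fword_append[of "[\<xi>]" v] by simp

lemma single_eq_fscal_fword: "Poly_Mapping.single w c = fscal c * fword w"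
  by (simp add: fword_def fscal_def mult_single_list)

lemma fscal_0 [simp]: "fscal 0 = 0" and fscal_1 [simp]: "fscal 1 = 1"
  by (simp_all add: fscal_def single_Nil_one)

lemma fscal_add: "fscal (a + b) = fscal a + fscal b"
  by (simp add: fscal_def single_add)

lemma fscal_minus: "fscal (- a) = - fscal a"
  by (simp add: fscal_def single_uminus)

lemma fscal_mult: "fscal (a * b) = fscal a * fscal b"
  by (simp add: fscal_def mult_single_list)

lemma fscal_sum: "fscal (\<Sum>i\<in>A. f i) = (\<Sum>i\<in>A. fscal (f i))"
  by (induction A rule: infinite_finite_induct) (simp_all add: fscal_add)

lemma fscal_fscal: "fscal a * (fscal b * p) = fscal (a * b) * p"
  by (simp add: fscal_mult mult.assoc)

lemma lookup_fscal_mult: "coef (fscal c * p) w = c * coef p w"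
  using mult_map_scale_conv_mult[of c p, symmetric]
  by (simp add: fscal_def zero_list_def map.rep_eq when_def)

lemma free_algebra_expansion:
  "p = (\<Sum>w\<in>words p. fscal (coef p w) * fword w)"
proof (rule poly_mapping_eqI)
  fix v
  have "coef (\<Sum>w\<in>words p. fscal (coef p w) * fword w) v
      = (\<Sum>w\<in>words p. if v = w then coef p w else 0)"
    by (simp add: single_eq_fscal_fword[symmetric] lookup_sum lookup_single when_def eq_commute)
  also have "\<dots> = coef p v"
    by (simp add: in_keys_iff)
  finally show "coef p v
      = coef (\<Sum>w\<in>words p. fscal (coef p w) * fword w) v"
    by simp
qed

lemma free_algebra_induct [case_names zero add scal word]:
  assumes "P 0" "\<And>p q. P p \<Longrightarrow> P q \<Longrightarrow> P (p + q)" "\<And>c p. P p \<Longrightarrow> P (fscal c * p)" "\<And>w. P (fword w)"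
  shows "P p"
proof -
  have "P (\<Sum>w\<in>A. fscal (coef p w) * fword w)" for A
    by (induction A rule: infinite_finite_induct) (auto intro: assms)
  then show ?thesis
    by (subst free_algebra_expansion)
qed

lemma fscal_commute: "fscal c * p = p * fscal c"
proof (induction p rule: free_algebra_induct)
  case (scal d p)
  have "fscal c * (fscal d * p) = fscal d * (fscal c * p)"
    by (simp add: fscal_fscal mult.commute)
  with scal show ?case
    by (simp add: mult.assoc)
next
  case (word w)
  then show ?case
    by (simp add: fscal_def fword_def mult_single_list)
qed (simp_all add: algebra_simps)

lemma fscal_left_commute: "p * (fscal c * q) = fscal c * (p * q)"
  by (metis fscal_commute mult.assoc)

text \<open>Linearity over the field, expressed inside the ring: scalars act as multiplication by
  the central elements \<open>fscal c\<close>.\<close>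

definition lin :: "(('a list \<Rightarrow>\<^sub>0 'k::comm_ring_1) \<Rightarrow> ('b list \<Rightarrow>\<^sub>0 'k)) \<Rightarrow> bool"
  where "lin \<Phi> \<longleftrightarrow> (\<forall>p q. \<Phi> (p + q) = \<Phi> p + \<Phi> q) \<and> (\<forall>c p. \<Phi> (fscal c * p) = fscal c * \<Phi> p)"

definition ext :: "('a list \<Rightarrow> 'b list \<Rightarrow>\<^sub>0 'k) \<Rightarrow> ('a list \<Rightarrow>\<^sub>0 'k::comm_ring_1) \<Rightarrow> ('b list \<Rightarrow>\<^sub>0 'k)"
  where "ext \<phi> p = (\<Sum>w\<in>words p. fscal (coef p w) * \<phi> w)"

lemma lin_addD: "lin \<Phi> \<Longrightarrow> \<Phi> (p + q) = \<Phi> p + \<Phi> q"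
  and lin_scalD: "lin \<Phi> \<Longrightarrow> \<Phi> (fscal c * p) = fscal c * \<Phi> p"
  by (simp_all add: lin_def)

lemma lin_0: "lin \<Phi> \<Longrightarrow> \<Phi> 0 = 0"
  using lin_scalD[of \<Phi> 0 0] by simp

lemma lin_minusD: "lin \<Phi> \<Longrightarrow> \<Phi> (- p) = - \<Phi> p"
  using lin_scalD[of \<Phi> "-1" p] by (simp add: fscal_minus)

lemma lin_diffD: "lin \<Phi> \<Longrightarrow> \<Phi> (p - q) = \<Phi> p - \<Phi> q"
  using lin_addD[of \<Phi> p "- q"] by (simp add: lin_minusD)

lemma lin_sumD: "lin \<Phi> \<Longrightarrow> \<Phi> (\<Sum>i\<in>A. f i) = (\<Sum>i\<in>A. \<Phi> (f i))"
  by (induction A rule: infinite_finite_induct) (simp_all add: lin_0 lin_addD)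

lemma ext_superset:
  assumes "finite A" "words p \<subseteq> A"
  shows "ext \<phi> p = (\<Sum>w\<in>A. fscal (coef p w) * \<phi> w)"
  unfolding ext_def using assms
  by (intro sum.mono_neutral_left) (auto simp: in_keys_iff)

lemma lin_ext [intro, simp]:
  fixes \<phi> :: "'a list \<Rightarrow> 'b list \<Rightarrow>\<^sub>0 'k::comm_ring_1"
  shows "lin (ext \<phi>)"
  unfolding lin_def
proof (intro conjI allI)
  fix p q :: "('a, 'k) free_alg"
  let ?A = "words p \<union> words q"
  have "ext \<phi> (p + q) = (\<Sum>w\<in>?A. fscal (coef (p + q) w) * \<phi> w)"
    by (intro ext_superset keys_add) simp
  also have "\<dots> = ext \<phi> p + ext \<phi> q"
    by (simp add: ext_superset[of ?A] lookup_add fscal_add distrib_right sum.distrib)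
  finally show "ext \<phi> (p + q) = ext \<phi> p + ext \<phi> q" .
next
  fix c and p :: "('a, 'k) free_alg"
  have "ext \<phi> (fscal c * p) = (\<Sum>w\<in>words p. fscal (coef (fscal c * p) w) * \<phi> w)"
    by (intro ext_superset) (auto simp: in_keys_iff lookup_fscal_mult)
  then show "ext \<phi> (fscal c * p) = fscal c * ext \<phi> p"
    by (simp add: lookup_fscal_mult ext_def sum_distrib_left fscal_fscal)
qed

lemma ext_fword [simp]: "ext \<phi> (fword w) = \<phi> w"
  by (simp add: ext_def fword_def)

lemma lin_eqI:
  assumes "lin \<Phi>" "lin \<Psi>" "\<And>w. \<Phi> (fword w) = \<Psi> (fword w)"
  shows "\<Phi> p = \<Psi> p"
  by (induction p rule: free_algebra_induct)
    (simp_all add: assms lin_0 lin_addD lin_scalD)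

lemma lin_id [simp]: "lin (\<lambda>p. p)"
  and lin_zero [simp]: "lin (\<lambda>p. 0)"
  and lin_add: "lin \<Phi> \<Longrightarrow> lin \<Psi> \<Longrightarrow> lin (\<lambda>p. \<Phi> p + \<Psi> p)"
  and lin_diff: "lin \<Phi> \<Longrightarrow> lin \<Psi> \<Longrightarrow> lin (\<lambda>p. \<Phi> p - \<Psi> p)"
  and lin_compose: "lin \<Phi>' \<Longrightarrow> lin \<Phi> \<Longrightarrow> lin (\<lambda>p. \<Phi>' (\<Phi> p))"
  by (simp_all add: lin_def algebra_simps)

lemma lin_mult_left: "lin \<Phi> \<Longrightarrow> lin (\<lambda>p. q * \<Phi> p)"
  and lin_mult_right: "lin \<Phi> \<Longrightarrow> lin (\<lambda>p. \<Phi> p * q)"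
  unfolding lin_def by (simp_all add: distrib_left distrib_right fscal_left_commute[of q] mult.assoc)


section \<open>Two-sided ideals of the free algebra\<close>

definition fideal :: "('a list \<Rightarrow>\<^sub>0 'k::comm_ring_1) set \<Rightarrow> bool"
  where "fideal K \<longleftrightarrow> 0 \<in> K \<and> (\<forall>p\<in>K. \<forall>q\<in>K. p + q \<in> K) \<and> (\<forall>p\<in>K. \<forall>r. r * p \<in> K \<and> p * r \<in> K)"

lemma fideal_0: "fideal K \<Longrightarrow> 0 \<in> K"
  and fideal_add: "fideal K \<Longrightarrow> p \<in> K \<Longrightarrow> q \<in> K \<Longrightarrow> p + q \<in> K"
  and fideal_left: "fideal K \<Longrightarrow> p \<in> K \<Longrightarrow> r * p \<in> K"
  and fideal_right: "fideal K \<Longrightarrow> p \<in> K \<Longrightarrow> p * r \<in> K"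
  by (auto simp: fideal_def)

lemma fideal_minus: "fideal K \<Longrightarrow> p \<in> K \<Longrightarrow> - p \<in> K"
  using fideal_left[of K p "-1"] by simp

lemma fideal_diff: "fideal K \<Longrightarrow> p \<in> K \<Longrightarrow> q \<in> K \<Longrightarrow> p - q \<in> K"
  using fideal_add[of K p "- q"] fideal_minus[of K q] by simp

lemma fideal_sum: "fideal K \<Longrightarrow> (\<And>i. i \<in> A \<Longrightarrow> f i \<in> K) \<Longrightarrow> (\<Sum>i\<in>A. f i) \<in> K"
  by (induction A rule: infinite_finite_induct) (auto intro: fideal_0 fideal_add)

text \<open>A linear \<Phi> need not be multiplicative, so the preimage of an ideal need not be an
  ideal. Quantifying over all surrounding words produces an ideal inside the preimage, and
  membership in it can be tested on generators.\<close>

lemma fideal_two_sided: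
  assumes \<Phi>: "lin \<Phi>" and I: "fideal I"
  shows "fideal {p. \<forall>u v. \<Phi> (fword u * p * fword v) \<in> I}" (is "fideal ?K")
proof -
  have left: "r * p \<in> ?K" if p: "p \<in> ?K" for r p
  proof (induction r rule: free_algebra_induct)
    case (word w)
    have "fword u * (fword w * p) * fword v = fword (u @ w) * p * fword v" for u v
      by (simp add: fword_append mult.assoc)
    with p show ?case by simp
  next
    case (scal c q)
    have "fword u * (fscal c * q * p) * fword v = fscal c * (fword u * (q * p) * fword v)" for u v
      by (simp add: mult.assoc fscal_left_commute[of "fword u"])
    with scal show ?case
      by (simp add: lin_scalD[OF \<Phi>] fideal_left[OF I])
  qed (simp_all add: lin_0[OF \<Phi>] lin_addD[OF \<Phi>] distrib_left distrib_right fideal_0[OF I] fideal_add[OF I])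
  have right: "p * r \<in> ?K" if p: "p \<in> ?K" for r p
  proof (induction r rule: free_algebra_induct)
    case (word w)
    have "fword u * (p * fword w) * fword v = fword u * p * fword (w @ v)" for u v
      by (simp add: fword_append mult.assoc)
    with p show ?case by simp
  next
    case (scal c q)
    have "fword u * (p * (fscal c * q)) * fword v = fscal c * (fword u * (p * q) * fword v)" for u v
      by (simp add: mult.assoc fscal_left_commute[of "fword u"] fscal_left_commute[of p])
    with scal show ?case
      by (simp add: lin_scalD[OF \<Phi>] fideal_left[OF I])
  qed (simp_all add: lin_0[OF \<Phi>] lin_addD[OF \<Phi>] distrib_left distrib_right fideal_0[OF I] fideal_add[OF I])
  show ?thesis
    unfolding fideal_def using left right
    by (simp add: lin_0[OF \<Phi>] lin_addD[OF \<Phi>] distrib_left distrib_right fideal_0[OF I] fideal_add[OF I])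
qed

lemma ring_free_algebra: "ring (free_algebra :: ('a list \<Rightarrow>\<^sub>0 'k::comm_ring_1) ring)"
proof -
  have "\<exists>y. x + y = 0" for x :: "('a, 'k) free_alg"
    by (rule exI[of _ "- x"]) simp
  then show ?thesis
    unfolding ring_of_type_algebra_def
    by unfold_locales (auto simp: algebra_simps Units_def)
qed

lemma free_algebra_simps [simp]:
  "carrier free_algebra = UNIV" "monoid.mult free_algebra = (*)" "\<one>\<^bsub>free_algebra\<^esub> = 1"
  "\<zero>\<^bsub>free_algebra\<^esub> = 0" "add free_algebra = (+)"
  by (simp_all add: ring_of_type_algebra_def fun_eq_iff)

lemma ideal_free_algebra_iff: "ideal K free_algebra \<longleftrightarrow> fideal K"
proof
  assume "ideal K free_algebra"
  then interpret ideal K free_algebra .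
  show "fideal K"
    using additive_subgroup.zero_closed[OF is_additive_subgroup]
      additive_subgroup.a_closed[OF is_additive_subgroup] I_l_closed I_r_closed
    by (auto simp: fideal_def)
next
  assume K: "fideal K"
  interpret ring free_algebra by (rule ring_free_algebra)
  have inv: "\<exists>y\<in>K. y + x = 0 \<and> x + y = 0" if "x \<in> K" for x
    using that fideal_minus[OF K] by (intro bexI[of _ "- x"]) auto
  have "inv\<^bsub>add_monoid free_algebra\<^esub> x \<in> K" if "x \<in> K" for x
    using minus_equality[of "- x" x] fideal_minus[OF K that] by (simp add: a_inv_def)
  then show "ideal K free_algebra"
    by (intro idealI ring_free_algebra subgroup.intro)
      (use K in \<open>auto simp: fideal_def\<close>)
qed

section \<open>The tensor ideal and congruence of representatives modulo it\<close>

context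
  fixes sc :: "'k::comm_ring_1 \<Rightarrow> 'a::ab_group_add \<Rightarrow> 'a"
begin

abbreviation "J \<equiv> tensor_ideal sc"

lemma fideal_J: "fideal J"
  unfolding tensor_ideal_def ideal_free_algebra_iff[symmetric]
  by (rule ring.genideal_ideal[OF ring_free_algebra]) simp

lemmas J_0 [simp] = fideal_0[OF fideal_J]
  and J_add = fideal_add[OF fideal_J]
  and J_diff = fideal_diff[OF fideal_J]
  and J_minus = fideal_minus[OF fideal_J]
  and J_left = fideal_left[OF fideal_J]
  and J_right = fideal_right[OF fideal_J]
  and J_sum = fideal_sum[OF fideal_J]

lemma J_relations: "linear_relations sc \<subseteq> J"
  unfolding tensor_ideal_def by (rule ring.genideal_self[OF ring_free_algebra]) simp

lemma J_minimal: "fideal K \<Longrightarrow> linear_relations sc \<subseteq> K \<Longrightarrow> J \<subseteq> K"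
  unfolding tensor_ideal_def ideal_free_algebra_iff[symmetric]
  by (rule ring.genideal_minimal[OF ring_free_algebra])

text \<open>Equality of tensors, read on representatives. It stays separate from equality because
  norms of representatives are not invariant under it.\<close>

definition cg :: "(('a, 'k) free_alg) \<Rightarrow> (('a, 'k) free_alg) \<Rightarrow> bool"
  where "cg p q \<longleftrightarrow> p - q \<in> J"

lemma cg_refl [simp, intro]: "cg p p"
  by (simp add: cg_def)

lemma cg_sym: "cg p q \<Longrightarrow> cg q p"
  using J_minus[of "p - q"] by (simp add: cg_def)

lemma cg_trans [trans]: "cg p q \<Longrightarrow> cg q r \<Longrightarrow> cg p r"
  using J_add[of "p - q" "q - r"] by (simp add: cg_def)

lemma cg_eq_trans [trans]: "cg p q \<Longrightarrow> q = r \<Longrightarrow> cg p r" and eq_cg_trans [trans]: "p = q \<Longrightarrow> cg q r \<Longrightarrow> cg p r"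
  by simp_all

lemma cg_add: "cg p q \<Longrightarrow> cg p' q' \<Longrightarrow> cg (p + p') (q + q')"
  using J_add[of "p - q" "p' - q'"] by (simp add: cg_def algebra_simps)

lemma cg_diff: "cg p q \<Longrightarrow> cg p' q' \<Longrightarrow> cg (p - p') (q - q')"
  using J_diff[of "p - q" "p' - q'"] by (simp add: cg_def algebra_simps)

lemma cg_left: "cg p q \<Longrightarrow> cg (r * p) (r * q)"
  using J_left[of "p - q" r] by (simp add: cg_def algebra_simps)

lemma cg_right: "cg p q \<Longrightarrow> cg (p * r) (q * r)"
  using J_right[of "p - q" r] by (simp add: cg_def algebra_simps)

lemma cg_mult: "cg p q \<Longrightarrow> cg p' q' \<Longrightarrow> cg (p * p') (q * q')"
  by (meson cg_left cg_right cg_trans)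

lemma cg_sum: "(\<And>i. i \<in> A \<Longrightarrow> cg (f i) (g i)) \<Longrightarrow> cg (\<Sum>i\<in>A. f i) (\<Sum>i\<in>A. g i)"
  using J_sum[of A "\<lambda>i. f i - g i"] by (simp add: cg_def sum_subtractf)

lemma cg_0_iff: "cg p 0 \<longleftrightarrow> p \<in> J"
  by (simp add: cg_def)

lemma fword_add: "cg (fword [\<xi> + \<eta>]) (fword [\<xi>] + fword [\<eta>])"
  using J_relations by (auto simp: linear_relations_def cg_def fword_def diff_diff_eq)

lemma fword_scale: "cg (fword [sc c \<xi>]) (fscal c * fword [\<xi>])"
  using J_relations by (auto simp: linear_relations_def cg_def single_eq_fscal_fword[symmetric]) (auto simp: fword_def)

lemma fword_zero: "cg (fword [0]) 0"
  using fword_add[of 0 0] J_minus by (fastforce simp: cg_def)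

lemma fword_sum: "cg (fword [\<Sum>i\<in>A. f i]) (\<Sum>i\<in>A. fword [f i])"
proof (induction A rule: infinite_finite_induct)
  case (insert x A)
  then have "cg (fword [f x + (\<Sum>i\<in>A. f i)]) (fword [f x] + (\<Sum>i\<in>A. fword [f i]))"
    by (meson cg_add cg_refl cg_trans fword_add)
  with insert show ?case
    by simp
qed (simp_all add: fword_zero)

lemma fword_diff: "cg (fword [\<xi> - \<eta>]) (fword [\<xi>] - fword [\<eta>])"
proof -
  have "cg (fword [\<xi>]) (fword [\<xi> - \<eta>] + fword [\<eta>])"
    using fword_add[of "\<xi> - \<eta>" \<eta>] by simp
  then show ?thesis
    by (metis add_diff_cancel_right' cg_diff cg_refl cg_sym)
qed

lemma lin_cgI:
  assumes "lin \<Phi>" "lin \<Psi>" "\<And>w. cg (\<Phi> (fword w)) (\<Psi> (fword w))"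
  shows "cg (\<Phi> p) (\<Psi> p)"
  by (induction p rule: free_algebra_induct)
    (auto simp add: assms lin_0 lin_addD lin_scalD intro: cg_add cg_left)

text \<open>Multilinearity only modulo \<open>cg\<close>: even \<open>fword\<close> is additive in a
  letter only up to congruence.\<close>

definition multilin :: "('a list \<Rightarrow> ('a, 'k) free_alg) \<Rightarrow> bool"
  where "multilin \<phi> \<longleftrightarrow> (\<forall>w i \<xi> \<eta> c. i < length w \<longrightarrow>
    cg (\<phi> (w[i := \<xi> + \<eta>])) (\<phi> (w[i := \<xi>]) + \<phi> (w[i := \<eta>])) \<and>
    cg (\<phi> (w[i := sc c \<xi>])) (fscal c * \<phi> (w[i := \<xi>])))"

lemma multilinI:
  assumes "\<And>w i \<xi> \<eta>. i < length w \<Longrightarrow> cg (\<phi> (w[i := \<xi> + \<eta>])) (\<phi> (w[i := \<xi>]) + \<phi> (w[i := \<eta>]))"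
    and "\<And>w i \<xi> c. i < length w \<Longrightarrow> cg (\<phi> (w[i := sc c \<xi>])) (fscal c * \<phi> (w[i := \<xi>]))"
  shows "multilin \<phi>"
  using assms by (simp add: multilin_def)

text \<open>The universal property of the tensor algebra. A relation placed between words u and v is
  an instance of multilinearity in the slot \<open>length u\<close>, so the relations lie in the
  ideal of \<open>fideal_two_sided\<close>; empty u and v give the claim.\<close>

lemma multilin_J:
  assumes \<phi>: "multilin \<phi>" and p: "p \<in> J"
  shows "ext \<phi> p \<in> J"
proof -
  define K where "K = {p. \<forall>u v. ext \<phi> (fword u * p * fword v) \<in> J}"
  have "fideal K"
    unfolding K_def by (rule fideal_two_sided[OF lin_ext fideal_J])
  moreover have "linear_relations sc \<subseteq> K"
  proof -
    \<comment> \<open>The letter 0 is a placeholder that every update overwrites.\<close>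
    have upd: "fword u * fword [x] * fword v = fword ((u @ [0] @ v)[length u := x])" for u v x
      by (simp add: fword_append[symmetric] mult.assoc[symmetric] del: fword_Nil)
    have "fword [\<xi> + \<eta>] - fword [\<xi>] - fword [\<eta>] \<in> K" for \<xi> \<eta>
    proof -
      have "ext \<phi> (fword u * (fword [\<xi> + \<eta>] - fword [\<xi>] - fword [\<eta>]) * fword v) \<in> J" for u v
      proof -
        have eq: "fword u * (fword [\<xi> + \<eta>] - fword [\<xi>] - fword [\<eta>]) * fword v =
            fword ((u @ [0] @ v)[length u := \<xi> + \<eta>]) - fword ((u @ [0] @ v)[length u := \<xi>])
            - fword ((u @ [0] @ v)[length u := \<eta>])"
          by (simp only: right_diff_distrib left_diff_distrib upd)
        have "ext \<phi> (fword u * (fword [\<xi> + \<eta>] - fword [\<xi>] - fword [\<eta>]) * fword v) =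
            \<phi> ((u @ [0] @ v)[length u := \<xi> + \<eta>]) - (\<phi> ((u @ [0] @ v)[length u := \<xi>])
            + \<phi> ((u @ [0] @ v)[length u := \<eta>]))"
          unfolding eq by (simp only: lin_diffD[OF lin_ext] lin_addD[OF lin_ext] ext_fword diff_diff_eq)
        then show ?thesis
          using \<phi>[unfolded multilin_def, rule_format, of "length u" "u @ [0] @ v" \<xi> \<eta>]
          by (simp add: cg_def)
      qed
      then show ?thesis by (simp add: K_def)
    qed
    moreover have "fword [sc c \<xi>] - fscal c * fword [\<xi>] \<in> K" for c \<xi>
    proof -
      have "ext \<phi> (fword u * (fword [sc c \<xi>] - fscal c * fword [\<xi>]) * fword v) \<in> J" for u v
      proof -
        have "fword u * (fscal c * fword [\<xi>]) * fword v = fscal c * (fword u * fword [\<xi>] * fword v)"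
          by (simp add: mult.assoc fscal_left_commute[of "fword u"])
        then have "fword u * (fword [sc c \<xi>] - fscal c * fword [\<xi>]) * fword v =
            fword ((u @ [0] @ v)[length u := sc c \<xi>])
            - fscal c * fword ((u @ [0] @ v)[length u := \<xi>])"
          by (simp only: right_diff_distrib left_diff_distrib upd)
        then show ?thesis
          using \<phi>[unfolded multilin_def, rule_format, of "length u" "u @ [0] @ v" \<xi>]
          by (simp add: lin_diffD[OF lin_ext] lin_scalD[OF lin_ext] cg_def)
      qed
      then show ?thesis by (simp add: K_def)
    qed
    ultimately show ?thesis
      by (auto simp: linear_relations_def single_eq_fscal_fword)
  qed
  ultimately have "J \<subseteq> K"
    by (rule J_minimal)
  with p have "ext \<phi> (fword [] * p * fword []) \<in> J"
    unfolding K_def by blast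
  then show ?thesis by simp
qed

lemma multilin_cg: "multilin \<phi> \<Longrightarrow> cg p q \<Longrightarrow> cg (ext \<phi> p) (ext \<phi> q)"
  using multilin_J[of \<phi> "p - q"] by (simp add: cg_def lin_diffD)

lemma fword_update: "i < length w \<Longrightarrow> fword (w[i := x]) = fword (take i w) * fword [x] * fword (drop (Suc i) w)"
  by (simp add: upd_conv_take_nth_drop fword_append[symmetric])

lemma multilin_fword: "multilin fword"
proof (rule multilinI)
  fix w :: "'a list" and i \<xi> \<eta>
  assume i: "i < length w"
  show "cg (fword (w[i := \<xi> + \<eta>])) (fword (w[i := \<xi>]) + fword (w[i := \<eta>]))"
    using cg_right[OF cg_left[OF fword_add]] by (simp add: fword_update[OF i] algebra_simps)
next
  fix w :: "'a list" and i \<xi> c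
  assume i: "i < length w"
  have "cg (fword (w[i := sc c \<xi>])) (fword (take i w) * (fscal c * fword [\<xi>]) * fword (drop (Suc i) w))"
    by (simp add: fword_update[OF i] cg_right cg_left fword_scale)
  also have "fword (take i w) * (fscal c * fword [\<xi>]) * fword (drop (Suc i) w) = fscal c * fword (w[i := \<xi>])"
    by (simp add: fword_update[OF i] mult.assoc fscal_left_commute[of "fword (take i w)"])
  finally show "cg (fword (w[i := sc c \<xi>])) (fscal c * fword (w[i := \<xi>]))" .
qed

lemma multilin_add: "multilin \<phi> \<Longrightarrow> multilin \<psi> \<Longrightarrow> multilin (\<lambda>w. \<phi> w + \<psi> w)"
proof (intro multilinI)
  fix w :: "'a list" and i \<xi> \<eta>
  assume *: "multilin \<phi>" "multilin \<psi>" "i < length w"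
  then have "cg (\<phi> (w[i := \<xi> + \<eta>]) + \<psi> (w[i := \<xi> + \<eta>]))
      ((\<phi> (w[i := \<xi>]) + \<phi> (w[i := \<eta>])) + (\<psi> (w[i := \<xi>]) + \<psi> (w[i := \<eta>])))"
    by (intro cg_add) (auto simp: multilin_def)
  then show "cg (\<phi> (w[i := \<xi> + \<eta>]) + \<psi> (w[i := \<xi> + \<eta>]))
      (\<phi> (w[i := \<xi>]) + \<psi> (w[i := \<xi>]) + (\<phi> (w[i := \<eta>]) + \<psi> (w[i := \<eta>])))"
    by (simp add: algebra_simps)
next
  fix w :: "'a list" and i \<xi> c
  assume *: "multilin \<phi>" "multilin \<psi>" "i < length w"
  then show "cg (\<phi> (w[i := sc c \<xi>]) + \<psi> (w[i := sc c \<xi>])) (fscal c * (\<phi> (w[i := \<xi>]) + \<psi> (w[i := \<xi>])))"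
    unfolding distrib_left by (intro cg_add) (auto simp: multilin_def)
qed

lemma multilin_zero: "multilin (\<lambda>w. 0)"
  by (intro multilinI) simp_all

lemma multilin_sum: "(\<And>i. i \<in> A \<Longrightarrow> multilin (\<phi> i)) \<Longrightarrow> multilin (\<lambda>w. \<Sum>i\<in>A. \<phi> i w)"
  by (induction A rule: infinite_finite_induct) (auto intro: multilin_zero multilin_add)

text \<open>Updates preserve the length, so formulas whose coefficients or index sets depend on the
  length can be treated one length at a time.\<close>

lemma multilin_length:
  assumes "\<And>n. multilin (\<phi> n)"
  shows "multilin (\<lambda>w. \<phi> (length w) w)"
  using assms by (auto simp: multilin_def)

lemma multilin_fscal: "multilin \<phi> \<Longrightarrow> multilin (\<lambda>w. fscal c * \<phi> w)"
proof (intro multilinI)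
  fix w :: "'a list" and i \<xi> \<eta>
  assume "multilin \<phi>" "i < length w"
  then show "cg (fscal c * \<phi> (w[i := \<xi> + \<eta>])) (fscal c * \<phi> (w[i := \<xi>]) + fscal c * \<phi> (w[i := \<eta>]))"
    unfolding distrib_left[symmetric] by (intro cg_left) (auto simp: multilin_def)
next
  fix w :: "'a list" and i \<xi> d
  assume "multilin \<phi>" "i < length w"
  then have "cg (fscal c * \<phi> (w[i := sc d \<xi>])) (fscal c * (fscal d * \<phi> (w[i := \<xi>])))"
    by (intro cg_left) (auto simp: multilin_def)
  then show "cg (fscal c * \<phi> (w[i := sc d \<xi>])) (fscal d * (fscal c * \<phi> (w[i := \<xi>])))"
    by (simp add: fscal_fscal mult.commute)
qed

lemma multilin_if: "(P \<Longrightarrow> multilin \<phi>) \<Longrightarrow> multilin (\<lambda>w. if P then \<phi> w else 0)"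
  by (cases P) (auto simp: multilin_zero)

lemma multilin_if_length: "multilin \<phi> \<Longrightarrow> multilin (\<lambda>w. if P (length w) then \<phi> w else 0)"
  by (rule multilin_length[of "\<lambda>n w. if P n then \<phi> w else 0"]) (rule multilin_if)

lemma permute_list_update:
  assumes "\<sigma> permutes {..<length w}" "i < length w"
  shows "permute_list \<sigma> (w[i := x]) = (permute_list \<sigma> w)[Hilbert_Choice.inv \<sigma> i := x]"
proof (rule nth_equalityI)
  fix k assume k: "k < length (permute_list \<sigma> (w[i := x]))"
  then have "\<sigma> k < length w"
    using permutes_in_image[OF assms(1), of k] by simp
  moreover have "\<sigma> k = i \<longleftrightarrow> k = Hilbert_Choice.inv \<sigma> i"
    using permutes_inv_eq[OF assms(1), of i k] by auto
  ultimately show "permute_list \<sigma> (w[i := x]) ! k = (permute_list \<sigma> w)[Hilbert_Choice.inv \<sigma> i := x] ! k"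
    using assms k
    by (cases "\<sigma> k = i") (simp_all add: permute_list_nth nth_list_update permutes_inv_eq[OF assms(1)])
qed simp

text \<open>Slot \<open>i\<close> of the word becomes slot
  \<open>Hilbert_Choice.inv \<sigma> i\<close> of the permuted word. The guard lets one fixed
  \<sigma> be used for words of all lengths.\<close>

lemma multilin_permute:
  assumes \<phi>: "multilin \<phi>"
  shows "multilin (\<lambda>w. if \<sigma> permutes {..<length w} then \<phi> (permute_list \<sigma> w) else 0)"
proof -
  have *: "Hilbert_Choice.inv \<sigma> i < length w" if "\<sigma> permutes {..<length w}" "i < length w"
    for w :: "'a list" and i
    using that permutes_in_image[OF permutes_inv[OF that(1)]] by simp
  show ?thesis
    using \<phi> * by (intro multilinI) (auto simp: permute_list_update multilin_def)
qed

end


section \<open>Symmetrization\<close>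

definition fsym :: "'a list \<Rightarrow> 'a list \<Rightarrow>\<^sub>0 'k::field_char_0"
  where "fsym w = fscal (1 / fact (length w)) * (\<Sum>\<sigma> | \<sigma> permutes {..<length w}. fword (permute_list \<sigma> w))"

abbreviation Sym :: "('a list \<Rightarrow>\<^sub>0 'k::field_char_0) \<Rightarrow> ('a, 'k) free_alg"
  where "Sym \<equiv> ext fsym"

lemma fsym_permute_list:
  assumes "\<tau> permutes {..<length w}"
  shows "fsym (permute_list \<tau> w) = (fsym w :: 'a list \<Rightarrow>\<^sub>0 'k::field_char_0)"
proof -
  let ?F = "fword :: 'a list \<Rightarrow> ('a, 'k) free_alg"
  have "(\<Sum>\<sigma> | \<sigma> permutes {..<length w}. ?F (permute_list \<sigma> (permute_list \<tau> w)))
      = (\<Sum>\<sigma> | \<sigma> permutes {..<length w}. ?F (permute_list (\<tau> \<circ> \<sigma>) w))"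
    by (intro sum.cong) (simp_all add: permute_list_compose)
  also have "\<dots> = (\<Sum>\<sigma> | \<sigma> permutes {..<length w}. ?F (permute_list \<sigma> w))"
    by (rule setum_permutations_compose_left[OF assms, symmetric])
  finally show ?thesis
    by (simp add: fsym_def)
qed

lemma fsym_mset: "mset u = mset v \<Longrightarrow> fsym u = fsym v"
  by (metis fsym_permute_list mset_eq_permutation)

lemma of_nat_eq_fscal: "of_nat n = fscal (of_nat n)"
  by (induction n) (simp_all add: fscal_add)

lemma sum_const_fscal: "(\<Sum>i\<in>A. p) = fscal (of_nat (card A)) * p"
  by (simp only: sum_constant of_nat_eq_fscal)

lemma Sym_fsym [simp]: "Sym (fsym w) = fsym w"
proof -
  have "Sym (fsym w) = fscal (1 / fact (length w)) * (\<Sum>\<sigma> | \<sigma> permutes {..<length w}. fsym w)"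
    by (subst fsym_def) (simp add: lin_scalD lin_sumD fsym_permute_list del: sum_constant)
  also have "\<dots> = fscal (1 / fact (length w) * fact (length w)) * fsym w"
    by (simp only: sum_const_fscal fscal_fscal card_permutations[OF card_lessThan finite_lessThan] of_nat_fact)
  finally show ?thesis by simp
qed

lemma Sym_Sym [simp]: "Sym (Sym p) = Sym p"
  by (rule lin_eqI[OF lin_compose[OF lin_ext lin_ext] lin_ext]) simp

lemma Sym_1 [simp]: "Sym 1 = (1 :: 'a list \<Rightarrow>\<^sub>0 'k::field_char_0)"
proof -
  have "fsym [] = (1 :: ('a, 'k) free_alg)"
    by (simp add: fsym_def)
  then show ?thesis
    using ext_fword[of "fsym :: _ \<Rightarrow> ('a, 'k) free_alg" "[]"] by simp
qed

lemma fsym_replicate: "fsym (replicate n \<eta>) = fword (replicate n \<eta>)"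
proof -
  have "permute_list \<sigma> (replicate n \<eta>) = replicate n \<eta>" if "\<sigma> permutes {..<n}" for \<sigma>
    using that permutes_in_image[OF that] by (intro nth_equalityI) (auto simp: permute_list_nth)
  then have "(\<Sum>\<sigma> | \<sigma> permutes {..<n}. fword (permute_list \<sigma> (replicate n \<eta>)))
      = (\<Sum>\<sigma> | \<sigma> permutes {..<n}. fword (replicate n \<eta>) :: 'a list \<Rightarrow>\<^sub>0 'b)"
    by (intro sum.cong) auto
  then show ?thesis
    unfolding fsym_def
    by (simp only: length_replicate sum_const_fscal fscal_fscal
        card_permutations[OF card_lessThan finite_lessThan] of_nat_fact) simp
qed

lemma multilin_fsym: "multilin sc fsym"
proof -
  have "multilin sc (\<lambda>w. fscal (1 / fact n) *
      (\<Sum>\<sigma> | \<sigma> permutes {..<n}. if \<sigma> permutes {..<length w} then fword (permute_list \<sigma> w) else 0))" for n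
    by (intro multilin_fscal multilin_sum multilin_permute multilin_fword)
  from multilin_length[OF this, of "\<lambda>n. n"] show ?thesis
    by (simp add: fsym_def[abs_def])
qed

lemma Sym_cg: "cg sc p q \<Longrightarrow> cg sc (Sym p) (Sym q)"
  by (rule multilin_cg[OF multilin_fsym])

text \<open>All placements of \<theta> among the copies of \<eta> have the same symmetrization, and
  a permutation of the letters merely permutes the placements. So the average over (m + 1)!
  permutations reduces to one over m + 1 placements.\<close>

lemma fsym_Cons_replicate:
  "(fsym (\<theta> # replicate m \<eta>) :: 'a list \<Rightarrow>\<^sub>0 'k::field_char_0) =
    fscal (1 / of_nat (Suc m)) * (\<Sum>i<Suc m. fword ((replicate (Suc m) \<eta>)[i := \<theta>]))"
proof -
  let ?W = "replicate (Suc m) \<eta>" and ?n = "Suc m"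
    and ?F = "fword :: 'a list \<Rightarrow> ('a, 'k) free_alg" and ?Y = "fsym :: 'a list \<Rightarrow> ('a, 'k) free_alg"
  have each: "?Y (?W[i := \<theta>]) = ?Y (\<theta> # replicate m \<eta>)" if "i < ?n" for i
  proof (rule fsym_mset)
    have "mset (?W[i := \<theta>]) = add_mset \<theta> (mset ?W - {#\<eta>#})"
      using that by (simp only: mset_update length_replicate List.nth_replicate)
    then show "mset (?W[i := \<theta>]) = mset (\<theta> # replicate m \<eta>)"
      by simp
  qed
  have "(\<Sum>i<?n. ?F (permute_list \<sigma> (?W[i := \<theta>]))) = (\<Sum>i<?n. ?F (?W[i := \<theta>]))"
    if \<sigma>: "\<sigma> permutes {..<?n}" for \<sigma>
  proof -
    have W: "permute_list \<sigma> ?W = ?W"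
      using \<sigma> permutes_in_image[OF \<sigma>]
      by (intro nth_equalityI) (simp_all add: permute_list_nth del: replicate_Suc)
    have "(\<Sum>i<?n. ?F (permute_list \<sigma> (?W[i := \<theta>])))
        = (\<Sum>i<?n. ?F (?W[Hilbert_Choice.inv \<sigma> i := \<theta>]))"
      using \<sigma> W by (intro sum.cong) (simp_all add: permute_list_update del: replicate_Suc)
    also have "\<dots> = (\<Sum>i<?n. ?F (?W[i := \<theta>]))"
      by (rule sum.reindex_bij_betw[OF permutes_imp_bij[OF permutes_inv[OF \<sigma>]]])
    finally show ?thesis .
  qed
  note inner = this
  have "(\<Sum>\<sigma> | \<sigma> permutes {..<?n}. \<Sum>i<?n. ?F (permute_list \<sigma> (?W[i := \<theta>])))
      = (\<Sum>\<sigma> | \<sigma> permutes {..<?n}. \<Sum>i<?n. ?F (?W[i := \<theta>]) :: ('a, 'k) free_alg)"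
    by (rule sum.cong[OF refl]) (use inner in blast)
  also have "\<dots> = fscal (fact ?n) * (\<Sum>i<?n. ?F (?W[i := \<theta>]))"
    by (simp only: sum_const_fscal card_permutations[OF card_lessThan finite_lessThan] of_nat_fact)
  finally have total: "(\<Sum>i<?n. \<Sum>\<sigma> | \<sigma> permutes {..<?n}. ?F (permute_list \<sigma> (?W[i := \<theta>])))
      = fscal (fact ?n) * (\<Sum>i<?n. ?F (?W[i := \<theta>]) :: ('a, 'k) free_alg)"
    by (subst sum.swap)
  have "fscal (of_nat ?n) * ?Y (\<theta> # replicate m \<eta>) = (\<Sum>i<?n. ?Y (\<theta> # replicate m \<eta>) :: ('a, 'k) free_alg)"
    by (simp only: sum_const_fscal card_lessThan)
  also have "\<dots> = (\<Sum>i<?n. ?Y (?W[i := \<theta>]))"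
    by (intro sum.cong) (simp_all add: each del: replicate_Suc)
  also have "\<dots> = fscal (1 / fact ?n) * (\<Sum>i<?n. \<Sum>\<sigma> | \<sigma> permutes {..<?n}. ?F (permute_list \<sigma> (?W[i := \<theta>])))"
    by (simp add: fsym_def sum_distrib_left del: replicate_Suc sum.lessThan_Suc)
  also have "\<dots> = (\<Sum>i<?n. ?F (?W[i := \<theta>]))"
    unfolding total fscal_fscal by (simp del: replicate_Suc sum.lessThan_Suc fact_Suc)
  finally have "fscal (of_nat ?n) * ?Y (\<theta> # replicate m \<eta>) = (\<Sum>i<?n. ?F (?W[i := \<theta>]) :: ('a, 'k) free_alg)" .
  then have "fscal (1 / of_nat ?n) * (fscal (of_nat ?n) * ?Y (\<theta> # replicate m \<eta>))
      = fscal (1 / of_nat ?n) * (\<Sum>i<?n. ?F (?W[i := \<theta>]) :: ('a, 'k) free_alg)"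
    by (rule arg_cong)
  then show ?thesis
    unfolding fscal_fscal by (simp del: replicate_Suc sum.lessThan_Suc of_nat_Suc)
qed


subsection \<open>Polarization\<close>

text \<open>The multinomial expansion without commutativity: one summand for each word of
  indices.\<close>

lemma sum_power_eq_sum_lists:
  fixes e :: "'i \<Rightarrow> 'r::semiring_1"
  assumes "finite S"
  shows "(\<Sum>i\<in>S. e i) ^ k = (\<Sum>l | set l \<subseteq> S \<and> length l = k. prod_list (map e l))"
proof (induction k)
  case (Suc k)
  have "(\<Sum>l | set l \<subseteq> S \<and> length l = Suc k. prod_list (map e l))
      = (\<Sum>(l, i)\<in>{l. set l \<subseteq> S \<and> length l = k} \<times> S. e i * prod_list (map e l))"
    unfolding lists_length_Suc_eq
    by (subst sum.reindex) (auto simp: inj_on_def case_prod_beta o_def)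
  also have "\<dots> = (\<Sum>i\<in>S. e i) * (\<Sum>l | set l \<subseteq> S \<and> length l = k. prod_list (map e l))"
    by (simp add: sum.cartesian_product[symmetric] sum_product sum.swap[of _ S])
  finally show ?case
    by (simp add: Suc)
next
  case 0
  have "{l. set l \<subseteq> S \<and> length l = 0} = {[]}" by auto
  then show ?case by simp
qed

text \<open>Inclusion-exclusion, obtained by expanding the product of \<open>1 - f x\<close> over U,
  where \<open>f\<close> is the indicator of the complement of A: a subset S contributes exactly
  when its complement avoids A.\<close>

lemma sum_alternating_supersets:
  assumes "finite U" "A \<subseteq> U"
  shows "(\<Sum>S\<in>Pow U. if A \<subseteq> S then (- 1) ^ (card U - card S) else 0)
    = (if A = U then 1 else (0 :: 'r::comm_ring_1))"
proof -
  define f :: "'a \<Rightarrow> 'r" where "f x = (if x \<in> A then 0 else 1)" for x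
  have "(\<Prod>x\<in>U. 1 - f x) = (if A = U then 1 else 0)"
  proof (cases "A = U")
    case False
    then obtain x where "x \<in> U" "x \<notin> A" using assms by auto
    then show ?thesis
      using assms False by (auto simp: f_def intro!: prod_zero)
  qed (simp add: f_def)
  moreover have prod_f: "prod f (U - S) = (if A \<subseteq> S then 1 else 0)" if "S \<subseteq> U" for S
  proof (cases "A \<subseteq> S")
    case True
    then show ?thesis by (auto simp: f_def intro!: prod.neutral)
  next
    case False
    then obtain x where "x \<in> A" "x \<notin> S" by auto
    then show ?thesis
      using assms False by (auto simp: f_def intro!: prod_zero)
  qed
  moreover have "(\<Prod>x\<in>U. 1 - f x) = (\<Sum>S\<in>Pow U. if A \<subseteq> S then (- 1) ^ (card U - card S) else 0)"
    unfolding prod_diff_conv_sum'[OF assms(1), of "\<lambda>_. 1" f]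
    by (intro sum.cong) (simp_all add: prod_f)
  ultimately show ?thesis
    by simp
qed

text \<open>A word of length k in k indices that uses every index is a permutation, written as the
  list of its values.\<close>

lemma sum_surjective_words:
  "(\<Sum>l | set l = {..<k} \<and> length l = k. f (map ((!) w) l))
    = (\<Sum>\<sigma> | \<sigma> permutes {..<k}. f (permute_list \<sigma> w))" if "length w = k"
proof (rule sum.reindex_bij_witness[where
      i = "\<lambda>\<sigma>. map \<sigma> [0..<k]" and j = "\<lambda>l i. if i < k then l ! i else i"])
  fix l assume l: "l \<in> {l. set l = {..<k} \<and> length l = k}"
  then show "map (\<lambda>i. if i < k then l ! i else i) [0..<k] = l"
    by (intro nth_equalityI) auto
  have "distinct l"
    using l by (intro card_distinct) auto
  then have "bij_betw ((!) l) {..<k} {..<k}"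
    using l by (intro bij_betw_nth) auto
  then have "bij_betw (\<lambda>i. if i < k then l ! i else i) {..<k} {..<k}"
    by (subst bij_betw_cong[where g = "(!) l"]) auto
  then show "(\<lambda>i. if i < k then l ! i else i) \<in> {\<sigma>. \<sigma> permutes {..<k}}"
    by (intro CollectI bij_imp_permutes) auto
  show "f (permute_list (\<lambda>i. if i < k then l ! i else i) w) = f (map ((!) w) l)"
    using l that by (intro arg_cong[where f = f] nth_equalityI) (auto simp: permute_list_def)
next
  fix \<sigma> assume "\<sigma> \<in> {\<sigma>. \<sigma> permutes {..<k}}"
  then have \<sigma>: "\<sigma> permutes {..<k}" by simp
  then show "(\<lambda>i. if i < k then map \<sigma> [0..<k] ! i else i) = \<sigma>"
    by (auto simp: fun_eq_iff permutes_not_in)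
  show "map \<sigma> [0..<k] \<in> {l. set l = {..<k} \<and> length l = k}"
    using permutes_image[OF \<sigma>] by (simp add: atLeast0LessThan)
qed

lemma fword_replicate: "(fword (replicate k x) :: 'a list \<Rightarrow>\<^sub>0 'k::comm_ring_1) = fword [x] ^ k"
proof (induction k)
  case (Suc k)
  then show ?case
    using fword_Cons[of x "replicate k x", where 'b = 'k] by simp
qed simp

lemma fword_map: "prod_list (map (\<lambda>i. fword [f i]) l) = (fword (map f l) :: 'a list \<Rightarrow>\<^sub>0 'k::comm_ring_1)"
proof (induction l)
  case (Cons i l)
  then show ?case
    using fword_Cons[of "f i" "map f l", where 'b = 'k] by simp
qed simp

lemma cg_power: "cg sc p q \<Longrightarrow> cg sc (p ^ k) (q ^ k)"
  by (induction k) (auto intro: cg_mult)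

text \<open>Expand the k-th power of each partial sum of letters into index words. The alternating
  sum over S retains only the words that use every index, and these are the permutations.\<close>

lemma fsym_polarization:
  fixes sc :: "'k::field_char_0 \<Rightarrow> 'a::ab_group_add \<Rightarrow> 'a"
  shows "cg sc (fsym w) (fscal (1 / fact (length w)) * (\<Sum>S\<in>Pow {..<length w}.
    fscal ((- 1) ^ (length w - card S)) * fword (replicate (length w) (\<Sum>i\<in>S. w ! i))))"
proof -
  define k where "k = length w"
  let ?e = "\<lambda>i. fword [w ! i] :: ('a, 'k) free_alg" and ?L = "{l. set l \<subseteq> {..<k} \<and> length l = k}"
  have fin: "finite ?L"
    by (rule finite_lists_length_eq) simp
  have power: "(\<Sum>i\<in>S. ?e i) ^ k = (\<Sum>l\<in>?L. if set l \<subseteq> S then fword (map ((!) w) l) else 0)"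
    if S: "S \<subseteq> {..<k}" for S
  proof -
    have "(\<Sum>i\<in>S. ?e i) ^ k = (\<Sum>l | set l \<subseteq> S \<and> length l = k. fword (map ((!) w) l))"
      by (simp add: sum_power_eq_sum_lists finite_subset[OF S] fword_map)
    also have "\<dots> = (\<Sum>l\<in>?L. if set l \<subseteq> S then fword (map ((!) w) l) else 0)"
      using S fin by (intro sum.mono_neutral_cong_left) auto
    finally show ?thesis .
  qed
  have "cg sc (\<Sum>S\<in>Pow {..<k}. fscal ((- 1) ^ (k - card S)) * fword (replicate k (\<Sum>i\<in>S. w ! i)))
      (\<Sum>S\<in>Pow {..<k}. fscal ((- 1) ^ (k - card S)) * (\<Sum>i\<in>S. ?e i) ^ k)"
    unfolding fword_replicate by (intro cg_sum cg_left cg_power fword_sum)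
  also have "(\<Sum>S\<in>Pow {..<k}. fscal ((- 1) ^ (k - card S)) * (\<Sum>i\<in>S. ?e i) ^ k)
      = (\<Sum>S\<in>Pow {..<k}. \<Sum>l\<in>?L. fscal (if set l \<subseteq> S then (- 1) ^ (k - card S) else 0) * fword (map ((!) w) l))"
    by (intro sum.cong) (auto simp: power sum_distrib_left intro!: sum.cong)
  also have "\<dots> = (\<Sum>l\<in>?L. fscal (\<Sum>S\<in>Pow {..<k}. if set l \<subseteq> S then (- 1) ^ (k - card S) else 0) * fword (map ((!) w) l))"
    by (subst sum.swap) (simp add: fscal_sum sum_distrib_right)
  also have "\<dots> = (\<Sum>l\<in>?L. if set l = {..<k} then fword (map ((!) w) l) else 0)"
  proof (rule sum.cong[OF refl])
    fix l assume "l \<in> ?L"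
    then have "(\<Sum>S\<in>Pow {..<k}. if set l \<subseteq> S then (- 1) ^ (k - card S) else 0)
        = (if set l = {..<k} then 1 else (0 :: 'k))"
      using sum_alternating_supersets[of "{..<k}" "set l", where 'r = 'k, unfolded card_lessThan] by simp
    then show "fscal (\<Sum>S\<in>Pow {..<k}. if set l \<subseteq> S then (- 1) ^ (k - card S) else (0 :: 'k))
        * fword (map ((!) w) l) = (if set l = {..<k} then fword (map ((!) w) l) else 0)"
      by simp
  qed
  also have "\<dots> = (\<Sum>l | set l = {..<k} \<and> length l = k. fword (map ((!) w) l))"
    using fin by (intro sum.mono_neutral_cong_right) auto
  also have "\<dots> = (\<Sum>\<sigma> | \<sigma> permutes {..<k}. fword (permute_list \<sigma> w))"
    by (rule sum_surjective_words) (simp add: k_def)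
  finally show ?thesis
    unfolding fsym_def k_def[symmetric] by (rule cg_left[OF cg_sym])
qed

text \<open>Powers of single elements span the symmetric tensors up to \<open>cg\<close>, so
  identities between operators on symmetric tensors need only be verified on
  \<open>replicate k \<eta>\<close>.\<close>

lemma polarization:
  fixes sc :: "'k::field_char_0 \<Rightarrow> 'a::ab_group_add \<Rightarrow> 'a"
  assumes "lin \<Phi>" "lin \<Psi>" "\<And>p q. cg sc p q \<Longrightarrow> cg sc (\<Phi> p) (\<Phi> q)" "\<And>p q. cg sc p q \<Longrightarrow> cg sc (\<Psi> p) (\<Psi> q)"
    and "\<And>k \<eta>. cg sc (\<Phi> (fword (replicate k \<eta>))) (\<Psi> (fword (replicate k \<eta>)))"
  shows "cg sc (\<Phi> (Sym p)) (\<Psi> (Sym p))"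
proof (rule lin_cgI[where \<Phi> = "\<lambda>p. \<Phi> (Sym p)" and \<Psi> = "\<lambda>p. \<Psi> (Sym p)"])
  show "lin (\<lambda>p. \<Phi> (Sym p))" "lin (\<lambda>p. \<Psi> (Sym p))"
    using assms(1,2) by (simp_all add: lin_compose[OF _ lin_ext])
  fix w :: "'a list"
  define q :: "('a, 'k) free_alg" where "q = fscal (1 / fact (length w)) * (\<Sum>S\<in>Pow {..<length w}.
    fscal ((- 1) ^ (length w - card S)) * fword (replicate (length w) (\<Sum>i\<in>S. w ! i)))"
  have q: "cg sc (Sym (fword w)) q"
    using fsym_polarization[of sc w] by (simp add: q_def)
  have "cg sc (\<Phi> (Sym (fword w))) (\<Phi> q)"
    using q by (rule assms)
  also have "cg sc (\<Phi> q) (\<Psi> q)"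
    unfolding q_def
    by (simp add: lin_scalD[OF assms(1)] lin_scalD[OF assms(2)] lin_sumD[OF assms(1)] lin_sumD[OF assms(2)])
      (intro cg_left cg_sum assms)
  also have "cg sc (\<Psi> q) (\<Psi> (Sym (fword w)))"
    using cg_sym[OF q] by (rule assms)
  finally show "cg sc (\<Phi> (Sym (fword w))) (\<Psi> (Sym (fword w)))" .
qed


section \<open>Bernoulli numbers\<close>

text \<open>\<open>bern n\<close> is \<open>B\<^sub>n / n!\<close>, the coefficient of \<open>t\<^sup>n\<close> in \<open>t / (exp t - 1)\<close>.\<close>

definition bern :: "nat \<Rightarrow> real"
  where "bern n = fps_nth (inverse (Abs_fps (\<lambda>n. 1 / fact (Suc n)))) n"

lemma bern_recurrence: "(\<Sum>i\<le>n. bern i / fact (Suc (n - i))) = (if n = 0 then 1 else 0)"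
proof -
  let ?G = "Abs_fps (\<lambda>n. 1 / fact (Suc n)) :: real fps"
  have "(\<Sum>i\<le>n. bern i / fact (Suc (n - i))) = fps_nth (inverse ?G * ?G) n"
    by (simp add: fps_mult_nth bern_def atLeast0AtMost)
  also have "inverse ?G * ?G = 1"
    by (rule inverse_mult_eq_1) simp
  finally show ?thesis by simp
qed

lemma bern_0 [simp]: "bern 0 = 1"
  using bern_recurrence[of 0] by simp

lemma two_power_le_fact: "2 ^ n \<le> (fact (Suc n) :: real)"
proof (induction n)
  case (Suc n)
  have "2 * 2 ^ n \<le> real (Suc (Suc n)) * fact (Suc n)"
    using Suc by (intro mult_mono) auto
  then show ?case by (simp only: power_Suc fact_Suc[of "Suc n"])
qed simp

text \<open>The recurrence expresses \<open>bern n\<close> through earlier values with weights at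
  most \<open>(1 / 2) ^ (n - i)\<close>, whose sum is below 1. Boundedness is enough later on: the
  convergence in \<open>wnorm_bern_word\<close> comes from the brackets.\<close>

lemma abs_bern_le_1: "\<bar>bern n\<bar> \<le> 1"
proof (induction n rule: less_induct)
  case (less n)
  show ?case
  proof (cases "n = 0")
    case False
    have "(\<Sum>i\<le>n. bern i / fact (Suc (n - i))) = (\<Sum>i<n. bern i / fact (Suc (n - i))) + bern n"
      using False by (simp add: lessThan_Suc_atMost[symmetric])
    then have "bern n = - (\<Sum>i<n. bern i / fact (Suc (n - i)))"
      using bern_recurrence[of n] False by simp
    then have "\<bar>bern n\<bar> = \<bar>\<Sum>i<n. bern i / fact (Suc (n - i))\<bar>"
      by simp
    also have "\<dots> \<le> (\<Sum>i<n. \<bar>bern i / fact (Suc (n - i))\<bar>)"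
      by (rule sum_abs)
    also have "\<dots> \<le> (\<Sum>i<n. (1 / 2) ^ (n - i))"
    proof (rule sum_mono)
      fix i assume "i \<in> {..<n}"
      then have "\<bar>bern i\<bar> \<le> 1" using less by simp
      then have "\<bar>bern i\<bar> / fact (Suc (n - i)) \<le> 1 / 2 ^ (n - i)"
        using two_power_le_fact by (intro frac_le) simp_all
      then show "\<bar>bern i / fact (Suc (n - i))\<bar> \<le> (1 / 2) ^ (n - i)"
        by (simp add: power_divide del: fact_Suc)
    qed
    also have "\<dots> = 1 - (1 / 2) ^ n"
    proof (induction n)
      case (Suc n)
      have "(\<Sum>i<Suc n. (1 / 2 :: real) ^ (Suc n - i)) = (\<Sum>i<n. 1 / 2 * (1 / 2) ^ (n - i)) + 1 / 2"
        by (simp add: Suc_diff_le)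
      then show ?case
        using Suc by (simp only: sum_distrib_left[symmetric]) (simp add: diff_divide_distrib)
    qed simp
    finally show ?thesis
      using zero_le_power[of "1 / 2 :: real" n] by linarith
  qed simp
qed

text \<open>Stated without a quotient, so that x = 0 is allowed; the auxiliary series has the
  coefficients of (exp (x t) - 1) / (x t).\<close>

lemma bern_fps_scaled:
  "Abs_fps (\<lambda>n. bern n * x ^ n) * (fps_exp x - 1) = fps_const x * fps_X"
proof -
  let ?B = "Abs_fps (\<lambda>n. bern n * x ^ n)" and ?G = "Abs_fps (\<lambda>n. x ^ n / fact (Suc n))"
  have "?B * ?G = 1"
  proof (rule fps_ext)
    fix n
    have "fps_nth (?B * ?G) n = (\<Sum>i\<le>n. bern i * x ^ i * (x ^ (n - i) / fact (Suc (n - i))))"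
      by (simp add: fps_mult_nth atLeast0AtMost del: fact_Suc)
    also have "\<dots> = (\<Sum>i\<le>n. x ^ n * (bern i / fact (Suc (n - i))))"
    proof (intro sum.cong refl)
      fix i assume "i \<in> {..n}"
      then have "x ^ n = x ^ i * x ^ (n - i)"
        by (simp add: power_add[symmetric])
      then show "bern i * x ^ i * (x ^ (n - i) / fact (Suc (n - i))) = x ^ n * (bern i / fact (Suc (n - i)))"
        by (simp del: fact_Suc)
    qed
    also have "\<dots> = fps_nth 1 n"
      unfolding sum_distrib_left[symmetric] bern_recurrence by simp
    finally show "fps_nth (?B * ?G) n = fps_nth 1 n" .
  qed
  moreover have "fps_exp x - 1 = ?G * (fps_const x * fps_X)"
  proof (rule fps_ext)
    fix n
    show "fps_nth (fps_exp x - 1) n = fps_nth (?G * (fps_const x * fps_X)) n"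
      by (cases n) (simp_all add: mult.assoc[symmetric] del: fact_Suc)
  qed
  ultimately show ?thesis
    by (simp add: mult.assoc[symmetric])
qed

text \<open>For f(t) = 1 / (exp t - 1) this is f(x) f(y) = f(x + y) (1 + f(x) + f(y)) in terms of
  B(x) = x t f(x t). With u, v, w the three differences exp - 1 it amounts to w = u v + u + v; the
  nonvanishing assumptions allow cancellation of u v w.\<close>

lemma bern_fps_identity:
  fixes x y :: real
  defines "B \<equiv> \<lambda>x. Abs_fps (\<lambda>n. bern n * x ^ n)"
  assumes "x \<noteq> 0" "y \<noteq> 0" "x + y \<noteq> 0"
  shows "(B x - B (x + y)) * B y * fps_const x + (B y - B (x + y)) * B x * fps_const y
    = fps_const (x * y) * fps_X * B (x + y)"
proof -
  define u v w where "u = fps_exp x - 1" and "v = fps_exp y - 1" and "w = fps_exp (x + y) - 1"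
  define cx cy where "cx = fps_const x" and "cy = fps_const y"
  have w: "w = u * v + u + v"
    by (simp add: u_def v_def w_def fps_exp_add_mult algebra_simps)
  have cxy: "fps_const (x + y) = cx + cy" "fps_const (x * y) = cx * cy"
    by (simp_all add: cx_def cy_def)
  have B: "B x * u = cx * fps_X" "B y * v = cy * fps_X" "B (x + y) * w = (cx + cy) * fps_X"
    unfolding cxy[symmetric] by (simp_all add: B_def u_def v_def w_def cx_def cy_def bern_fps_scaled)
  have nz: "u * v * w \<noteq> 0"
    using assms(2-4) by (simp add: u_def v_def w_def)
  have "((B x - B (x + y)) * B y * cx + (B y - B (x + y)) * B x * cy) * (u * v * w)
      = ((B x * u) * w - (B (x + y) * w) * u) * (B y * v) * cx + ((B y * v) * w - (B (x + y) * w) * v) * (B x * u) * cy"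
    by (simp add: algebra_simps)
  also have "\<dots> = cx * cy * fps_X * (B (x + y) * w) * (u * v)"
    unfolding B by (simp add: w algebra_simps)
  also have "\<dots> = (cx * cy * fps_X * B (x + y)) * (u * v * w)"
    by (simp add: algebra_simps)
  finally show ?thesis
    using nz by (simp add: cx_def[symmetric] cy_def[symmetric] cxy)
qed

text \<open>The coefficient of t^(n + 1) at y = 1. The differences of series have no constant term,
  which shifts the index to \<open>Suc a\<close>; \<open>x ^ Suc a - (x + 1) ^ Suc a\<close> is
  divisible by -1 and \<open>1 - (x + 1) ^ Suc a\<close> by -x with geometric quotients, and a
  common factor x is cancelled.\<close>

lemma bern_identity:
  fixes x :: real
  assumes "x \<noteq> 0" "x + 1 \<noteq> 0"
  shows "bern n * (x + 1) ^ n =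
    - (\<Sum>a\<le>n. bern (Suc a) * bern (n - a) * (\<Sum>i\<le>a. (x + 1) ^ i * (x ^ (a - i) + x ^ (n - a))))"
proof -
  let ?s = "x + 1"
  define B where "B = (\<lambda>x :: real. Abs_fps (\<lambda>n. bern n * x ^ n))"
  have coeff: "fps_nth ((B p - B q) * B r) (Suc n)
      = (\<Sum>a\<le>n. bern (Suc a) * bern (n - a) * ((p ^ Suc a - q ^ Suc a) * r ^ (n - a)))" for p q r
  proof -
    have "fps_nth ((B p - B q) * B r) (Suc n)
        = (\<Sum>b\<le>Suc n. (bern b * p ^ b - bern b * q ^ b) * (bern (Suc n - b) * r ^ (Suc n - b)))"
      by (simp add: fps_mult_nth B_def atLeast0AtMost)
    also have "\<dots> = (\<Sum>a\<le>n. (bern (Suc a) * p ^ Suc a - bern (Suc a) * q ^ Suc a) * (bern (n - a) * r ^ (n - a)))"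
      by (simp add: sum.atMost_Suc_shift del: sum.atMost_Suc)
    finally show ?thesis
      by (simp add: algebra_simps)
  qed
  have "(B x - B ?s) * B 1 * fps_const x + (B 1 - B ?s) * B x * fps_const 1
    = fps_const (x * 1) * fps_X * B ?s"
    using bern_fps_identity[of x 1] assms by (simp add: B_def)
  then have "fps_nth ((B x - B ?s) * B 1 * fps_const x + (B 1 - B ?s) * B x * fps_const 1) (Suc n)
      = fps_nth (fps_const (x * 1) * fps_X * B ?s) (Suc n)"
    by simp
  moreover have "fps_nth (fps_const (x * 1) * fps_X * B ?s) (Suc n) = x * (bern n * ?s ^ n)"
    by (simp add: B_def mult.assoc)
  ultimately have "fps_nth ((B x - B ?s) * B 1) (Suc n) * x + fps_nth ((B 1 - B ?s) * B x) (Suc n)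
      = x * (bern n * ?s ^ n)"
    by (simp only: fps_add_nth fps_mult_right_const_nth mult_1_right)
  then have main: "(\<Sum>a\<le>n. bern (Suc a) * bern (n - a) *
      ((x ^ Suc a - ?s ^ Suc a) * x + (1 - ?s ^ Suc a) * x ^ (n - a))) = x * (bern n * ?s ^ n)"
    unfolding coeff by (simp add: sum_distrib_right sum.distrib[symmetric] distrib_left mult.assoc)
  have "(x ^ Suc a - ?s ^ Suc a) * x + (1 - ?s ^ Suc a) * x ^ (n - a)
      = - x * (\<Sum>i\<le>a. ?s ^ i * (x ^ (a - i) + x ^ (n - a)))" for a
  proof -
    have "x ^ Suc a - ?s ^ Suc a = - (\<Sum>i\<le>a. ?s ^ i * x ^ (a - i))"
      using power_diff_sumr2[of ?s "Suc a" x]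
      by (simp add: lessThan_Suc_atMost algebra_simps del: power_Suc)
    moreover have "1 - ?s ^ Suc a = - x * (\<Sum>i\<le>a. ?s ^ i)"
      using power_diff_sumr2[of ?s "Suc a" 1]
      by (simp add: lessThan_Suc_atMost algebra_simps del: power_Suc)
    moreover have "(\<Sum>i\<le>a. ?s ^ i * (x ^ (a - i) + x ^ (n - a)))
        = (\<Sum>i\<le>a. ?s ^ i * x ^ (a - i)) + (\<Sum>i\<le>a. ?s ^ i) * x ^ (n - a)"
      by (simp only: distrib_left sum.distrib sum_distrib_right)
    moreover have "- S * x + - x * T * c = - x * (S + T * c)" for S T c
      by (simp add: algebra_simps)
    ultimately show ?thesis
      by (simp only:)
  qed
  then have "x * (bern n * ?s ^ n) = (\<Sum>a\<le>n. bern (Suc a) * bern (n - a) *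
      (- x * (\<Sum>i\<le>a. ?s ^ i * (x ^ (a - i) + x ^ (n - a)))))"
    unfolding main[symmetric] by simp
  also have "\<dots> = x * - (\<Sum>a\<le>n. bern (Suc a) * bern (n - a) * (\<Sum>i\<le>a. ?s ^ i * (x ^ (a - i) + x ^ (n - a))))"
    by (simp add: sum_distrib_left sum_negf[symmetric] algebra_simps)
  finally show ?thesis
    unfolding mult_left_cancel[OF assms(1)] .
qed

text \<open>
  The polynomials are dehomogenized: the powers of \<open>x\<close> and \<open>1\<close> stand for the numbers of factors
  \<open>ad \<eta>\<close> applied to the first and to the second argument of a bracket, and \<open>x + 1\<close> for \<open>ad \<eta>\<close>
  applied to the bracket itself.
\<close>

lemma bern_poly_identity:
  "Polynomial.smult (bern n) ([:1, 1:] ^ n) =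
    - (\<Sum>a\<le>n. \<Sum>i\<le>a. Polynomial.smult (bern (Suc a) * bern (n - a))
        ([:1, 1:] ^ i * (Polynomial.monom 1 (a - i) + Polynomial.monom 1 (n - a))))" (is "?P = ?Q")
proof (rule ccontr)
  assume "?P \<noteq> ?Q"
  then have "finite {x. poly (?P - ?Q) x = 0}"
    by (intro poly_roots_finite) simp
  \<comment> \<open>Values at all points other than the two excluded from
    \<open>bern_identity\<close> determine the polynomial, since a nonzero one has finitely many
    roots.\<close>
  moreover have "UNIV - {0, - 1} \<subseteq> {x. poly (?P - ?Q) x = 0}"
  proof
    fix x :: real assume "x \<in> UNIV - {0, - 1}"
    then show "x \<in> {x. poly (?P - ?Q) x = 0}"
      using bern_identity[of x n]
      by (simp add: poly_sum poly_monom sum_distrib_left algebra_simps)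
  qed
  ultimately have "finite (UNIV - {0, - 1} :: real set)"
    by (rule finite_subset[rotated])
  then show False
    by (simp add: infinite_UNIV_char_0)
qed


section \<open>A Bernoulli identity for iterated brackets\<close>

context banach_lie_algebra
begin

lemma br_add_right: "br \<xi> (\<eta> + \<zeta>) = br \<xi> \<eta> + br \<xi> \<zeta>"
  and br_add_left: "br (\<xi> + \<eta>) \<zeta> = br \<xi> \<zeta> + br \<eta> \<zeta>"
  and br_sc_right: "br \<xi> (sc c \<eta>) = sc c (br \<xi> \<eta>)"
  and br_sc_left: "br (sc c \<xi>) \<eta> = sc c (br \<xi> \<eta>)"
  using linear_br_right[of \<xi>] linear_br_left[of \<zeta>] linear_br_left[of \<eta>]
  by (simp_all add: Vector_Spaces.linear_iff)

lemma br_scaleR_right: "br \<xi> (r *\<^sub>R \<eta>) = r *\<^sub>R br \<xi> \<eta>"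
  by (metis br_sc_right scale_of_real)

lemma br_zero_right [simp]: "br \<xi> 0 = 0"
  using br_scaleR_right[of \<xi> 0 0] by simp

lemma br_anti: "br \<xi> \<eta> = - br \<eta> \<xi>"
proof -
  have "0 = br (\<xi> + \<eta>) (\<xi> + \<eta>)"
    by (rule br_self[symmetric])
  also have "\<dots> = br \<xi> \<xi> + br \<xi> \<eta> + (br \<eta> \<xi> + br \<eta> \<eta>)"
    by (simp only: br_add_left br_add_right ac_simps)
  finally show ?thesis
    by (simp add: br_self eq_neg_iff_add_eq_0)
qed

lemma br_minus_right: "br \<xi> (- \<eta>) = - br \<xi> \<eta>"
  using br_scaleR_right[of \<xi> "-1" \<eta>] by simp

lemma br_derivation: "br \<eta> (br \<xi> \<zeta>) = br (br \<eta> \<xi>) \<zeta> + br \<xi> (br \<eta> \<zeta>)"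
proof -
  have "br \<eta> (br \<xi> \<zeta>) = - br \<xi> (br \<zeta> \<eta>) - br \<zeta> (br \<eta> \<xi>)"
    using jacobi[of \<eta> \<xi> \<zeta>] by (simp add: eq_neg_iff_add_eq_0 algebra_simps)
  then show ?thesis
    using br_anti[of \<zeta> \<eta>] br_anti[of \<zeta> "br \<eta> \<xi>"] by (simp add: br_minus_right)
qed

lemma br_sum_right: "br \<xi> (\<Sum>i\<in>A. f i) = (\<Sum>i\<in>A. br \<xi> (f i))"
  by (induction A rule: infinite_finite_induct) (simp_all add: br_add_right)

lemma funpow_br_zero [simp]: "(br \<eta> ^^ i) 0 = 0"
  by (induction i) simp_all

lemma funpow_br_minus: "(br \<eta> ^^ i) (- \<xi>) = - (br \<eta> ^^ i) \<xi>"
  by (induction i) (simp_all add: br_minus_right)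

text \<open>The map \<Psi> replaces the monomial of exponent r by the bracket of \<open>x r\<close>
  with \<open>z (n - r)\<close>. As \<open>br \<eta>\<close> is a derivation, multiplication by
  \<open>[:1, 1:]\<close> turns into an application of \<open>br \<eta>\<close>, so
  \<open>bern_poly_identity\<close> can be transported; antisymmetry in the first bracket absorbs
  the sign.\<close>

lemma bern_bracket_identity:
  fixes \<eta> \<xi> \<zeta> :: 'a
  defines "x \<equiv> \<lambda>r. (br \<eta> ^^ r) \<xi>" and "z \<equiv> \<lambda>r. (br \<eta> ^^ r) \<zeta>"
  shows "(\<Sum>a\<le>n. \<Sum>i\<le>a. (bern (Suc a) * bern (n - a)) *\<^sub>R
      ((br \<eta> ^^ i) (br (z (n - a)) (x (a - i))) - (br \<eta> ^^ i) (br (x (n - a)) (z (a - i)))))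
    = bern n *\<^sub>R (br \<eta> ^^ n) (br \<xi> \<zeta>)"
proof -
  define \<Psi> :: "nat \<Rightarrow> real poly \<Rightarrow> 'a"
    where "\<Psi> n Q = (\<Sum>r\<le>n. Polynomial.coeff Q r *\<^sub>R br (x r) (z (n - r)))" for n Q
  have [simp]: "br \<eta> (x r) = x (Suc r)" "br \<eta> (z r) = z (Suc r)" for r
    by (simp_all add: x_def z_def)
  have \<Psi>_smult: "\<Psi> n (Polynomial.smult c Q) = c *\<^sub>R \<Psi> n Q" for n c Q
    by (simp add: \<Psi>_def scaleR_sum_right)
  have \<Psi>_add: "\<Psi> n (P + Q) = \<Psi> n P + \<Psi> n Q" for n P Q
    by (simp add: \<Psi>_def scaleR_add_left sum.distrib)
  have \<Psi>_minus: "\<Psi> n (- Q) = - \<Psi> n Q" for n Q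
    using \<Psi>_smult[of n "-1" Q] by simp
  have \<Psi>_sum: "\<Psi> n (\<Sum>i\<in>A. f i) = (\<Sum>i\<in>A. \<Psi> n (f i))" for n f and A :: "nat set"
    by (induction A rule: infinite_finite_induct) (simp_all add: \<Psi>_add, simp_all add: \<Psi>_def)
  have \<Psi>_step: "\<Psi> (Suc n) ([:1, 1:] * Q) = br \<eta> (\<Psi> n Q)" if "Polynomial.degree Q \<le> n" for n Q
  proof -
    have "\<Psi> (Suc n) ([:1, 1:] * Q)
        = (\<Sum>r\<le>Suc n. Polynomial.coeff Q r *\<^sub>R br (x r) (z (Suc n - r)))
        + (\<Sum>r\<le>Suc n. Polynomial.coeff (pCons 0 Q) r *\<^sub>R br (x r) (z (Suc n - r)))"
      by (simp add: \<Psi>_def scaleR_add_left sum.distrib del: sum.atMost_Suc)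
    also have "(\<Sum>r\<le>Suc n. Polynomial.coeff Q r *\<^sub>R br (x r) (z (Suc n - r)))
        = (\<Sum>r\<le>n. Polynomial.coeff Q r *\<^sub>R br (x r) (z (Suc (n - r))))"
      using that by (simp add: coeff_eq_0 Suc_diff_le)
    also have "(\<Sum>r\<le>Suc n. Polynomial.coeff (pCons 0 Q) r *\<^sub>R br (x r) (z (Suc n - r)))
        = (\<Sum>r\<le>n. Polynomial.coeff Q r *\<^sub>R br (x (Suc r)) (z (n - r)))"
      by (simp add: sum.atMost_Suc_shift del: sum.atMost_Suc)
    finally show ?thesis
      by (simp add: \<Psi>_def br_sum_right br_scaleR_right br_derivation[of \<eta>] scaleR_add_right sum.distrib)
  qed
  have \<Psi>_monom: "\<Psi> (i + n) ([:1, 1:] ^ i * Polynomial.monom 1 r) = (br \<eta> ^^ i) (br (x r) (z (n - r)))"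
    if "r \<le> n" for i n r
  proof (induction i)
    case 0
    have "\<Psi> n (Polynomial.monom 1 r) = (\<Sum>k\<le>n. if k = r then br (x r) (z (n - r)) else 0)"
      unfolding \<Psi>_def by (intro sum.cong) auto
    with that show ?case by simp
  next
    case (Suc i)
    have "Polynomial.degree ([:1, 1:] ^ i * Polynomial.monom 1 r :: real poly) \<le> i + n"
      using that degree_power_le[of "[:1, 1:] :: real poly" i] degree_monom_le[of "1 :: real" r]
      by (intro order.trans[OF degree_mult_le]) simp
    from \<Psi>_step[OF this] show ?case
      by (simp only: Suc mult.assoc power_Suc add_Suc funpow.simps o_apply)
  qed
  have "bern n *\<^sub>R (br \<eta> ^^ n) (br \<xi> \<zeta>) = \<Psi> n (Polynomial.smult (bern n) ([:1, 1:] ^ n))"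
    using \<Psi>_monom[of 0 0 n] by (simp add: \<Psi>_smult x_def z_def)
  also have "\<dots> = - (\<Sum>a\<le>n. \<Sum>i\<le>a. (bern (Suc a) * bern (n - a)) *\<^sub>R
      (\<Psi> n ([:1, 1:] ^ i * Polynomial.monom 1 (a - i)) + \<Psi> n ([:1, 1:] ^ i * Polynomial.monom 1 (n - a))))"
    by (simp add: bern_poly_identity \<Psi>_minus \<Psi>_sum \<Psi>_smult \<Psi>_add distrib_left)
  also have "\<dots> = (\<Sum>a\<le>n. \<Sum>i\<le>a. (bern (Suc a) * bern (n - a)) *\<^sub>R
      ((br \<eta> ^^ i) (br (z (n - a)) (x (a - i))) - (br \<eta> ^^ i) (br (x (n - a)) (z (a - i)))))"
    unfolding sum_negf[symmetric]
  proof (intro sum.cong refl)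
    fix a i assume "a \<in> {..n}" "i \<in> {..a}"
    then have "\<Psi> n ([:1, 1:] ^ i * Polynomial.monom 1 (a - i)) = (br \<eta> ^^ i) (br (x (a - i)) (z (n - a)))"
      "\<Psi> n ([:1, 1:] ^ i * Polynomial.monom 1 (n - a)) = (br \<eta> ^^ i) (br (x (n - a)) (z (a - i)))"
      using \<Psi>_monom[of "a - i" "n - i" i] \<Psi>_monom[of "n - a" "n - i" i] by simp_all
    then show "- ((bern (Suc a) * bern (n - a)) *\<^sub>R
        (\<Psi> n ([:1, 1:] ^ i * Polynomial.monom 1 (a - i)) + \<Psi> n ([:1, 1:] ^ i * Polynomial.monom 1 (n - a)))) =
      (bern (Suc a) * bern (n - a)) *\<^sub>R
        ((br \<eta> ^^ i) (br (z (n - a)) (x (a - i))) - (br \<eta> ^^ i) (br (x (n - a)) (z (a - i))))"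
      using br_anti[of "z (n - a)" "x (a - i)"]
      by (simp add: funpow_br_minus algebra_simps)
  qed
  finally show ?thesis by simp
qed

end


section \<open>Left multiplication on symmetric tensors\<close>

lemma sum_triangle:
  "(\<Sum>j\<le>k. \<Sum>a\<le>k - j. g j a) = (\<Sum>n\<le>k. \<Sum>a\<le>n. g (n - a) a)" for k :: nat
  unfolding sum.Sigma[OF finite_atMost ballI[OF finite_atMost]]
  by (rule sum.reindex_bij_witness[where i = "\<lambda>(n, a). (n - a, a)" and j = "\<lambda>(j, a). (j + a, a)"]) auto

lemma sum_triangle_commute:
  "(\<Sum>j\<le>k. \<Sum>a\<le>k - j. g j a) = (\<Sum>j\<le>k. \<Sum>a\<le>k - j. g a j)" for k :: nat
  unfolding sum.Sigma[OF finite_atMost ballI[OF finite_atMost]]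
  by (rule sum.reindex_bij_witness[where i = "\<lambda>(j, a). (a, j)" and j = "\<lambda>(j, a). (a, j)"]) auto

lemma foldr_replicate: "foldr f (replicate n x) y = (f x ^^ n) y"
  by (induction n) simp_all

context banach_lie_algebra
begin

abbreviation rscal :: "real \<Rightarrow> ('a, 'k) free_alg"
  where "rscal r \<equiv> fscal (of_real r)"

text \<open>The nested bracket consumes the first j letters instead of averaging over all choices of
  j letters; \<open>lmul\<close> symmetrizes before and after, which makes the choice immaterial. As
  \<open>bern j\<close> is the Bernoulli number divided by j!, the coefficient is (k choose j) times
  the Bernoulli number.\<close>

definition bern_word :: "'a \<Rightarrow> 'a list \<Rightarrow> ('a, 'k) free_alg"
  where "bern_word \<xi> w = (\<Sum>j\<le>length w. rscal (fact (length w) / fact (length w - j) * bern j) *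
    fword (foldr br (take j w) \<xi> # drop j w))"

text \<open>
  On powers, \<open>lmul \<xi> (\<eta>\<^sup>k) = (\<Sum>j\<le>k. (k choose j) B\<^sub>j (ad \<eta>)\<^sup>j \<xi> \<cdot> \<eta>\<^bsup>k - j\<^esup>)\<close>, which is the
  expression of left multiplication by \<open>\<xi>\<close> in the universal enveloping algebra in terms of
  symmetric tensors.
\<close>

definition lmul :: "'a \<Rightarrow> (('a, 'k) free_alg) \<Rightarrow> ('a, 'k) free_alg"
  where "lmul \<xi> p = Sym (ext (bern_word \<xi>) (Sym p))"

lemma lin_lmul: "lin (lmul \<xi>)"
  unfolding lmul_def[abs_def] by (intro lin_compose[OF lin_ext] lin_ext)

lemma Sym_lmul [simp]: "Sym (lmul \<xi> p) = lmul \<xi> p"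
  and lmul_Sym [simp]: "lmul \<xi> (Sym p) = lmul \<xi> p"
  by (simp_all add: lmul_def)

lemma fword_Cons_sum: "cg sc (fword ((\<Sum>i\<in>A. f i) # v)) (\<Sum>i\<in>A. fword (f i # v))"
  using cg_right[OF fword_sum[where sc = sc, of f A], where r = "fword v"]
  by (simp add: sum_distrib_right fword_append[symmetric])

lemma fword_Cons_add: "cg sc (fword ((\<xi> + \<eta>) # v)) (fword (\<xi> # v) + fword (\<eta> # v))"
  using cg_right[OF fword_add[where sc = sc], where r = "fword v"]
  by (simp add: distrib_right fword_append[symmetric])

lemma fword_Cons_diff: "cg sc (fword ((\<xi> - \<eta>) # v)) (fword (\<xi> # v) - fword (\<eta> # v))"
  using cg_right[OF fword_diff[where sc = sc], where r = "fword v"]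
  by (simp add: left_diff_distrib fword_append[symmetric])

lemma fword_Cons_sc: "cg sc (fword (sc c \<xi> # v)) (fscal c * fword (\<xi> # v))"
  using cg_right[OF fword_scale[where sc = sc], where r = "fword v"]
  by (simp add: mult.assoc fword_append[symmetric])

lemma fword_Cons_scaleR: "cg sc (fword ((r *\<^sub>R \<xi>) # v)) (rscal r * fword (\<xi> # v))"
  using fword_Cons_sc[of "of_real r"] by (simp add: scale_of_real)

lemma foldr_br_update:
  assumes "i < length w"
  shows "foldr br (w[i := \<xi> + \<eta>]) \<zeta> = foldr br (w[i := \<xi>]) \<zeta> + foldr br (w[i := \<eta>]) \<zeta>"
    and "foldr br (w[i := sc c \<xi>]) \<zeta> = sc c (foldr br (w[i := \<xi>]) \<zeta>)"
  using assms
  by (induction w arbitrary: i)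
    (auto simp: br_add_left br_sc_left br_add_right br_sc_right split: nat.splits)

lemma foldr_br_linear:
  "foldr br w (\<xi> + \<eta>) = foldr br w \<xi> + foldr br w \<eta>"
  "foldr br w (sc c \<xi>) = sc c (foldr br w \<xi>)"
  by (induction w) (simp_all add: br_add_right br_sc_right)

text \<open>Slot \<open>i\<close> is either consumed by the bracket, which is linear in each entry,
  or survives as letter \<open>Suc (i - j)\<close>, position 0 being taken by the bracket.\<close>

lemma multilin_bern_word: "multilin sc (bern_word \<xi>)"
proof -
  have step: "multilin sc (\<lambda>w. fword (foldr br (take j w) \<xi> # drop j w))" for j
  proof (rule multilinI)
    fix w :: "'a list" and i \<zeta> \<eta>
    assume i: "i < length w"
    show "cg sc (fword (foldr br (take j (w[i := \<zeta> + \<eta>])) \<xi> # drop j (w[i := \<zeta> + \<eta>])))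
      (fword (foldr br (take j (w[i := \<zeta>])) \<xi> # drop j (w[i := \<zeta>])) +
       fword (foldr br (take j (w[i := \<eta>])) \<xi> # drop j (w[i := \<eta>])))"
    proof (cases "i < j")
      case True
      with i show ?thesis
        by (simp add: take_update_swap drop_update_cancel foldr_br_update fword_Cons_add)
    next
      case False
      with i show ?thesis
        using multilin_fword[of sc, unfolded multilin_def, rule_format,
            of "Suc (i - j)" "foldr br (take j w) \<xi> # drop j w"]
        by (simp add: take_update_cancel drop_update_swap)
    qed
  next
    fix w :: "'a list" and i \<zeta> c
    assume i: "i < length w"
    show "cg sc (fword (foldr br (take j (w[i := sc c \<zeta>])) \<xi> # drop j (w[i := sc c \<zeta>])))
      (fscal c * fword (foldr br (take j (w[i := \<zeta>])) \<xi> # drop j (w[i := \<zeta>])))"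
    proof (cases "i < j")
      case True
      with i show ?thesis
        by (simp add: take_update_swap drop_update_cancel foldr_br_update fword_Cons_sc)
    next
      case False
      with i show ?thesis
        using multilin_fword[of sc, unfolded multilin_def, rule_format,
            of "Suc (i - j)" "foldr br (take j w) \<xi> # drop j w"]
        by (simp add: take_update_cancel drop_update_swap)
    qed
  qed
  have "multilin sc (\<lambda>w. \<Sum>j\<le>n. rscal (fact n / fact (n - j) * bern j) *
      fword (foldr br (take j w) \<xi> # drop j w))" for n
    by (intro multilin_sum multilin_fscal step)
  from multilin_length[OF this, of "\<lambda>n. n"] show ?thesis
    by (simp add: bern_word_def[abs_def])
qed

lemma lmul_cg: "cg sc p q \<Longrightarrow> cg sc (lmul \<xi> p) (lmul \<xi> q)"
  unfolding lmul_def by (intro Sym_cg multilin_cg[OF multilin_bern_word])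

lemma lmul_add: "cg sc (lmul (\<xi> + \<eta>) p) (lmul \<xi> p + lmul \<eta> p)"
proof -
  have "cg sc (ext (bern_word (\<xi> + \<eta>)) q) (ext (bern_word \<xi>) q + ext (bern_word \<eta>) q)" for q
  proof (rule lin_cgI[where p = q and \<Phi> = "ext (bern_word (\<xi> + \<eta>))"
        and \<Psi> = "\<lambda>q. ext (bern_word \<xi>) q + ext (bern_word \<eta>) q"])
    fix w :: "'a list"
    have "cg sc (bern_word (\<xi> + \<eta>) w) (\<Sum>j\<le>length w. rscal (fact (length w) / fact (length w - j) * bern j) *
        (fword (foldr br (take j w) \<xi> # drop j w) + fword (foldr br (take j w) \<eta> # drop j w)))"
      unfolding bern_word_def foldr_br_linear by (intro cg_sum cg_left fword_Cons_add)
    then show "cg sc (ext (bern_word (\<xi> + \<eta>)) (fword w)) (ext (bern_word \<xi>) (fword w) + ext (bern_word \<eta>) (fword w))"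
      by (simp add: bern_word_def distrib_left sum.distrib)
  qed (simp_all add: lin_add)
  from Sym_cg[OF this] show ?thesis
    by (simp add: lmul_def lin_addD)
qed

lemma lmul_sc: "cg sc (lmul (sc c \<xi>) p) (fscal c * lmul \<xi> p)"
proof -
  have "cg sc (ext (bern_word (sc c \<xi>)) q) (fscal c * ext (bern_word \<xi>) q)" for q
  proof (rule lin_cgI[where p = q and \<Phi> = "ext (bern_word (sc c \<xi>))"
        and \<Psi> = "\<lambda>q. fscal c * ext (bern_word \<xi>) q"])
    fix w :: "'a list"
    have "cg sc (bern_word (sc c \<xi>) w) (\<Sum>j\<le>length w. rscal (fact (length w) / fact (length w - j) * bern j) *
        (fscal c * fword (foldr br (take j w) \<xi> # drop j w)))"
      unfolding bern_word_def foldr_br_linear by (intro cg_sum cg_left fword_Cons_sc)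
    then show "cg sc (ext (bern_word (sc c \<xi>)) (fword w)) (fscal c * ext (bern_word \<xi>) (fword w))"
      by (simp add: bern_word_def sum_distrib_left fscal_fscal mult.commute)
  qed (simp_all add: lin_mult_left)
  from Sym_cg[OF this] show ?thesis
    by (simp add: lmul_def lin_scalD)
qed


subsection \<open>Compatibility with the Lie bracket\<close>

lemma lmul_power:
  "lmul \<zeta> (fword (replicate k \<eta>)) = (\<Sum>j\<le>k. rscal (fact k / fact (k - j) * bern j) *
    fsym ((br \<eta> ^^ j) \<zeta> # replicate (k - j) \<eta>))"
proof -
  have "bern_word \<zeta> (replicate k \<eta>) = (\<Sum>j\<le>k. rscal (fact k / fact (k - j) * bern j) *
      fword ((br \<eta> ^^ j) \<zeta> # replicate (k - j) \<eta>))"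
    unfolding bern_word_def
    by (intro sum.cong) (auto simp: foldr_replicate min_def)
  then show ?thesis
    by (simp add: lmul_def fsym_replicate lin_sumD lin_scalD)
qed

lemma replicate_update:
  assumes "i < n"
  shows "(replicate n \<eta>)[i := \<theta>] = replicate i \<eta> @ \<theta> # replicate (n - Suc i) \<eta>"
  using assms by (simp add: upd_conv_take_nth_drop min_def)

text \<open>Here \<theta> stands behind the \<open>a\<close> consumed letters and survives as a
  letter.\<close>

lemma fsym_bracket_update_ge:
  assumes "a \<le> i" "i \<le> m"
  shows "fsym (foldr br (take a ((replicate (Suc m) \<eta>)[i := \<theta>])) \<xi> # drop a ((replicate (Suc m) \<eta>)[i := \<theta>]))
    = fsym ((br \<eta> ^^ a) \<xi> # \<theta> # replicate (m - a) \<eta>)"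
proof (rule fsym_mset)
  have "(replicate (Suc m) \<eta>)[i := \<theta>] = replicate a \<eta> @ replicate (i - a) \<eta> @ \<theta> # replicate (m - i) \<eta>"
    using assms by (simp add: replicate_update replicate_add[symmetric] append_assoc[symmetric] del: append_assoc replicate_Suc)
  moreover have "m - a = (i - a) + (m - i)"
    using assms by simp
  ultimately show "mset (foldr br (take a ((replicate (Suc m) \<eta>)[i := \<theta>])) \<xi> # drop a ((replicate (Suc m) \<eta>)[i := \<theta>]))
    = mset ((br \<eta> ^^ a) \<xi> # \<theta> # replicate (m - a) \<eta>)"
    by (simp only:) (simp add: foldr_replicate replicate_add)
qed

text \<open>Here \<theta> is one of the \<open>Suc a\<close> consumed letters and sits at depth
  \<open>i\<close> of the nested bracket.\<close>

lemma foldr_bracket_update_less: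
  assumes "i \<le> a" "a \<le> m"
  shows "foldr br (take (Suc a) ((replicate (Suc m) \<eta>)[i := \<theta>])) \<xi> # drop (Suc a) ((replicate (Suc m) \<eta>)[i := \<theta>])
    = (br \<eta> ^^ i) (br \<theta> ((br \<eta> ^^ (a - i)) \<xi>)) # replicate (m - a) \<eta>"
proof -
  have "(replicate (Suc m) \<eta>)[i := \<theta>] = (replicate i \<eta> @ \<theta> # replicate (a - i) \<eta>) @ replicate (m - a) \<eta>"
    using assms by (simp add: replicate_update replicate_add[symmetric] del: replicate_Suc)
  moreover have "length (replicate i \<eta> @ \<theta> # replicate (a - i) \<eta>) = Suc a"
    using assms by simp
  ultimately have "take (Suc a) ((replicate (Suc m) \<eta>)[i := \<theta>]) = replicate i \<eta> @ \<theta> # replicate (a - i) \<eta>"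
    "drop (Suc a) ((replicate (Suc m) \<eta>)[i := \<theta>]) = replicate (m - a) \<eta>"
    by (metis append_eq_conv_conj)+
  then show ?thesis
    by (simp only:) (simp add: foldr_replicate)
qed

text \<open>Symmetrization spreads \<theta> evenly over m + 1 positions. A bracket that consumes a
  letters leaves \<theta> outside in m + 1 - a of them, which gives the first sum, and swallows it
  in the remaining a, which gives the second sum with a replaced by \<open>Suc a\<close>. The
  average over positions turns (m + 1)! into m!.\<close>

lemma lmul_Cons_power:
  "lmul \<xi> (fword (\<theta> # replicate m \<eta>)) =
    (\<Sum>a\<le>m. rscal (fact m / fact (m - a) * bern a) * fsym ((br \<eta> ^^ a) \<xi> # \<theta> # replicate (m - a) \<eta>)) +
    (\<Sum>a\<le>m. rscal (fact m / fact (m - a) * bern (Suc a)) *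
      (\<Sum>i\<le>a. fsym ((br \<eta> ^^ i) (br \<theta> ((br \<eta> ^^ (a - i)) \<xi>)) # replicate (m - a) \<eta>)))"
proof -
  let ?n = "Suc m" and ?W = "\<lambda>i. (replicate (Suc m) \<eta>)[i := \<theta>]"
  let ?c = "\<lambda>a. fact (Suc m) / fact (Suc m - a) * bern a / real (Suc m)"
  define Q where "Q a = (fsym ((br \<eta> ^^ a) \<xi> # \<theta> # replicate (m - a) \<eta>) :: ('a, 'k) free_alg)" for a
  define P where "P a = (\<Sum>i\<le>a. fsym ((br \<eta> ^^ i) (br \<theta> ((br \<eta> ^^ (a - i)) \<xi>)) # replicate (m - a) \<eta>) :: ('a, 'k) free_alg)" for a
  define G where "G a = (\<Sum>i<?n. fsym (foldr br (take a (?W i)) \<xi> # drop a (?W i)) :: ('a, 'k) free_alg)" for a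
  have G0: "G 0 = fscal (of_nat ?n) * Q 0"
  proof -
    have "G 0 = (\<Sum>i<?n. Q 0)"
      unfolding G_def Q_def
      by (intro sum.cong refl fsym_bracket_update_ge) auto
    then show ?thesis
      by (simp only: sum_const_fscal card_lessThan)
  qed
  \<comment> \<open>Of the positions of \<theta>, the last m - a lie behind the \<open>Suc a\<close>
    consumed letters; for \<open>a = m\<close> there are none.\<close>
  have G_Suc: "G (Suc a) = (if a < m then fscal (of_nat (m - a)) * Q (Suc a) else 0) + P a" if "a \<le> m" for a
  proof -
    have "{..<?n} = {..a} \<union> {Suc a..m}" using that by auto
    then have "G (Suc a) = (\<Sum>i\<le>a. fsym (foldr br (take (Suc a) (?W i)) \<xi> # drop (Suc a) (?W i)))
      + (\<Sum>i\<in>{Suc a..m}. fsym (foldr br (take (Suc a) (?W i)) \<xi> # drop (Suc a) (?W i)))"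
      unfolding G_def by (simp only:) (rule sum.union_disjoint, auto)
    also have "(\<Sum>i\<le>a. fsym (foldr br (take (Suc a) (?W i)) \<xi> # drop (Suc a) (?W i))) = P a"
      unfolding P_def using that by (intro sum.cong refl) (simp only: atMost_iff foldr_bracket_update_less)
    also have "(\<Sum>i\<in>{Suc a..m}. fsym (foldr br (take (Suc a) (?W i)) \<xi> # drop (Suc a) (?W i)))
        = (\<Sum>i\<in>{Suc a..m}. Q (Suc a))"
      unfolding Q_def by (intro sum.cong refl fsym_bracket_update_ge) auto
    also have "\<dots> = fscal (of_nat (m - a)) * Q (Suc a)"
      by (simp only: sum_const_fscal card_atLeastAtMost diff_Suc_Suc)
    finally show ?thesis
      using that by (simp add: add.commute)
  qed
  have "lmul \<xi> (fword (\<theta> # replicate m \<eta>))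
      = fscal (1 / of_nat ?n) * (\<Sum>i<?n. Sym (bern_word \<xi> (?W i)))"
    by (simp only: lmul_def ext_fword fsym_Cons_replicate lin_scalD[OF lin_ext] lin_sumD[OF lin_ext])
  also have "\<dots> = fscal (1 / of_nat ?n) * (\<Sum>i<?n. \<Sum>a\<le>?n. rscal (fact ?n / fact (?n - a) * bern a) *
      fsym (foldr br (take a (?W i)) \<xi> # drop a (?W i)))"
    by (simp only: bern_word_def length_list_update length_replicate lin_sumD[OF lin_ext] lin_scalD[OF lin_ext] ext_fword)
  also have "\<dots> = (\<Sum>a\<le>?n. fscal (1 / of_nat ?n) * (rscal (fact ?n / fact (?n - a) * bern a) * G a))"
    unfolding G_def by (subst sum.swap) (simp only: sum_distrib_left)
  also have "\<dots> = (\<Sum>a\<le>?n. rscal (?c a) * G a)"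
    by (simp add: fscal_fscal mult.commute[of "1 + of_nat m"] del: fact_Suc sum.atMost_Suc)
  also have "\<dots> = rscal (?c 0) * G 0 + (\<Sum>a\<le>m. rscal (?c (Suc a)) * G (Suc a))"
    by (rule sum.atMost_Suc_shift)
  also have "(\<Sum>a\<le>m. rscal (?c (Suc a)) * G (Suc a))
      = (\<Sum>a\<le>m. rscal (?c (Suc a)) * (if a < m then fscal (of_nat (m - a)) * Q (Suc a) else 0))
      + (\<Sum>a\<le>m. rscal (?c (Suc a)) * P a)"
    by (simp add: G_Suc distrib_left sum.distrib del: fact_Suc)
  also have "(\<Sum>a\<le>m. rscal (?c (Suc a)) * P a) = (\<Sum>a\<le>m. rscal (fact m / fact (m - a) * bern (Suc a)) * P a)"
    by (intro sum.cong refl arg_cong2[where f = "(*)"] arg_cong[where f = rscal]) (simp del: of_nat_Suc)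
  also have "(\<Sum>a\<le>m. rscal (?c (Suc a)) * (if a < m then fscal (of_nat (m - a)) * Q (Suc a) else 0))
      = (\<Sum>a<m. rscal (?c (Suc a)) * (fscal (of_nat (m - a)) * Q (Suc a)))"
    by (rule sum.mono_neutral_cong_right) auto
  also have "\<dots> = (\<Sum>a<m. rscal (fact m / fact (m - Suc a) * bern (Suc a)) * Q (Suc a))"
  proof (intro sum.cong refl)
    fix a assume "a \<in> {..<m}"
    then have "m - a = Suc (m - Suc a)" by simp
    then have f: "fact (m - a) = real (m - a) * fact (m - Suc a)" and "real (m - a) \<noteq> 0"
      by (metis fact_Suc of_nat_fact, simp)
    then have "?c (Suc a) * real (m - a) = fact m / fact (m - Suc a) * bern (Suc a)"
      unfolding diff_Suc_Suc f fact_Suc[of m] by (simp del: of_nat_Suc of_nat_diff)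
    then have "of_real (?c (Suc a)) * of_nat (m - a) = (of_real (fact m / fact (m - Suc a) * bern (Suc a)) :: 'k)"
      by (metis of_real_mult of_real_of_nat_eq)
    then show "rscal (?c (Suc a)) * (fscal (of_nat (m - a)) * Q (Suc a))
        = rscal (fact m / fact (m - Suc a) * bern (Suc a)) * Q (Suc a)"
      by (simp only: fscal_fscal)
  qed
  also have "rscal (?c 0) * G 0 = rscal (fact m / fact (m - 0) * bern 0) * Q 0"
    unfolding G0 fscal_fscal by (simp del: fact_Suc of_nat_Suc)
  finally have total: "lmul \<xi> (fword (\<theta> # replicate m \<eta>)) =
      rscal (fact m / fact (m - 0) * bern 0) * Q 0 +
      ((\<Sum>a<m. rscal (fact m / fact (m - Suc a) * bern (Suc a)) * Q (Suc a)) +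
      (\<Sum>a\<le>m. rscal (fact m / fact (m - a) * bern (Suc a)) * P a))" .
  have "(\<Sum>a\<le>m. rscal (fact m / fact (m - a) * bern a) * Q a) =
      rscal (fact m / fact (m - 0) * bern 0) * Q 0 +
      (\<Sum>a<m. rscal (fact m / fact (m - Suc a) * bern (Suc a)) * Q (Suc a))"
    unfolding lessThan_Suc_atMost[symmetric] by (rule sum.lessThan_Suc_shift)
  then show ?thesis
    unfolding Q_def[symmetric] P_def[symmetric] total by (simp only: add.assoc)
qed

text \<open>The outer operator either leaves the inner bracket alone or takes it as an argument. The
  second kind is sorted by the total number \<open>n\<close> of consumed letters, which is the
  grading of \<open>bern_bracket_identity\<close>.\<close>

lemma lmul_lmul_power:
  fixes \<xi> \<zeta> \<eta> :: 'a and k :: nat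
  defines "x \<equiv> \<lambda>r. (br \<eta> ^^ r) \<xi>" and "y \<equiv> \<lambda>r. (br \<eta> ^^ r) \<zeta>"
  shows "lmul \<xi> (lmul \<zeta> (fword (replicate k \<eta>))) =
    (\<Sum>j\<le>k. \<Sum>a\<le>k - j. rscal (fact k / fact (k - j - a) * bern j * bern a) *
      fsym (x a # y j # replicate (k - j - a) \<eta>)) +
    (\<Sum>n\<le>k. rscal (fact k / fact (k - n)) * (\<Sum>a\<le>n. \<Sum>i\<le>a. rscal (bern (Suc a) * bern (n - a)) *
      fsym ((br \<eta> ^^ i) (br (y (n - a)) (x (a - i))) # replicate (k - n) \<eta>)))"
proof -
  have coeff: "fact k / fact (k - j) * b * (fact (k - j) / fact (k - j - a) * c) = fact k / fact (k - j - a) * b * c"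
    for j a and b c :: real by simp
  have "lmul \<xi> (lmul \<zeta> (fword (replicate k \<eta>)))
      = (\<Sum>j\<le>k. rscal (fact k / fact (k - j) * bern j) * lmul \<xi> (Sym (fword (y j # replicate (k - j) \<eta>))))"
    by (simp only: lmul_power lin_sumD[OF lin_lmul] lin_scalD[OF lin_lmul] y_def ext_fword)
  also have "\<dots> = (\<Sum>j\<le>k. \<Sum>a\<le>k - j. rscal (fact k / fact (k - j - a) * bern j * bern a) *
      fsym (x a # y j # replicate (k - j - a) \<eta>)) +
    (\<Sum>j\<le>k. \<Sum>a\<le>k - j. rscal (fact k / fact (k - j - a) * bern j * bern (Suc a)) * (\<Sum>i\<le>a.
      fsym ((br \<eta> ^^ i) (br (y j) (x (a - i))) # replicate (k - j - a) \<eta>)))"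
    unfolding lmul_Sym lmul_Cons_power x_def
    by (simp only: distrib_left sum_distrib_left[where A = "{..k - _}"] fscal_fscal of_real_mult[symmetric] coeff sum.distrib)
  also have "(\<Sum>j\<le>k. \<Sum>a\<le>k - j. rscal (fact k / fact (k - j - a) * bern j * bern (Suc a)) * (\<Sum>i\<le>a.
      fsym ((br \<eta> ^^ i) (br (y j) (x (a - i))) # replicate (k - j - a) \<eta>)))
    = (\<Sum>n\<le>k. rscal (fact k / fact (k - n)) * (\<Sum>a\<le>n. \<Sum>i\<le>a. rscal (bern (Suc a) * bern (n - a)) *
      fsym ((br \<eta> ^^ i) (br (y (n - a)) (x (a - i))) # replicate (k - n) \<eta>)))"
    unfolding sum_triangle
    by (intro sum.cong refl)
      (simp add: sum_distrib_left fscal_fscal mult_ac)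
  finally show ?thesis .
qed

lemma fsym_Cons_sum: "cg sc (fsym ((\<Sum>i\<in>A. f i) # v)) (\<Sum>i\<in>A. fsym (f i # v))"
  using Sym_cg[OF fword_Cons_sum[of f A v]] by (simp add: lin_sumD)

lemma fsym_Cons_diff: "cg sc (fsym ((\<xi> - \<eta>) # v)) (fsym (\<xi> # v) - fsym (\<eta> # v))"
  using Sym_cg[OF fword_Cons_diff[of \<xi> \<eta> v]] by (simp add: lin_diffD)

lemma fsym_Cons_scaleR: "cg sc (fsym ((r *\<^sub>R \<xi>) # v)) (rscal r * fsym (\<xi> # v))"
  using Sym_cg[OF fword_Cons_scaleR[of r \<xi> v]] by (simp add: lin_scalD)

text \<open>The terms with two separate brackets are symmetric under exchange of \<xi> and \<zeta>
  and cancel. In the others, linearity in the first letter collects everything with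
  \<open>k - n\<close> remaining copies of \<eta> into one letter, to which
  \<open>bern_bracket_identity\<close> applies.\<close>

lemma lmul_commutator_power:
  "cg sc (lmul \<xi> (lmul \<zeta> (fword (replicate k \<eta>))) - lmul \<zeta> (lmul \<xi> (fword (replicate k \<eta>))))
    (lmul (br \<xi> \<zeta>) (fword (replicate k \<eta>)))"
proof -
  define x y where "x r = (br \<eta> ^^ r) \<xi>" and "y r = (br \<eta> ^^ r) \<zeta>" for r
  let ?R = "\<lambda>n. replicate (k - n) \<eta>"
  let ?u = "\<lambda>n a i. (br \<eta> ^^ i) (br (y (n - a)) (x (a - i)))"
  let ?v = "\<lambda>n a i. (br \<eta> ^^ i) (br (x (n - a)) (y (a - i)))"
  have quad: "(\<Sum>j\<le>k. \<Sum>a\<le>k - j. rscal (fact k / fact (k - j - a) * bern j * bern a) *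
      fsym (x a # y j # replicate (k - j - a) \<eta>))
    = (\<Sum>j\<le>k. \<Sum>a\<le>k - j. rscal (fact k / fact (k - j - a) * bern j * bern a) *
      fsym (y a # x j # replicate (k - j - a) \<eta>))"
  proof (subst sum_triangle_commute, intro sum.cong refl)
    fix j a
    have "fsym (x j # y a # replicate (k - a - j) \<eta>) = (fsym (y a # x j # replicate (k - j - a) \<eta>) :: ('a, 'k) free_alg)"
      by (rule fsym_mset) (simp add: add_mset_commute add.commute)
    then show "rscal (fact k / fact (k - a - j) * bern a * bern j) * fsym (x j # y a # replicate (k - a - j) \<eta>)
      = rscal (fact k / fact (k - j - a) * bern j * bern a) * fsym (y a # x j # replicate (k - j - a) \<eta>)"
      by (simp add: add.commute mult_ac)
  qed
  have "lmul \<xi> (lmul \<zeta> (fword (replicate k \<eta>))) - lmul \<zeta> (lmul \<xi> (fword (replicate k \<eta>)))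
    = (\<Sum>n\<le>k. rscal (fact k / fact (k - n)) * (\<Sum>a\<le>n. \<Sum>i\<le>a. rscal (bern (Suc a) * bern (n - a)) *
        (fsym (?u n a i # ?R n) - fsym (?v n a i # ?R n))))"
    unfolding lmul_lmul_power x_def[symmetric] y_def[symmetric] quad
    by (simp add: sum_subtractf right_diff_distrib)
  also have "cg sc \<dots> (\<Sum>n\<le>k. rscal (fact k / fact (k - n)) *
      fsym ((\<Sum>a\<le>n. \<Sum>i\<le>a. (bern (Suc a) * bern (n - a)) *\<^sub>R (?u n a i - ?v n a i)) # ?R n))"
  proof (intro cg_sum cg_left)
    fix n
    have "cg sc (fsym ((\<Sum>a\<le>n. \<Sum>i\<le>a. (bern (Suc a) * bern (n - a)) *\<^sub>R (?u n a i - ?v n a i)) # ?R n))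
        (\<Sum>a\<le>n. fsym ((\<Sum>i\<le>a. (bern (Suc a) * bern (n - a)) *\<^sub>R (?u n a i - ?v n a i)) # ?R n))"
      by (rule fsym_Cons_sum)
    also have "cg sc \<dots> (\<Sum>a\<le>n. \<Sum>i\<le>a. fsym ((bern (Suc a) * bern (n - a)) *\<^sub>R (?u n a i - ?v n a i) # ?R n))"
      by (intro cg_sum fsym_Cons_sum)
    also have "cg sc \<dots> (\<Sum>a\<le>n. \<Sum>i\<le>a. rscal (bern (Suc a) * bern (n - a)) * fsym ((?u n a i - ?v n a i) # ?R n))"
      by (intro cg_sum fsym_Cons_scaleR)
    also have "cg sc \<dots> (\<Sum>a\<le>n. \<Sum>i\<le>a. rscal (bern (Suc a) * bern (n - a)) *
        (fsym (?u n a i # ?R n) - fsym (?v n a i # ?R n)))"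
      by (intro cg_sum cg_left fsym_Cons_diff)
    finally show "cg sc (\<Sum>a\<le>n. \<Sum>i\<le>a. rscal (bern (Suc a) * bern (n - a)) *
        (fsym (?u n a i # ?R n) - fsym (?v n a i # ?R n)))
      (fsym ((\<Sum>a\<le>n. \<Sum>i\<le>a. (bern (Suc a) * bern (n - a)) *\<^sub>R (?u n a i - ?v n a i)) # ?R n))"
      by (rule cg_sym)
  qed
  also have "(\<Sum>n\<le>k. rscal (fact k / fact (k - n)) *
      fsym ((\<Sum>a\<le>n. \<Sum>i\<le>a. (bern (Suc a) * bern (n - a)) *\<^sub>R (?u n a i - ?v n a i)) # ?R n))
    = (\<Sum>n\<le>k. rscal (fact k / fact (k - n)) * fsym (bern n *\<^sub>R (br \<eta> ^^ n) (br \<xi> \<zeta>) # ?R n))"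
    unfolding x_def y_def bern_bracket_identity ..
  also have "cg sc \<dots> (\<Sum>n\<le>k. rscal (fact k / fact (k - n)) * (rscal (bern n) * fsym ((br \<eta> ^^ n) (br \<xi> \<zeta>) # ?R n)))"
    by (intro cg_sum cg_left fsym_Cons_scaleR)
  also have "\<dots> = lmul (br \<xi> \<zeta>) (fword (replicate k \<eta>))"
    by (simp only: lmul_power fscal_fscal of_real_mult)
  finally show ?thesis .
qed

text \<open>The operators \<open>lmul \<xi>\<close> thus represent the Lie algebra on symmetric
  tensors, by polarization from the case of powers.\<close>

lemma lmul_commutator:
  "cg sc (lmul \<xi> (lmul \<zeta> p) - lmul \<zeta> (lmul \<xi> p)) (lmul (br \<xi> \<zeta>) p)"
proof -
  have "cg sc (lmul \<xi> (lmul \<zeta> (Sym p)) - lmul \<zeta> (lmul \<xi> (Sym p))) (lmul (br \<xi> \<zeta>) (Sym p))"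
    by (rule polarization)
      (simp_all add: lin_diff lin_compose[OF lin_lmul lin_lmul] lin_lmul cg_diff lmul_cg lmul_commutator_power)
  then show ?thesis by simp
qed

end


section \<open>The tensor algebra as a quotient\<close>

lemma lin_eq_on_keys:
  assumes "lin \<Phi>" "lin \<Psi>" "\<And>w. w \<in> words p \<Longrightarrow> \<Phi> (fword w) = \<Psi> (fword w)"
  shows "\<Phi> p = \<Psi> p"
proof -
  have "\<Phi> p = (\<Sum>w\<in>words p. fscal (coef p w) * \<Phi> (fword w))"
    by (subst free_algebra_expansion) (simp only: lin_sumD[OF assms(1)] lin_scalD[OF assms(1)])
  also have "\<dots> = (\<Sum>w\<in>words p. fscal (coef p w) * \<Psi> (fword w))"
    by (intro sum.cong) (simp_all add: assms(3))
  also have "\<dots> = \<Psi> p"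
    by (subst (3) free_algebra_expansion) (simp only: lin_sumD[OF assms(2)] lin_scalD[OF assms(2)])
  finally show ?thesis .
qed

lemma finsum_free_algebra: "finsum free_algebra f A = (\<Sum>i\<in>A. f i)"
proof -
  interpret ring free_algebra by (rule ring_free_algebra)
  show ?thesis
    by (induction A rule: infinite_finite_induct) (simp_all add: finsum_insert)
qed

definition fproj :: "nat \<Rightarrow> ('a list \<Rightarrow>\<^sub>0 'k::comm_ring_1) \<Rightarrow> ('a, 'k) free_alg"
  where "fproj n = ext (\<lambda>w. if length w = n then fword w else 0)"

lemma lin_fproj: "lin (fproj n)"
  by (simp add: fproj_def)

lemma fproj_fword: "fproj n (fword w) = (if length w = n then fword w else 0)"
  by (simp add: fproj_def)

lemma sum_fproj:
  assumes "\<And>w. w \<in> words p \<Longrightarrow> length w \<le> N"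
  shows "(\<Sum>n\<le>N. fproj n p) = p"
proof (rule lin_eq_on_keys[where \<Phi> = "\<lambda>p. \<Sum>n\<le>N. fproj n p"])
  show "lin (\<lambda>p. \<Sum>n\<le>N. fproj n p)"
    by (simp add: lin_def lin_addD[OF lin_fproj] lin_scalD[OF lin_fproj] sum.distrib sum_distrib_left)
  fix w assume "w \<in> words p"
  then show "(\<Sum>n\<le>N. fproj n (fword w)) = fword w"
    using assms by (simp add: fproj_fword)
qed simp

lemma keys_lengths_bounded: "\<exists>N. \<forall>w\<in>words p. length w \<le> N"
  using finite_keys[of p] by (meson finite_imageI finite_nat_set_iff_bounded_le imageI)

context
  fixes sc :: "'k::comm_ring_1 \<Rightarrow> 'a::ab_group_add \<Rightarrow> 'a"
begin

lemma fproj_cg: "cg sc p q \<Longrightarrow> cg sc (fproj n p) (fproj n q)"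
  unfolding fproj_def
  by (intro multilin_cg multilin_if_length[where P = "\<lambda>m. m = n"] multilin_fword)

lemma ideal_J: "ideal (tensor_ideal sc) free_algebra"
  by (simp add: ideal_free_algebra_iff fideal_J)

lemma tensor_class_ring_hom: "ring_hom_ring free_algebra (tensor_algebra sc) (tensor_class sc)"
  using ideal.rcos_ring_hom_ring[OF ideal_J]
  by (simp add: tensor_algebra_def tensor_class_def[abs_def])

lemma tensor_class_conv: "tensor_class sc p = {q. cg sc q p}"
proof -
  have "q \<in> tensor_class sc p \<longleftrightarrow> q - p \<in> tensor_ideal sc" for q
    by (force simp: tensor_class_def a_r_coset_def r_coset_def)
  then show ?thesis
    by (auto simp: cg_def)
qed

lemma tensor_class_eq_iff: "tensor_class sc p = tensor_class sc q \<longleftrightarrow> cg sc p q"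
  unfolding tensor_class_conv by (auto intro: cg_sym cg_trans)

lemma carrier_tensor_algebra: "carrier (tensor_algebra sc) = range (tensor_class sc)"
  by (auto simp: tensor_algebra_def FactRing_def A_RCOSETS_def' tensor_class_def)

interpretation TC: ring_hom_ring free_algebra "tensor_algebra sc" "tensor_class sc"
  by (rule tensor_class_ring_hom)

lemma tensor_class_mult: "tensor_class sc p \<otimes>\<^bsub>tensor_algebra sc\<^esub> tensor_class sc q = tensor_class sc (p * q)"
  and tensor_class_add: "tensor_class sc p \<oplus>\<^bsub>tensor_algebra sc\<^esub> tensor_class sc q = tensor_class sc (p + q)"
  and tensor_class_zero: "\<zero>\<^bsub>tensor_algebra sc\<^esub> = tensor_class sc 0"
  using TC.hom_mult[of p q] TC.hom_add[of p q] TC.hom_zero by simp_all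

lemma tensor_class_finsum:
  "finsum (tensor_algebra sc) (\<lambda>i. tensor_class sc (f i)) A = tensor_class sc (\<Sum>i\<in>A. f i)"
  using TC.hom_finsum[of f A] by (simp add: finsum_free_algebra o_def)

lemma tensor_class_uminus: "\<ominus>\<^bsub>tensor_algebra sc\<^esub> tensor_class sc p = tensor_class sc (- p)"
  using TC.S.minus_equality[of "tensor_class sc (- p)" "tensor_class sc p"]
  by (simp add: tensor_class_add tensor_class_zero carrier_tensor_algebra)

lemma tensor_class_minus:
  "tensor_class sc p \<ominus>\<^bsub>tensor_algebra sc\<^esub> tensor_class sc q = tensor_class sc (p - q)"
  by (simp add: a_minus_def tensor_class_uminus tensor_class_add)

lemma tensor_scalar_conv: "tensor_scalar sc c = tensor_class sc (fscal c)"
  and tensor_conv: "tensor sc w = tensor_class sc (fword w)"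
  by (simp_all add: tensor_scalar_def tensor_def fscal_def fword_def)

text \<open>By the congruence hypothesis all representatives have the same value, so
  \<open>the_elem\<close> is applied to a singleton. The homomorphism \<kappa> is kept general
  because the target is the tensor algebra in some uses and the enveloping algebra in
  others.\<close>

lemma tensor_induced_class:
  assumes \<kappa>: "ring_hom_ring free_algebra R \<kappa>"
    and \<phi>: "\<And>w. \<phi> w = \<kappa> (\<phi>' w)" and s: "\<And>c. s c = \<kappa> (fscal c)"
    and cg: "\<And>p q. cg sc p q \<Longrightarrow> \<kappa> (ext \<phi>' p) = \<kappa> (ext \<phi>' q)"
  shows "tensor_induced R s \<phi> (tensor_class sc p) = \<kappa> (ext \<phi>' p)"
proof -
  interpret ring_hom_ring free_algebra R \<kappa> by fact
  have "(\<Oplus>\<^bsub>R\<^esub>w\<in>words q. s (coef q w) \<otimes>\<^bsub>R\<^esub> \<phi> w) = \<kappa> (ext \<phi>' q)" for q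
  proof -
    have "\<kappa> (ext \<phi>' q) = finsum R (\<kappa> \<circ> (\<lambda>w. fscal (coef q w) * \<phi>' w)) (words q)"
      using hom_finsum[of "\<lambda>w. fscal (coef q w) * \<phi>' w" "words q"]
      by (simp add: finsum_free_algebra ext_def)
    also have "\<kappa> \<circ> (\<lambda>w. fscal (coef q w) * \<phi>' w)
        = (\<lambda>w. s (coef q w) \<otimes>\<^bsub>R\<^esub> \<phi> w)"
      using hom_mult by (auto simp: s \<phi>)
    finally show ?thesis by simp
  qed
  then have "(\<lambda>q. \<Oplus>\<^bsub>R\<^esub>w\<in>words q. s (coef q w) \<otimes>\<^bsub>R\<^esub> \<phi> w) ` tensor_class sc p
      = {\<kappa> (ext \<phi>' p)}"
    using cg by (auto simp: tensor_class_conv image_iff)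
  then show ?thesis
    by (simp add: tensor_induced_def)
qed

lemma tensor_induced_tensor_class:
  assumes "\<And>w. \<phi> w = tensor_class sc (\<phi>' w)" "multilin sc \<phi>'"
  shows "tensor_induced (tensor_algebra sc) (tensor_scalar sc) \<phi> (tensor_class sc p) = tensor_class sc (ext \<phi>' p)"
  by (rule tensor_induced_class[OF tensor_class_ring_hom])
    (simp_all add: assms tensor_scalar_conv tensor_class_eq_iff multilin_cg)

lemma tensor_proj_class: "tensor_proj sc n (tensor_class sc p) = tensor_class sc (fproj n p)"
  unfolding tensor_proj_def fproj_def
  by (rule tensor_induced_tensor_class)
    (auto simp: tensor_conv tensor_class_zero
      intro!: multilin_if_length[where P = "\<lambda>m. m = n"] multilin_fword)

definition fperm :: "nat \<Rightarrow> (nat \<Rightarrow> nat) \<Rightarrow> (('a, 'k) free_alg) \<Rightarrow> ('a, 'k) free_alg"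
  where "fperm n \<sigma> = ext (\<lambda>w. if length w = n then fword (permute_list \<sigma> w) else 0)"

lemma multilin_fperm:
  assumes "\<sigma> permutes {..<n}"
  shows "multilin sc (\<lambda>w. if length w = n then fword (permute_list \<sigma> w) else 0)"
proof -
  have "multilin sc (\<lambda>w. if length w = n then (if \<sigma> permutes {..<length w} then fword (permute_list \<sigma> w) else 0) else 0)"
    by (intro multilin_if_length[where P = "\<lambda>m. m = n"] multilin_permute multilin_fword)
  also have "(\<lambda>w. if length w = n then (if \<sigma> permutes {..<length w} then fword (permute_list \<sigma> w) else 0) else 0)
    = (\<lambda>w. if length w = n then fword (permute_list \<sigma> w) else 0)"
    using assms by auto
  finally show ?thesis .
qed

lemma tensor_permute_class:
  assumes "\<sigma> permutes {..<n}"
  shows "tensor_permute sc n \<sigma> (tensor_class sc p) = tensor_class sc (fperm n \<sigma> p)"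
  unfolding tensor_permute_def fperm_def
  by (rule tensor_induced_tensor_class)
    (auto simp: tensor_conv tensor_class_zero intro!: multilin_fperm assms)

lemma fperm_cg: "\<sigma> permutes {..<n} \<Longrightarrow> cg sc p q \<Longrightarrow> cg sc (fperm n \<sigma> p) (fperm n \<sigma> q)"
  unfolding fperm_def by (intro multilin_cg multilin_fperm)

end

lemma fproj_fsym: "fproj n (fsym w) = (if length w = n then fsym w else 0)"
proof -
  have "(\<Sum>\<sigma> | \<sigma> permutes {..<length w}. if length w = n then fword (permute_list \<sigma> w) else 0)
    = (if length w = n then (\<Sum>\<sigma> | \<sigma> permutes {..<length w}. fword (permute_list \<sigma> w)) else 0)"
    by simp
  then show ?thesis
    by (simp add: fsym_def lin_scalD[OF lin_fproj] lin_sumD[OF lin_fproj] fproj_fword)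
qed

lemma fproj_Sym: "fproj n (Sym p) = Sym (fproj n p)"
  by (rule lin_eqI[OF lin_compose[OF lin_fproj lin_ext] lin_compose[OF lin_ext lin_fproj]])
    (simp add: fproj_fsym fproj_fword lin_0[OF lin_ext])

section \<open>Symmetric tensors as the fixed points of symmetrization\<close>

context
  fixes sc :: "'k::field_char_0 \<Rightarrow> 'a::ab_group_add \<Rightarrow> 'a"
begin

lemma symmetrize_class: "symmetrize sc (tensor_class sc p) = tensor_class sc (Sym p)"
  unfolding symmetrize_def
  by (rule tensor_induced_tensor_class)
    (simp_all add: sym_product_def tensor_conv tensor_scalar_conv tensor_class_finsum tensor_class_mult
      fsym_def[symmetric] multilin_fsym)

lemma fperm_Sym:
  assumes \<sigma>: "\<sigma> permutes {..<n}"
  shows "fperm n \<sigma> (Sym p) = fproj n (Sym p :: ('a, 'k) free_alg)"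
proof (rule lin_eqI[where \<Phi> = "\<lambda>p. fperm n \<sigma> (Sym p)" and \<Psi> = "\<lambda>p. fproj n (Sym p)"])
  show "lin (\<lambda>p. fperm n \<sigma> (Sym p))" "lin (\<lambda>p. fproj n (Sym p))"
    unfolding fperm_def fproj_def by (rule lin_compose[OF lin_ext lin_ext])+
  fix w :: "'a list"
  have lin: "lin (fperm n \<sigma>)"
    by (simp add: fperm_def)
  show "fperm n \<sigma> (Sym (fword w)) = (fproj n (Sym (fword w)) :: ('a, 'k) free_alg)"
  proof (cases "length w = n")
    case True
    have "(\<Sum>\<tau> | \<tau> permutes {..<n}. fword (permute_list \<sigma> (permute_list \<tau> w)) :: ('a, 'k) free_alg)
        = (\<Sum>\<tau> | \<tau> permutes {..<n}. fword (permute_list (\<tau> \<circ> \<sigma>) w))"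
      using True \<sigma> by (intro sum.cong) (simp_all add: permute_list_compose)
    also have "\<dots> = (\<Sum>\<tau> | \<tau> permutes {..<n}. fword (permute_list \<tau> w))"
      by (rule sum_permutations_compose_right[OF \<sigma>, symmetric])
    finally have "fperm n \<sigma> (fsym w) = (fsym w :: ('a, 'k) free_alg)"
      unfolding fsym_def lin_scalD[OF lin] lin_sumD[OF lin] using True by (simp add: fperm_def)
    with True show ?thesis
      by (simp add: fproj_fsym)
  next
    case False
    then have "fperm n \<sigma> (fsym w) = (0 :: ('a, 'k) free_alg)"
      unfolding fsym_def lin_scalD[OF lin] lin_sumD[OF lin] by (simp add: fperm_def)
    with False show ?thesis
      by (simp add: fproj_fsym)
  qed
qed

text \<open>\<open>Sym\<close> uses a different symmetric group in each degree; a degree bound makes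
  it a finite combination of the operators \<open>fperm n \<sigma>\<close>, which descend to
  tensors.\<close>

lemma Sym_eq_sum_fperm:
  assumes "\<And>w. w \<in> words p \<Longrightarrow> length w \<le> N"
  shows "Sym p = (\<Sum>n\<le>N. fscal (1 / fact n) * (\<Sum>\<sigma> | \<sigma> permutes {..<n}. fperm n \<sigma> p :: ('a, 'k) free_alg))"
proof (rule lin_eq_on_keys[where \<Psi> = "\<lambda>p. \<Sum>n\<le>N. fscal (1 / fact n) * (\<Sum>\<sigma> | \<sigma> permutes {..<n}. fperm n \<sigma> p)"])
  show "lin (\<lambda>p. \<Sum>n\<le>N. fscal (1 / fact n) * (\<Sum>\<sigma> | \<sigma> permutes {..<n}. fperm n \<sigma> p) :: ('a, 'k) free_alg)"
    by (simp add: lin_def fperm_def lin_addD[OF lin_ext] lin_scalD[OF lin_ext] sum.distrib distrib_left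
        sum_distrib_left fscal_left_commute[of "fscal (1 / fact _)"])
  fix w assume "w \<in> words p"
  then have "length w \<le> N" by (rule assms)
  have "(\<Sum>n\<le>N. fscal (1 / fact n) * (\<Sum>\<sigma> | \<sigma> permutes {..<n}. fperm n \<sigma> (fword w)))
      = (\<Sum>n\<le>N. if n = length w then fsym w else 0 :: ('a, 'k) free_alg)"
    by (intro sum.cong refl) (simp add: fperm_def fsym_def)
  also have "\<dots> = fsym w"
    using \<open>length w \<le> N\<close> by simp
  finally show "Sym (fword w) = (\<Sum>n\<le>N. fscal (1 / fact n) * (\<Sum>\<sigma> | \<sigma> permutes {..<n}. fperm n \<sigma> (fword w)) :: ('a, 'k) free_alg)"
    by simp
qed simp

lemma sum_permutations_const:
  "fscal (1 / fact n) * (\<Sum>\<sigma> | \<sigma> permutes {..<n}. p) = (p :: ('a, 'k) free_alg)"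
  by (simp only: sum_const_fscal fscal_fscal card_permutations[OF card_lessThan finite_lessThan] of_nat_fact) simp

text \<open>Averaging the invariance over the permutations of each degree gives one direction; the
  other is that the image of \<open>Sym\<close> is invariant.\<close>

lemma tensor_class_in_sym_tensors_iff: "tensor_class sc p \<in> sym_tensors sc \<longleftrightarrow> cg sc (Sym p) p"
proof -
  have "tensor_class sc p \<in> sym_tensors sc \<longleftrightarrow> (\<forall>n \<sigma>. \<sigma> permutes {..<n} \<longrightarrow> cg sc (fperm n \<sigma> p) (fproj n p))"
    by (auto simp: sym_tensors_def carrier_tensor_algebra tensor_permute_class tensor_proj_class tensor_class_eq_iff)
  also have "\<dots> \<longleftrightarrow> cg sc (Sym p) p"
  proof
    assume *: "\<forall>n \<sigma>. \<sigma> permutes {..<n} \<longrightarrow> cg sc (fperm n \<sigma> p) (fproj n p)"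
    obtain N where N: "\<And>w. w \<in> words p \<Longrightarrow> length w \<le> N"
      using keys_lengths_bounded[of p] by blast
    have "Sym p = (\<Sum>n\<le>N. fscal (1 / fact n) * (\<Sum>\<sigma> | \<sigma> permutes {..<n}. fperm n \<sigma> p))"
      by (rule Sym_eq_sum_fperm[OF N])
    also have "cg sc \<dots> (\<Sum>n\<le>N. fscal (1 / fact n) * (\<Sum>\<sigma> | \<sigma> permutes {..<n}. fproj n p))"
      using * by (intro cg_sum cg_left) auto
    also have "(\<Sum>n\<le>N. fscal (1 / fact n) * (\<Sum>\<sigma> | \<sigma> permutes {..<n}. fproj n p)) = p"
      by (simp only: sum_permutations_const sum_fproj[OF N])
    finally show "cg sc (Sym p) p" .
  next
    assume p: "cg sc (Sym p) p"
    show "\<forall>n \<sigma>. \<sigma> permutes {..<n} \<longrightarrow> cg sc (fperm n \<sigma> p) (fproj n p)"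
    proof (intro allI impI)
      fix n :: nat and \<sigma> assume \<sigma>: "\<sigma> permutes {..<n}"
      have "cg sc (fperm n \<sigma> p) (fperm n \<sigma> (Sym p))"
        by (rule fperm_cg[OF \<sigma> cg_sym[OF p]])
      also have "fperm n \<sigma> (Sym p) = fproj n (Sym p)"
        by (rule fperm_Sym[OF \<sigma>])
      also have "cg sc (fproj n (Sym p)) (fproj n p)"
        by (intro fproj_cg p)
      finally show "cg sc (fperm n \<sigma> p) (fproj n p)" .
    qed
  qed
  finally show ?thesis .
qed

end


section \<open>The Poincare-Birkhoff-Witt theorem\<close>

context banach_lie_algebra
begin

text \<open>The word acts on the unit tensor through the representation \<open>lmul\<close>. This
  becomes the inverse of quantization: it kills the relations of the enveloping algebra and fixes
  symmetric tensors, both up to \<open>cg\<close>.\<close>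

definition rep_word :: "'a list \<Rightarrow> ('a, 'k) free_alg"
  where "rep_word w = foldr lmul w 1"

abbreviation rep :: "(('a, 'k) free_alg) \<Rightarrow> ('a, 'k) free_alg"
  where "rep \<equiv> ext rep_word"

lemma lin_foldr_lmul: "lin (foldr lmul u)"
proof (induction u)
  case Nil
  then show ?case by (simp add: id_def)
next
  case (Cons a u)
  then show ?case
    using lin_compose[OF lin_lmul[of a] Cons] by (simp add: o_def)
qed

lemma foldr_lmul_cg: "cg sc p q \<Longrightarrow> cg sc (foldr lmul u p) (foldr lmul u q)"
  by (induction u) (auto intro: lmul_cg)

lemma rep_fword_mult: "rep (fword u * p) = foldr lmul u (rep p)"
proof (rule lin_eqI[where \<Phi> = "\<lambda>p. rep (fword u * p)" and \<Psi> = "\<lambda>p. foldr lmul u (rep p)"])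
  show "lin (\<lambda>p. rep (fword u * p))"
    by (rule lin_compose[OF lin_ext lin_mult_left[OF lin_id]])
  show "lin (\<lambda>p. foldr lmul u (rep p))"
    by (rule lin_compose[OF lin_foldr_lmul lin_ext])
qed (simp add: fword_append[symmetric] rep_word_def)

lemma rep_1 [simp]: "rep 1 = 1"
  using ext_fword[of rep_word "[]"] by (simp add: rep_word_def)

lemma Sym_rep [simp]: "Sym (rep p) = rep p"
proof (rule lin_eqI[where \<Phi> = "\<lambda>p. Sym (rep p)" and \<Psi> = rep])
  fix w
  show "Sym (rep (fword w)) = rep (fword w)"
    by (cases w) (simp_all add: rep_word_def del: fword_Nil)
qed (simp_all add: lin_compose[OF lin_ext lin_ext])

lemma multilin_rep_word: "multilin sc rep_word"
proof (rule multilinI)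
  fix w :: "'a list" and i \<xi> \<eta>
  assume i: "i < length w"
  have "cg sc (lmul (\<xi> + \<eta>) (rep_word (drop (Suc i) w)))
      (lmul \<xi> (rep_word (drop (Suc i) w)) + lmul \<eta> (rep_word (drop (Suc i) w)))"
    by (rule lmul_add)
  from foldr_lmul_cg[OF this, of "take i w"]
  show "cg sc (rep_word (w[i := \<xi> + \<eta>])) (rep_word (w[i := \<xi>]) + rep_word (w[i := \<eta>]))"
    using i by (simp add: rep_word_def upd_conv_take_nth_drop lin_addD[OF lin_foldr_lmul])
next
  fix w :: "'a list" and i \<xi> c
  assume i: "i < length w"
  have "cg sc (lmul (sc c \<xi>) (rep_word (drop (Suc i) w))) (fscal c * lmul \<xi> (rep_word (drop (Suc i) w)))"
    by (rule lmul_sc)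
  from foldr_lmul_cg[OF this, of "take i w"]
  show "cg sc (rep_word (w[i := sc c \<xi>])) (fscal c * rep_word (w[i := \<xi>]))"
    using i by (simp add: rep_word_def upd_conv_take_nth_drop lin_scalD[OF lin_foldr_lmul])
qed

lemma rep_cg: "cg sc p q \<Longrightarrow> cg sc (rep p) (rep q)"
  by (rule multilin_cg[OF multilin_rep_word])

text \<open>All terms with j > 0 contain \<open>br \<eta> \<eta>\<close>, so only the leading term
  survives.\<close>

lemma lmul_same_power: "cg sc (lmul \<eta> (fword (replicate k \<eta>))) (fword (replicate (Suc k) \<eta>))"
proof -
  have "cg sc (rscal (fact k / fact (k - j) * bern j) * fsym ((br \<eta> ^^ j) \<eta> # replicate (k - j) \<eta>))
      (if j = 0 then fword (replicate (Suc k) \<eta>) else 0)" for j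
  proof (cases j)
    case 0
    moreover have "fsym (replicate (Suc k) \<eta>) = (fword (replicate (Suc k) \<eta>) :: ('a, 'k) free_alg)"
      by (rule fsym_replicate)
    ultimately show ?thesis by simp
  next
    case (Suc i)
    have "(br \<eta> ^^ j) \<eta> = (br \<eta> ^^ i) (br \<eta> \<eta>)"
      unfolding Suc funpow_Suc_right by simp
    then have "(br \<eta> ^^ j) \<eta> = 0"
      by (simp add: br_self)
    moreover have "cg sc (fsym (0 # v)) 0" for v
      using fsym_Cons_scaleR[of 0 0 v] by simp
    ultimately show ?thesis
      using Suc cg_left[of sc _ 0] by fastforce
  qed
  then have "cg sc (lmul \<eta> (fword (replicate k \<eta>))) (\<Sum>j\<le>k. if j = 0 then fword (replicate (Suc k) \<eta>) else 0)"
    unfolding lmul_power by (rule cg_sum)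
  then show ?thesis by simp
qed

lemma rep_power: "cg sc (rep (fword (replicate k \<eta>))) (fword (replicate k \<eta>))"
proof (induction k)
  case (Suc k)
  have "rep (fword (replicate (Suc k) \<eta>)) = lmul \<eta> (rep (fword (replicate k \<eta>)))"
    by (simp add: rep_word_def)
  also have "cg sc \<dots> (lmul \<eta> (fword (replicate k \<eta>)))"
    by (rule lmul_cg[OF Suc])
  also have "cg sc \<dots> (fword (replicate (Suc k) \<eta>))"
    by (rule lmul_same_power)
  finally show ?case .
qed simp

text \<open>On powers this is \<open>rep_power\<close>; polarization does the rest.\<close>

lemma rep_Sym: "cg sc (rep (Sym p)) (Sym p)"
  by (rule polarization[where \<Psi> = "\<lambda>p. p"]) (simp_all add: rep_cg rep_power[unfolded ext_fword])


subsection \<open>The enveloping algebra as a quotient of the free algebra\<close>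

text \<open>The kernel of the composite map from the free algebra to the enveloping algebra, so that
  two successive quotients can be handled as one.\<close>

definition env_kernel :: "(('a, 'k) free_alg) set"
  where "env_kernel = {p. tensor_class sc p \<in> env_ideal sc br}"

definition env_rel :: "'a \<Rightarrow> 'a \<Rightarrow> ('a, 'k) free_alg"
  where "env_rel \<xi> \<eta> = fword [\<xi>, \<eta>] - fword [\<eta>, \<xi>] - fword [br \<xi> \<eta>]"

interpretation T: ring_hom_ring free_algebra "tensor_algebra sc" "tensor_class sc"
  by (rule tensor_class_ring_hom)

lemma env_ideal_conv: "env_ideal sc br = Idl\<^bsub>tensor_algebra sc\<^esub> {tensor_class sc (env_rel \<xi> \<eta>) | \<xi> \<eta>. True}"
  by (simp add: env_ideal_def env_rel_def tensor_conv tensor_class_minus)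

lemma ideal_env_ideal: "ideal (env_ideal sc br) (tensor_algebra sc)"
  unfolding env_ideal_conv
  by (rule T.S.genideal_ideal) (auto simp: carrier_tensor_algebra)

lemma env_rel_in_kernel: "env_rel \<xi> \<eta> \<in> env_kernel"
proof -
  have "{tensor_class sc (env_rel \<xi> \<eta>) | \<xi> \<eta>. True} \<subseteq> env_ideal sc br"
    unfolding env_ideal_conv by (rule T.S.genideal_self) (auto simp: carrier_tensor_algebra)
  then show ?thesis
    by (auto simp: env_kernel_def)
qed

definition env_map :: "(('a, 'k) free_alg) \<Rightarrow> ('a, 'k) tensors set"
  where "env_map p = env_class sc br (tensor_class sc p)"

lemma env_map_ring_hom: "ring_hom_ring free_algebra (env_algebra sc br) env_map"
proof -
  interpret ideal "env_ideal sc br" "tensor_algebra sc"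
    by (rule ideal_env_ideal)
  have "env_class sc br \<in> ring_hom (tensor_algebra sc) (env_algebra sc br)"
    using rcos_ring_hom by (simp add: env_algebra_def env_class_def[abs_def])
  then have "env_class sc br \<circ> tensor_class sc \<in> ring_hom free_algebra (env_algebra sc br)"
    by (rule ring_hom_trans[OF T.homh])
  moreover have "ring (env_algebra sc br)"
    unfolding env_algebra_def by (rule quotient_is_ring)
  ultimately show ?thesis
    by (intro ring_hom_ringI2 ring_free_algebra) (simp_all add: env_map_def[abs_def] o_def)
qed

interpretation U: ring_hom_ring free_algebra "env_algebra sc br" env_map
  by (rule env_map_ring_hom)

lemma env_map_mult: "env_map p \<otimes>\<^bsub>env_algebra sc br\<^esub> env_map q = env_map (p * q)"
  and env_map_one: "\<one>\<^bsub>env_algebra sc br\<^esub> = env_map 1"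
  using U.hom_mult[of p q] U.hom_one by simp_all

lemma env_map_finsum: "finsum (env_algebra sc br) (\<lambda>i. env_map (f i)) A = env_map (\<Sum>i\<in>A. f i)"
  using U.hom_finsum[of f A] by (simp add: finsum_free_algebra o_def)

lemma env_map_eq_iff: "env_map p = env_map q \<longleftrightarrow> p - q \<in> env_kernel"
proof -
  have "env_map p = env_map q \<longleftrightarrow> tensor_class sc p \<ominus>\<^bsub>tensor_algebra sc\<^esub> tensor_class sc q \<in> env_ideal sc br"
    unfolding env_map_def env_class_def
    by (rule T.S.quotient_eq_iff_same_a_r_cos[OF ideal_env_ideal, symmetric])
      (simp_all add: carrier_tensor_algebra)
  then show ?thesis
    by (simp add: tensor_class_minus env_kernel_def)
qed

lemma fideal_env_kernel: "fideal env_kernel"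
proof -
  interpret ideal "env_ideal sc br" "tensor_algebra sc"
    by (rule ideal_env_ideal)
  show ?thesis
    unfolding fideal_def env_kernel_def
    using additive_subgroup.zero_closed[OF is_additive_subgroup]
      additive_subgroup.a_closed[OF is_additive_subgroup] I_l_closed I_r_closed
    by (auto simp: tensor_class_zero tensor_class_add[symmetric] tensor_class_mult[symmetric] carrier_tensor_algebra)
qed

lemma cg_imp_env_kernel: "cg sc p q \<Longrightarrow> p - q \<in> env_kernel"
  unfolding env_map_eq_iff[symmetric] by (simp add: env_map_def tensor_class_eq_iff[symmetric])

text \<open>By \<open>lmul_commutator\<close>, a relation between two words acts as zero, so the
  relations lie in the two-sided ideal \<open>Q\<close>. Its image in the tensor algebra is an ideal
  and therefore contains \<open>env_ideal\<close>.\<close>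

lemma rep_env_kernel:
  assumes "p \<in> env_kernel"
  shows "cg sc (rep p) 0"
proof -
  define Q where "Q = {p. \<forall>u v. cg sc (rep (fword u * p * fword v)) 0}"
  have Q: "fideal Q"
    unfolding Q_def cg_0_iff by (rule fideal_two_sided[OF lin_ext fideal_J])
  \<comment> \<open>Saturation under congruence: without it, membership of a class in the image of
    \<open>Q\<close> would say nothing about a given representative.\<close>
  have Q_cg: "q \<in> Q" if "cg sc q p" "p \<in> Q" for p q
  proof -
    have "cg sc (rep (fword u * q * fword v)) (rep (fword u * p * fword v))" for u v
      by (intro rep_cg cg_left cg_right that)
    moreover have "cg sc (rep (fword u * p * fword v)) 0" for u v
      using that(2) by (simp add: Q_def)
    ultimately have "cg sc (rep (fword u * q * fword v)) 0" for u v
      by (rule cg_trans)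
    then show ?thesis
      by (simp add: Q_def)
  qed
  have "env_rel \<xi> \<eta> \<in> Q" for \<xi> \<eta>
  proof -
    have "cg sc (rep (fword u * env_rel \<xi> \<eta> * fword v)) 0" for u v
    proof -
      let ?p = "rep (fword v)"
      have "rep (env_rel \<xi> \<eta> * fword v) = lmul \<xi> (lmul \<eta> ?p) - lmul \<eta> (lmul \<xi> ?p) - lmul (br \<xi> \<eta>) ?p"
        by (simp only: env_rel_def left_diff_distrib lin_diffD[OF lin_ext] rep_fword_mult foldr.simps o_apply id_apply)
      also have "cg sc \<dots> 0"
        using cg_diff[OF lmul_commutator cg_refl, of \<xi> \<eta> ?p "lmul (br \<xi> \<eta>) ?p"] by simp
      finally have "cg sc (foldr lmul u (rep (env_rel \<xi> \<eta> * fword v))) (foldr lmul u 0)"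
        by (rule foldr_lmul_cg)
      then show ?thesis
        by (simp add: mult.assoc rep_fword_mult lin_0[OF lin_foldr_lmul])
    qed
    then show ?thesis by (simp add: Q_def)
  qed
  then have "{tensor_class sc (env_rel \<xi> \<eta>) | \<xi> \<eta>. True} \<subseteq> tensor_class sc ` Q"
    by blast
  moreover have "ideal (tensor_class sc ` Q) (tensor_algebra sc)"
  proof (rule idealI)
    show "ring (tensor_algebra sc)"
      by (rule T.S.ring_axioms)
    show "subgroup (tensor_class sc ` Q) (add_monoid (tensor_algebra sc))"
    proof (rule group.subgroupI)
      show "Group.group (add_monoid (tensor_algebra sc))"
        by (rule T.S.add.group_axioms)
      show "tensor_class sc ` Q \<noteq> {}"
        using fideal_0[OF Q] by blast
      show "tensor_class sc ` Q \<subseteq> carrier (add_monoid (tensor_algebra sc))"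
        by (auto simp: carrier_tensor_algebra)
    next
      fix a assume "a \<in> tensor_class sc ` Q"
      then obtain q where "a = tensor_class sc q" "q \<in> Q" by blast
      then show "inv\<^bsub>add_monoid (tensor_algebra sc)\<^esub> a \<in> tensor_class sc ` Q"
        using fideal_minus[OF Q, of q] tensor_class_uminus[of sc q, unfolded a_inv_def] by simp
    next
      fix a b assume "a \<in> tensor_class sc ` Q" "b \<in> tensor_class sc ` Q"
      then show "a \<otimes>\<^bsub>add_monoid (tensor_algebra sc)\<^esub> b \<in> tensor_class sc ` Q"
        using fideal_add[OF Q] by (auto simp: tensor_class_add)
    qed
  qed (use fideal_left[OF Q] fideal_right[OF Q] in \<open>auto simp: carrier_tensor_algebra tensor_class_mult\<close>)
  ultimately have "env_ideal sc br \<subseteq> tensor_class sc ` Q"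
    unfolding env_ideal_conv by (intro T.S.genideal_minimal)
  then obtain q where "tensor_class sc p = tensor_class sc q" "q \<in> Q"
    using assms by (auto simp: env_kernel_def)
  then have "p \<in> Q"
    using Q_cg by (simp add: tensor_class_eq_iff)
  then have "cg sc (rep (fword [] * p * fword [])) 0"
    unfolding Q_def by blast
  then show ?thesis by simp
qed


subsection \<open>Bijectivity of the quantization map\<close>

text \<open>The standard filtration of the enveloping algebra with a strict bound: degree less than
  \<open>n\<close>, so that \<open>lower (length w)\<close> contains the errors of lower order for
  the word \<open>w\<close>.\<close>

definition lower :: "nat \<Rightarrow> (('a, 'k) free_alg) set"
  where "lower n = {p. \<exists>q. p - q \<in> env_kernel \<and> (\<forall>w\<in>words q. length w < n)}"

lemma lower_add: "p \<in> lower n \<Longrightarrow> q \<in> lower n \<Longrightarrow> p + q \<in> lower n"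
proof -
  assume "p \<in> lower n" "q \<in> lower n"
  then obtain p' q' where p': "p - p' \<in> env_kernel" "\<forall>w\<in>words p'. length w < n"
    and q': "q - q' \<in> env_kernel" "\<forall>w\<in>words q'. length w < n"
    by (auto simp: lower_def)
  have "(p + q) - (p' + q') \<in> env_kernel"
    using fideal_add[OF fideal_env_kernel p'(1) q'(1)] by (simp add: algebra_simps)
  moreover have "\<forall>w\<in>words (p' + q'). length w < n"
    using keys_add[of p' q'] p'(2) q'(2) by blast
  ultimately show ?thesis
    by (auto simp: lower_def)
qed

lemma lower_mult:
  assumes "p \<in> lower n" and r: "\<forall>w\<in>words r. length w \<le> m"
  shows "r * p \<in> lower (m + n)"
proof -
  from assms obtain p' where p': "p - p' \<in> env_kernel" "\<forall>w\<in>words p'. length w < n"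
    by (auto simp: lower_def)
  have "r * p - r * p' \<in> env_kernel"
    using fideal_left[OF fideal_env_kernel p'(1), of r] by (simp add: right_diff_distrib)
  moreover have "\<forall>w\<in>words (r * p'). length w < m + n"
    using keys_mult[of r p'] p'(2) r by (force simp: plus_list_def intro: add_le_less_mono)
  ultimately show ?thesis
    by (auto simp: lower_def)
qed

lemma lower_0: "0 \<in> lower n"
  using fideal_0[OF fideal_env_kernel] by (auto simp: lower_def intro!: exI[of _ 0])

lemma lower_sum: "(\<And>i. i \<in> A \<Longrightarrow> f i \<in> lower n) \<Longrightarrow> (\<Sum>i\<in>A. f i) \<in> lower n"
  by (induction A rule: infinite_finite_induct) (auto intro: lower_0 lower_add)

text \<open>Every transposition of neighbouring letters costs a bracket, that is, a word with one
  letter less.\<close>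

lemma fword_move_lower: "fword (a # u @ v) - fword (u @ a # v) \<in> lower (Suc (length u + length v))"
proof (induction u)
  case (Cons b u)
  have "fword [b] * (fword (a # u @ v) - fword (u @ a # v)) \<in> lower (1 + Suc (length u + length v))"
    by (rule lower_mult[OF Cons]) (simp add: fword_def)
  moreover have "fword (a # b # u @ v) - fword (b # a # u @ v) \<in> lower (Suc (Suc (length u + length v)))"
  proof -
    have "env_rel a b * fword (u @ v) \<in> env_kernel"
      by (intro fideal_right[OF fideal_env_kernel] env_rel_in_kernel)
    then have "(fword (a # b # u @ v) - fword (b # a # u @ v)) - fword (br a b # u @ v) \<in> env_kernel"
      by (simp add: env_rel_def left_diff_distrib fword_append[symmetric])
    then show ?thesis
      unfolding lower_def by (auto simp: fword_def intro!: exI[of _ "Poly_Mapping.single (br a b # u @ v) 1"])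
  qed
  ultimately have "(fword (a # b # u @ v) - fword (b # a # u @ v)) +
      fword [b] * (fword (a # u @ v) - fword (u @ a # v)) \<in> lower (Suc (Suc (length u + length v)))"
    by (intro lower_add) simp_all
  then show ?case
    by (simp add: right_diff_distrib fword_append[symmetric])
qed (simp add: lower_0)

lemma fword_mset_lower: "mset u = mset v \<Longrightarrow> fword u - fword v \<in> lower (length u)"
proof (induction u arbitrary: v)
  case (Cons a u)
  then have "a \<in> set v"
    by (metis list.set_intros(1) mset_eq_setD)
  then obtain s t where v: "v = s @ a # t"
    by (meson split_list)
  with Cons.prems have mset: "mset u = mset (s @ t)"
    by simp
  have "fword [a] * (fword u - fword (s @ t)) \<in> lower (1 + length u)"
    by (rule lower_mult[OF Cons.IH[OF mset]]) (simp add: fword_def)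
  moreover have "length u = length s + length t"
    using mset_eq_length[OF mset] by simp
  ultimately have "fword [a] * (fword u - fword (s @ t)) + (fword (a # s @ t) - fword (s @ a # t)) \<in> lower (length (a # u))"
    using fword_move_lower[of a s t] by (intro lower_add) simp_all
  then show ?case
    by (simp add: v right_diff_distrib fword_append[symmetric])
qed (simp add: lower_0)

lemma fword_fsym_lower: "fword w - fsym w \<in> lower (length w)"
proof -
  let ?n = "length w"
  have "(\<Sum>\<sigma> | \<sigma> permutes {..<?n}. fword w - fword (permute_list \<sigma> w)) \<in> lower ?n"
    by (intro lower_sum fword_mset_lower) auto
  then have "fscal (1 / fact ?n) * (\<Sum>\<sigma> | \<sigma> permutes {..<?n}. fword w - fword (permute_list \<sigma> w)) \<in> lower (0 + ?n)"
    by (rule lower_mult) (simp add: fscal_def)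
  then show ?thesis
    by (simp add: sum_subtractf right_diff_distrib fsym_def[symmetric] sum_permutations_const del: sum_constant)
qed

text \<open>Surjectivity of quantization. Up to relations, a word differs from its symmetrization by
  shorter words, to which induction on the length applies.\<close>

lemma ex_symmetric_representative: "\<exists>s. p - Sym s \<in> env_kernel"
proof -
  have lin: "\<exists>s. p - Sym s \<in> env_kernel"
    if "\<And>w. w \<in> words p \<Longrightarrow> \<exists>s. fword w - Sym s \<in> env_kernel" for p
  proof -
    obtain s where s: "\<And>w. w \<in> words p \<Longrightarrow> fword w - Sym (s w) \<in> env_kernel"
      using \<open>\<And>w. w \<in> words p \<Longrightarrow> \<exists>s. fword w - Sym s \<in> env_kernel\<close> by metis
    have "(\<Sum>w\<in>words p. fscal (coef p w) * (fword w - Sym (s w))) \<in> env_kernel"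
      by (intro fideal_sum[OF fideal_env_kernel] fideal_left[OF fideal_env_kernel] s)
    then have "p - Sym (\<Sum>w\<in>words p. fscal (coef p w) * s w) \<in> env_kernel"
      by (simp add: right_diff_distrib sum_subtractf free_algebra_expansion[symmetric] lin_sumD lin_scalD)
    then show ?thesis ..
  qed
  have "\<exists>s. fword w - Sym s \<in> env_kernel" for w
  proof (induction w rule: length_induct)
    case (1 w)
    obtain q where q: "fword w - fsym w - q \<in> env_kernel" "\<forall>v\<in>words q. length v < length w"
      using fword_fsym_lower[of w] by (auto simp: lower_def)
    obtain s where "q - Sym s \<in> env_kernel"
      using lin[of q] 1 q(2) by blast
    from fideal_add[OF fideal_env_kernel q(1) this]
    have "fword w - Sym (fword w + s) \<in> env_kernel"
      by (simp add: lin_addD algebra_simps)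
    then show ?case ..
  qed
  then show ?thesis
    by (rule lin)
qed

text \<open>With a symmetric representative s of p, \<open>rep p\<close> is congruent to
  \<open>rep (Sym s)\<close> and hence to \<open>Sym s\<close>; so \<open>rep\<close> computes
  symmetric representatives.\<close>

lemma env_map_rep: "env_map (rep p) = env_map p"
proof -
  obtain s where s: "p - Sym s \<in> env_kernel"
    using ex_symmetric_representative by blast
  have "cg sc (rep p) (rep (Sym s))"
    using cg_add[OF rep_env_kernel[OF s] cg_refl, of "rep (Sym s)"] by (simp add: lin_diffD)
  also have "cg sc \<dots> (Sym s)"
    by (rule rep_Sym)
  finally have "env_map (rep p) = env_map (Sym s)"
    unfolding env_map_eq_iff by (rule cg_imp_env_kernel)
  also have "\<dots> = env_map p"
    using s unfolding env_map_eq_iff[symmetric] by simp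
  finally show ?thesis .
qed

lemma env_product_conv: "env_product sc br w = env_map (fword w)"
proof (induction w)
  case (Cons a w)
  then show ?case
    using env_map_mult[of "fword [a]" "fword w"]
    by (simp add: env_product_def tensor_conv env_map_def fword_append[symmetric])
qed (simp add: env_product_def env_map_one)

lemma quantize_class: "quantize sc br (tensor_class sc p) = env_map (Sym p)"
  unfolding quantize_def
proof (rule tensor_induced_class[OF env_map_ring_hom])
  show "env_map (Sym p) = env_map (Sym q)" if "cg sc p q" for p q
    unfolding env_map_eq_iff using that by (intro cg_imp_env_kernel Sym_cg)
qed (simp_all add: env_product_conv env_map_finsum env_map_mult env_map_def[symmetric] tensor_scalar_conv fsym_def)

text \<open>\<open>rep\<close> is a left inverse of quantization, well defined on the enveloping
  algebra by \<open>rep_env_kernel\<close>.\<close>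

lemma quantize_inj: "inj_on (quantize sc br) (sym_tensors sc)"
proof (rule inj_onI)
  fix x y assume xy: "x \<in> sym_tensors sc" "y \<in> sym_tensors sc" "quantize sc br x = quantize sc br y"
  obtain p q where pq: "x = tensor_class sc p" "y = tensor_class sc q"
    using xy by (auto simp: sym_tensors_def carrier_tensor_algebra)
  then have sym: "cg sc (Sym p) p" "cg sc (Sym q) q"
    using xy by (simp_all add: tensor_class_in_sym_tensors_iff)
  have "Sym p - Sym q \<in> env_kernel"
    using xy(3) by (simp add: pq quantize_class env_map_eq_iff)
  then have "cg sc (rep (Sym p)) (rep (Sym q))"
    using cg_add[OF rep_env_kernel cg_refl, of "Sym p - Sym q" "rep (Sym q)"] by (simp add: lin_diffD)
  then have "cg sc p q"
    using rep_Sym sym by (meson cg_sym cg_trans)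
  then show "x = y"
    by (simp add: pq tensor_class_eq_iff)
qed

text \<open>The value of \<open>rep\<close> is symmetric and has the required image, so injectivity
  singles it out. This explicit form of the product is the one that is estimated.\<close>

lemma quantize_inverse_product:
  "the_inv_into (sym_tensors sc) (quantize sc br)
    (quantize sc br (tensor_class sc p) \<otimes>\<^bsub>env_algebra sc br\<^esub> quantize sc br (tensor_class sc q))
  = tensor_class sc (rep (Sym p * Sym q))"
  by (rule the_inv_into_f_eq[OF quantize_inj])
    (simp_all add: quantize_class env_map_mult env_map_rep tensor_class_in_sym_tensors_iff)

section \<open>The star product on representatives\<close>

definition fstar :: "'k \<Rightarrow> nat \<Rightarrow> nat \<Rightarrow> (('a, 'k) free_alg) \<Rightarrow> (('a, 'k) free_alg) \<Rightarrow> ('a, 'k) free_alg"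
  where "fstar z k l p q = (\<Sum>n\<in>{0..k + l}. fscal (z ^ n) * fproj (k + l - n) (rep (Sym p * Sym q)))"

lemma gutt_star_homogeneous_class:
  "gutt_star_homogeneous sc br z k l (tensor_class sc p) (tensor_class sc q) = tensor_class sc (fstar z k l p q)"
  by (simp add: gutt_star_homogeneous_def quantize_inverse_product tensor_proj_class tensor_scalar_conv
      tensor_class_mult tensor_class_finsum fstar_def)

lemma fstar_cg: "cg sc p p' \<Longrightarrow> cg sc q q' \<Longrightarrow> cg sc (fstar z k l p q) (fstar z k l p' q')"
  unfolding fstar_def by (intro cg_sum cg_left fproj_cg rep_cg cg_mult Sym_cg)

lemma fstar_Sym [simp]: "fstar z k l (Sym p) (Sym q) = fstar z k l p q"
  by (simp add: fstar_def)

lemma fstar_zero: "cg sc p 0 \<Longrightarrow> cg sc (fstar z k l p q) 0" "cg sc q 0 \<Longrightarrow> cg sc (fstar z k l p q) 0"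
  using fstar_cg[of p 0 q q z k l] fstar_cg[of p p q 0 z k l]
  by (simp_all add: fstar_def lin_0 lin_0[OF lin_fproj])

text \<open>The sums in \<open>gutt_star\<close> run over the degrees that actually occur. These are
  at most N and all other terms are congruent to 0, so a range independent of the arguments may be
  used.\<close>

lemma gutt_star_class:
  assumes p: "\<And>w. w \<in> words p \<Longrightarrow> length w \<le> N"
    and q: "\<And>w. w \<in> words q \<Longrightarrow> length w \<le> N"
  shows "gutt_star sc br z (tensor_class sc p) (tensor_class sc q) =
    tensor_class sc (\<Sum>k\<le>N. \<Sum>l\<le>N. fstar z k l (fproj k p) (fproj l q))"
proof -
  have deg: "tensor_degrees sc (symmetrize sc (tensor_class sc r)) = {k. \<not> cg sc (Sym (fproj k r)) 0}" for r
    by (simp add: tensor_degrees_def symmetrize_class tensor_proj_class tensor_class_zero tensor_class_eq_iff fproj_Sym)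
  have zero: "Sym (fproj k r) = 0" if "\<And>w. w \<in> words r \<Longrightarrow> length w \<le> N" "k > N"
    for k and r :: "('a, 'k) free_alg"
  proof -
    have "fproj k r = 0"
    proof (rule lin_eq_on_keys[OF lin_fproj lin_zero])
      fix w assume "w \<in> words r"
      then have "length w \<noteq> k"
        using that(1)[of w] that(2) by linarith
      then show "fproj k (fword w) = 0"
        by (simp add: fproj_fword)
    qed
    then show ?thesis by (simp add: lin_0)
  qed
  let ?D = "{k. \<not> cg sc (Sym (fproj k p)) 0}" and ?E = "{k. \<not> cg sc (Sym (fproj k q)) 0}"
  have D: "?D \<subseteq> {..N}" and E: "?E \<subseteq> {..N}"
  proof -
    have "Sym (fproj k p) = 0" "Sym (fproj k q) = 0" if "N < k" for k
      by (rule zero[OF p that], assumption, rule zero[OF q that], assumption)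
    then show "?D \<subseteq> {..N}" "?E \<subseteq> {..N}"
      by (auto simp: linorder_not_less[symmetric])
  qed
  let ?f = "\<lambda>k l. fstar z k l (Sym (fproj k p)) (Sym (fproj l q))"
  have "gutt_star sc br z (tensor_class sc p) (tensor_class sc q) =
      tensor_class sc (\<Sum>k\<in>?D. \<Sum>l\<in>?E. ?f k l)"
    unfolding gutt_star_def deg
    by (simp only: symmetrize_class tensor_proj_class fproj_Sym gutt_star_homogeneous_class tensor_class_finsum)
  also have "\<dots> = tensor_class sc (\<Sum>k\<le>N. \<Sum>l\<le>N. ?f k l)"
  proof -
    have "(\<Sum>k\<in>?D. \<Sum>l\<in>?E. ?f k l) = (\<Sum>k\<le>N. if k \<in> ?D then \<Sum>l\<in>?E. ?f k l else 0)"
      using D by (intro sum.mono_neutral_cong_left) auto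
    also have "\<dots> = (\<Sum>k\<le>N. if k \<in> ?D then \<Sum>l\<le>N. if l \<in> ?E then ?f k l else 0 else 0)"
      using E by (intro sum.cong refl if_cong sum.mono_neutral_cong_left) auto
    also have "cg sc \<dots> (\<Sum>k\<le>N. \<Sum>l\<le>N. ?f k l)"
    proof (rule cg_sum)
      fix k
      have "cg sc (if k \<in> ?D then \<Sum>l\<le>N. if l \<in> ?E then ?f k l else 0 else 0)
          (\<Sum>l\<le>N. if k \<in> ?D \<and> l \<in> ?E then ?f k l else 0)"
        by simp
      also have "cg sc \<dots> (\<Sum>l\<le>N. ?f k l)"
      proof (rule cg_sum)
        fix l
        show "cg sc (if k \<in> ?D \<and> l \<in> ?E then ?f k l else 0) (?f k l)"
        proof (cases "k \<in> ?D \<and> l \<in> ?E")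
          case False
          then have "cg sc (?f k l) 0"
            using fstar_zero by blast
          then show ?thesis
            by (simp only: False if_False cg_sym)
        qed simp
      qed
      finally show "cg sc (if k \<in> ?D then \<Sum>l\<le>N. if l \<in> ?E then ?f k l else 0 else 0) (\<Sum>l\<le>N. ?f k l)" .
    qed
    finally show ?thesis
      by (simp only: tensor_class_eq_iff)
  qed
  finally show ?thesis by simp
qed

end


section \<open>Weighted norms on the free algebra\<close>

text \<open>A weighted l1 norm of the coefficients of a representative. With weight
  \<open>wprod norm\<close>, its infimum over the homogeneous representatives of a class is the
  projective norm.\<close>

definition wnorm :: "('a list \<Rightarrow> real) \<Rightarrow> ('a list \<Rightarrow>\<^sub>0 'k::real_normed_field) \<Rightarrow> real"
  where "wnorm W p = (\<Sum>w\<in>words p. norm (coef p w) * W w)"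

lemma wnorm_superset:
  assumes "finite A" "words p \<subseteq> A"
  shows "wnorm W p = (\<Sum>w\<in>A. norm (coef p w) * W w)"
  unfolding wnorm_def using assms
  by (intro sum.mono_neutral_left) (auto simp: in_keys_iff)

lemma wnorm_nonneg: "(\<And>w. 0 \<le> W w) \<Longrightarrow> 0 \<le> wnorm W p"
  by (simp add: wnorm_def sum_nonneg)

lemma wnorm_0 [simp]: "wnorm W 0 = 0"
  by (simp add: wnorm_def)

lemma wnorm_single: "wnorm W (Poly_Mapping.single w c) = norm c * W w"
  by (simp add: wnorm_def)

lemma wnorm_fword [simp]: "wnorm W (fword w) = W w"
  by (simp add: fword_def wnorm_single)

lemma wnorm_fscal [simp]: "wnorm W (fscal c) = norm c * W []"
  by (simp add: fscal_def wnorm_single)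

lemma wnorm_add:
  assumes "\<And>w. 0 \<le> W w"
  shows "wnorm W (p + q) \<le> wnorm W p + wnorm W q"
proof -
  let ?A = "words p \<union> words q"
  have "wnorm W (p + q) = (\<Sum>w\<in>?A. norm (coef (p + q) w) * W w)"
    by (intro wnorm_superset keys_add) simp
  also have "\<dots> \<le> (\<Sum>w\<in>?A. norm (coef p w) * W w + norm (coef q w) * W w)"
    unfolding lookup_add distrib_right[symmetric]
    by (intro sum_mono mult_right_mono norm_triangle_ineq assms)
  also have "\<dots> = wnorm W p + wnorm W q"
    by (simp add: sum.distrib wnorm_superset[of ?A])
  finally show ?thesis .
qed

lemma wnorm_sum: "(\<And>w. 0 \<le> W w) \<Longrightarrow> wnorm W (\<Sum>i\<in>A. f i) \<le> (\<Sum>i\<in>A. wnorm W (f i))"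
proof (induction A rule: infinite_finite_induct)
  case (insert x A)
  then show ?case
    using wnorm_add[of W "f x" "\<Sum>i\<in>A. f i"] by simp
qed simp_all

lemma wnorm_scal: "wnorm W (fscal c * p) = norm c * wnorm W p"
proof -
  have "wnorm W (fscal c * p) = (\<Sum>w\<in>words p. norm (coef (fscal c * p) w) * W w)"
    by (intro wnorm_superset) (auto simp: in_keys_iff lookup_fscal_mult)
  then show ?thesis
    by (simp add: wnorm_def lookup_fscal_mult norm_mult sum_distrib_left mult.assoc)
qed

text \<open>For an l1 norm, a bound on the basis words is a bound on the operator with the same
  constant.\<close>

lemma wnorm_lin:
  assumes \<Phi>: "lin \<Phi>" and W': "\<And>w. 0 \<le> W' w" and bound: "\<And>w. wnorm W' (\<Phi> (fword w)) \<le> K * W w"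
  shows "wnorm W' (\<Phi> p) \<le> K * wnorm W p"
proof -
  have "\<Phi> p = (\<Sum>w\<in>words p. fscal (coef p w) * \<Phi> (fword w))"
    by (subst free_algebra_expansion) (simp only: lin_sumD[OF \<Phi>] lin_scalD[OF \<Phi>])
  then have "wnorm W' (\<Phi> p) \<le> (\<Sum>w\<in>words p. norm (coef p w) * wnorm W' (\<Phi> (fword w)))"
    using wnorm_sum[OF W', where f = "\<lambda>w. fscal (coef p w) * \<Phi> (fword w)"
        and A = "words p"]
    by (simp add: wnorm_scal)
  also have "\<dots> \<le> (\<Sum>w\<in>words p. norm (coef p w) * (K * W w))"
    by (intro sum_mono mult_left_mono bound) simp
  also have "\<dots> = K * wnorm W p"
    by (simp add: wnorm_def sum_distrib_left algebra_simps)
  finally show ?thesis .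
qed

lemma wnorm_mono:
  assumes "\<And>w. 0 \<le> W' w" "\<And>w. W' w \<le> K * W w"
  shows "wnorm W' p \<le> K * wnorm W p"
  using wnorm_lin[OF lin_id, of W' K W] assms by simp

lemma wnorm_mult:
  assumes W: "\<And>w. 0 \<le> W w" and V: "\<And>u v. W (u @ v) \<le> V u * V' v" "\<And>w. 0 \<le> V w" "\<And>w. 0 \<le> V' w"
  shows "wnorm W (p * q) \<le> wnorm V p * wnorm V' q"
proof -
  have "wnorm W (fword u * q) \<le> V u * wnorm V' q" for u
    using W V(1) by (intro wnorm_lin[OF lin_mult_left[OF lin_id]]) (simp_all add: fword_append[symmetric])
  then have "wnorm W (p * q) \<le> wnorm V' q * wnorm V p"
    by (intro wnorm_lin[OF lin_mult_right[OF lin_id] W]) (simp add: mult.commute)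
  then show ?thesis
    by (simp add: mult.commute)
qed

lemma wnorm_Sym:
  assumes W: "\<And>w. 0 \<le> W w" and mset: "\<And>u v. mset u = mset v \<Longrightarrow> W u = W v"
  shows "wnorm W (Sym p) \<le> wnorm W p"
proof -
  have "wnorm W (fsym w :: 'a list \<Rightarrow>\<^sub>0 'b) \<le> W w" for w
  proof -
    have "wnorm W (\<Sum>\<sigma> | \<sigma> permutes {..<length w}. fword (permute_list \<sigma> w) :: 'a list \<Rightarrow>\<^sub>0 'b)
        \<le> (\<Sum>\<sigma> | \<sigma> permutes {..<length w}. W (permute_list \<sigma> w))"
      using wnorm_sum[OF W, where f = "\<lambda>\<sigma>. fword (permute_list \<sigma> w) :: 'a list \<Rightarrow>\<^sub>0 'b"] by simp
    also have "\<dots> = (\<Sum>\<sigma> | \<sigma> permutes {..<length w}. W w)"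
      by (intro sum.cong refl mset) simp
    also have "\<dots> = fact (length w) * W w"
      by (simp add: card_permutations[OF card_lessThan finite_lessThan] del: card_permutations)
    finally have "norm (1 / fact (length w) :: 'b) *
        wnorm W (\<Sum>\<sigma> | \<sigma> permutes {..<length w}. fword (permute_list \<sigma> w) :: 'a list \<Rightarrow>\<^sub>0 'b)
        \<le> norm (1 / fact (length w) :: 'b) * (fact (length w) * W w)"
      by (rule mult_left_mono) simp
    then show ?thesis
      by (simp add: fsym_def wnorm_scal norm_divide norm_fact)
  qed
  then show ?thesis
    using wnorm_lin[OF lin_ext, of W fsym 1 W p] W by simp
qed

lemma lookup_fproj: "coef (fproj n p) w = (if length w = n then coef p w else 0)"
proof (induction p rule: free_algebra_induct)
  case (word v)
  then show ?case
    by (simp add: fproj_fword) (auto simp: fword_def lookup_single when_def)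
qed (simp_all add: lin_0[OF lin_fproj] lin_addD[OF lin_fproj] lin_scalD[OF lin_fproj] lookup_add lookup_fscal_mult)

lemma keys_fproj: "words (fproj n p) = {w \<in> words p. length w = n}"
  by (auto simp: in_keys_iff lookup_fproj split: if_splits)

lemma wnorm_fproj_le: "(\<And>w. 0 \<le> W w) \<Longrightarrow> wnorm W (fproj n p) \<le> wnorm W p"
  using wnorm_lin[OF lin_fproj, of W n 1 W p] by (simp add: fproj_fword)

lemma wnorm_fproj_cong:
  assumes "\<And>w. length w = n \<Longrightarrow> W w = K * W' w"
  shows "wnorm W (fproj n p) = K * wnorm W' (fproj n p)"
  by (simp add: wnorm_def keys_fproj assms sum_distrib_left algebra_simps)

lemma wnorm_eq_sum_fproj:
  assumes "\<And>w. w \<in> words p \<Longrightarrow> length w \<le> N"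
  shows "wnorm W p = (\<Sum>n\<le>N. wnorm W (fproj n p))"
proof -
  have "wnorm W (fproj n p) = (\<Sum>w | w \<in> words p \<and> length w = n. norm (coef p w) * W w)" for n
    by (simp add: wnorm_def keys_fproj lookup_fproj)
  then have "(\<Sum>n\<le>N. wnorm W (fproj n p)) =
      (\<Sum>n\<le>N. \<Sum>w | w \<in> words p \<and> length w = n. norm (coef p w) * W w)"
    by simp
  also have "\<dots> = wnorm W p"
    unfolding wnorm_def using assms by (intro sum.group) auto
  finally show ?thesis ..
qed

abbreviation wprod :: "('a \<Rightarrow> real) \<Rightarrow> 'a list \<Rightarrow> real"
  where "wprod N w \<equiv> prod_list (map N w)"

lemma wprod_nonneg: "(\<And>\<xi>. 0 \<le> N \<xi>) \<Longrightarrow> 0 \<le> wprod N w"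
  by (induction w) simp_all

lemma wprod_mset: "mset u = mset v \<Longrightarrow> wprod N u = wprod N v"
  by (metis mset_map prod_mset_prod_list)

lemma wprod_mono:
  assumes "\<And>\<xi>. 0 \<le> N \<xi>" "\<And>\<xi>. N \<xi> \<le> K * N' \<xi>" "0 \<le> K"
  shows "wprod N w \<le> K ^ length w * wprod N' w"
proof (induction w)
  case (Cons a w)
  have "N a * wprod N w \<le> (K * N' a) * (K ^ length w * wprod N' w)"
    using assms order_trans[OF assms(1,2)] Cons by (intro mult_mono wprod_nonneg) simp_all
  then show ?case by (simp add: algebra_simps)
qed simp


section \<open>Renorming a uniformly topologically nilpotent algebra\<close>

context banach_lie_algebra
begin

lemma br_scaleR_left: "br (r *\<^sub>R \<xi>) \<eta> = r *\<^sub>R br \<xi> \<eta>"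
  by (metis br_sc_left scale_of_real)

lemma foldr_br_scaleR: "foldr br w (r *\<^sub>R \<xi>) = r *\<^sub>R foldr br w \<xi>"
  by (induction w) (simp_all add: br_scaleR_right)

lemma norm_foldr_br_unit:
  assumes "\<And>\<eta>. \<eta> \<in> set w \<Longrightarrow> norm \<eta> = 1"
  shows "norm (foldr br w \<xi>) \<le> norm \<xi>"
  using assms
proof (induction w)
  case (Cons a w)
  then have "norm (br a (foldr br w \<xi>)) \<le> 1 * norm (foldr br w \<xi>)"
    using norm_br[of a] by (metis list.set_intros(1))
  with Cons show ?case by simp
qed simp

lemma bounded_linear_foldr_br:
  assumes "\<And>\<eta>. \<eta> \<in> set w \<Longrightarrow> norm \<eta> = 1"
  shows "bounded_linear (foldr br w)"
  using norm_foldr_br_unit[of w] assms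
  by (intro bounded_linear_intro[where K = 1]) (simp_all add: foldr_br_linear foldr_br_scaleR)

text \<open>Words longer than some n0 are controlled by \<open>ad_growth br n < \<delta>\<close>.
  The finitely many shorter lengths use that a bracket with a unit vector does not increase the
  norm, and \<open>A\<close> makes up for the missing powers of \<delta>. Lengths above n0 are
  positive, so that \<open>root\<close> can be inverted there.\<close>

lemma norm_foldr_br_decay:
  assumes nil: "uniformly_top_nilpotent br" and \<delta>: "0 < \<delta>" "\<delta> \<le> 1"
  obtains A where "1 \<le> A"
    "\<And>w \<xi>. (\<And>\<eta>. \<eta> \<in> set w \<Longrightarrow> norm \<eta> = 1) \<Longrightarrow> norm (foldr br w \<xi>) \<le> A * \<delta> ^ length w * norm \<xi>"
proof -
  have "\<forall>\<^sub>F n in sequentially. ad_growth br n < \<delta>"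
    using order_tendstoD(2)[OF nil[unfolded uniformly_top_nilpotent_def] \<delta>(1)] .
  then obtain n0 where n0: "\<And>n. n \<ge> n0 \<Longrightarrow> ad_growth br n < \<delta>"
    by (auto simp: eventually_sequentially)
  show thesis
  proof
    show A: "1 \<le> (1 / \<delta>) ^ Suc n0"
      using \<delta> by (intro one_le_power) simp
    fix w :: "'a list" and \<xi> assume w: "\<And>\<eta>. \<eta> \<in> set w \<Longrightarrow> norm \<eta> = 1"
    have le_norm: "norm (foldr br w \<xi>) \<le> norm \<xi>" and blin: "bounded_linear (foldr br w)"
      by (rule norm_foldr_br_unit bounded_linear_foldr_br; simp add: w)+
    let ?n = "length w"
    show "norm (foldr br w \<xi>) \<le> (1 / \<delta>) ^ Suc n0 * \<delta> ^ ?n * norm \<xi>"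
    proof (cases "?n \<le> n0")
      case True
      have "\<delta> ^ Suc n0 \<le> \<delta> ^ ?n"
        using True \<delta> by (intro power_decreasing) simp_all
      then have "1 \<le> (1 / \<delta>) ^ Suc n0 * \<delta> ^ ?n"
        using \<delta> by (simp add: power_divide field_simps del: power_Suc)
      then have "1 * norm \<xi> \<le> (1 / \<delta>) ^ Suc n0 * \<delta> ^ ?n * norm \<xi>"
        by (rule mult_right_mono) simp
      then show ?thesis
        using le_norm by simp
    next
      case False
      let ?S = "{root ?n (onorm (foldr br \<xi>s)) | \<xi>s. length \<xi>s = ?n \<and> (\<forall>\<xi>\<in>set \<xi>s. norm \<xi> = 1)}"
      have onorm: "onorm (foldr br v) \<le> 1" if "\<forall>\<xi>\<in>set v. norm \<xi> = 1" for v
        using norm_foldr_br_unit[of v] that by (intro onorm_bound) auto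
      have "bdd_above ?S"
        using onorm False by (intro bdd_aboveI[of _ 1]) (auto intro!: real_root_le_1_iff[THEN iffD2])
      then have "root ?n (onorm (foldr br w)) \<le> ad_growth br ?n"
        unfolding ad_growth_def using w by (intro cSup_upper) auto
      also have "\<dots> \<le> \<delta>"
        using n0[of ?n] False by simp
      finally have "onorm (foldr br w) \<le> \<delta> ^ ?n"
        using False onorm_pos_le[OF blin] \<delta>
        by (metis linorder_not_le less_nat_zero_code not_gr_zero power_mono real_root_ge_zero real_root_pow_pos2)
      moreover have "norm (foldr br w \<xi>) \<le> onorm (foldr br w) * norm \<xi>"
        by (rule Operator_Norm.onorm[OF blin])
      ultimately have "norm (foldr br w \<xi>) \<le> \<delta> ^ ?n * norm \<xi>"
        by (meson mult_right_mono norm_ge_zero order_trans)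
      also have "\<dots> \<le> (1 / \<delta>) ^ Suc n0 * \<delta> ^ ?n * norm \<xi>"
        using mult_right_mono[OF A, of "\<delta> ^ ?n * norm \<xi>"] \<delta> by (simp add: mult.assoc)
      finally show ?thesis .
    qed
  qed
qed

text \<open>
  The gauge is the maximum of an equivalent norm \<open>q\<close>, for which each \<open>ad \<eta>\<close> has operator norm at
  most \<open>\<delta> \<parallel>\<eta>\<parallel>\<close>, and of the operator norm of \<open>ad\<close> with respect to \<open>q\<close>, both suitably scaled.  Only
  the operator norm part controls a bracket of brackets with a single factor \<open>A\<close>.  No triangle
  inequality is needed for the gauge, since the estimates below are made on words.
\<close>

lemma bracket_gauge:
  assumes nil: "uniformly_top_nilpotent br" and \<epsilon>: "0 < \<epsilon>"
  obtains N :: "'a \<Rightarrow> real" and A where "1 \<le> A" "\<And>\<xi>. 0 \<le> N \<xi>" "\<And>\<xi>. N \<xi> \<le> norm \<xi>"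
    "\<And>\<xi>. norm \<xi> \<le> A * N \<xi>" "\<And>\<xi> \<eta>. N (br \<xi> \<eta>) \<le> \<epsilon> * N \<xi> * N \<eta>"
proof -
  \<comment> \<open>The half pays for the two terms that the Jacobi identity produces in
    \<open>op_br\<close>; the bound 1 is needed for \<open>norm_foldr_br_decay\<close>.\<close>
  define \<delta> where "\<delta> = min 1 (\<epsilon> / 2)"
  have \<delta>: "0 < \<delta>" "\<delta> \<le> 1" "2 * \<delta> \<le> \<epsilon>"
    using \<epsilon> by (auto simp: \<delta>_def)
  obtain A where A: "1 \<le> A" and decay:
    "\<And>w \<xi>. (\<And>\<eta>. \<eta> \<in> set w \<Longrightarrow> norm \<eta> = 1) \<Longrightarrow> norm (foldr br w \<xi>) \<le> A * \<delta> ^ length w * norm \<xi>"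
    using norm_foldr_br_decay[OF nil \<delta>(1,2)] by blast
  define unit where "unit = {w :: 'a list. \<forall>\<eta>\<in>set w. norm \<eta> = 1}"
  \<comment> \<open>The supremum over all words makes a further unit letter at the inner end cost
    exactly one factor \<delta>, which is \<open>q_br\<close>. The decay keeps \<open>q\<close>
    below \<open>A * norm \<xi>\<close>, and the empty word keeps it above
    \<open>norm \<xi>\<close>.\<close>
  define q where "q \<xi> = (SUP w\<in>unit. norm (foldr br w \<xi>) / \<delta> ^ length w)" for \<xi>
  have Nil: "[] \<in> unit"
    by (simp add: unit_def)
  have unit_bound: "norm (foldr br w \<xi>) / \<delta> ^ length w \<le> A * norm \<xi>" if "w \<in> unit" for w \<xi>
    using decay[of w \<xi>] that \<delta> by (simp add: unit_def field_simps)
  then have bdd: "bdd_above ((\<lambda>w. norm (foldr br w \<xi>) / \<delta> ^ length w) ` unit)" for \<xi>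
    by (auto intro!: bdd_aboveI[of _ "A * norm \<xi>"])
  have q_upper: "norm (foldr br w \<xi>) / \<delta> ^ length w \<le> q \<xi>" if "w \<in> unit" for w \<xi>
    unfolding q_def using that by (intro cSUP_upper bdd)
  have q_least: "q \<xi> \<le> C" if "\<And>w. w \<in> unit \<Longrightarrow> norm (foldr br w \<xi>) / \<delta> ^ length w \<le> C" for \<xi> C
    unfolding q_def using that Nil by (intro cSUP_least) auto
  have q_norm: "norm \<xi> \<le> q \<xi>" for \<xi>
    using q_upper[OF Nil, of \<xi>] by simp
  have q_nonneg: "0 \<le> q \<xi>" for \<xi>
    using q_norm[of \<xi>] norm_ge_zero[of \<xi>] by linarith
  have q_le: "q \<xi> \<le> A * norm \<xi>" for \<xi>
    by (intro q_least unit_bound)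
  have q_add: "q (\<xi> + \<eta>) \<le> q \<xi> + q \<eta>" for \<xi> \<eta>
  proof (rule q_least)
    fix w assume w: "w \<in> unit"
    have "norm (foldr br w (\<xi> + \<eta>)) / \<delta> ^ length w
        \<le> norm (foldr br w \<xi>) / \<delta> ^ length w + norm (foldr br w \<eta>) / \<delta> ^ length w"
      unfolding foldr_br_linear add_divide_distrib[symmetric]
      using \<delta> by (intro divide_right_mono norm_triangle_ineq) simp
    then show "norm (foldr br w (\<xi> + \<eta>)) / \<delta> ^ length w \<le> q \<xi> + q \<eta>"
      using q_upper[OF w, of \<xi>] q_upper[OF w, of \<eta>] by linarith
  qed
  have foldr_minus: "foldr br w (- \<xi>) = - foldr br w \<xi>" for w \<xi>
    using foldr_br_scaleR[of w "-1" \<xi>] by simp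
  have q_minus: "q (- \<xi>) = q \<xi>" for \<xi>
    unfolding q_def foldr_minus by simp
  have q_diff: "q (\<xi> - \<eta>) \<le> q \<xi> + q \<eta>" for \<xi> \<eta>
    using q_add[of \<xi> "- \<eta>"] by (simp add: q_minus)
  have q_zero: "q 0 = 0"
    using q_le[of 0] q_nonneg[of 0] by simp
  have q_br: "q (br \<eta> \<xi>) \<le> \<delta> * norm \<eta> * q \<xi>" for \<eta> \<xi>
  proof (cases "\<eta> = 0")
    case True
    then have "br \<eta> \<xi> = 0"
      using br_scaleR_left[of 0 0 \<xi>] by simp
    then show ?thesis
      by (simp add: q_zero True)
  next
    case False
    show ?thesis
    proof (rule q_least)
      fix w assume w: "w \<in> unit"
      define e where "e = (1 / norm \<eta>) *\<^sub>R \<eta>"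
      have "w @ [e] \<in> unit"
        using w False by (simp add: unit_def e_def)
      from q_upper[OF this, of \<xi>]
      have "norm (foldr br w (br e \<xi>)) \<le> \<delta> * \<delta> ^ length w * q \<xi>"
        using \<delta> by (simp add: field_simps)
      moreover have "br \<eta> \<xi> = norm \<eta> *\<^sub>R br e \<xi>"
        using False by (simp add: e_def br_scaleR_left)
      ultimately have "norm (foldr br w (br \<eta> \<xi>)) \<le> norm \<eta> * (\<delta> * \<delta> ^ length w * q \<xi>)"
        by (simp add: foldr_br_scaleR mult_left_mono)
      then show "norm (foldr br w (br \<eta> \<xi>)) / \<delta> ^ length w \<le> \<delta> * norm \<eta> * q \<xi>"
        using \<delta> by (simp add: field_simps)
    qed
  qed
  \<comment> \<open>Written as the infimum of the admissible constants, so that upper bounds are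
    immediate from \<open>op_lower\<close>; \<open>op_bound\<close> says that the infimum is itself
    admissible.\<close>
  define op where "op \<eta> = (INF C\<in>{C. 0 \<le> C \<and> (\<forall>\<xi>. q (br \<eta> \<xi>) \<le> C * q \<xi>)}. C)" for \<eta>
  have op_mem: "\<delta> * norm \<eta> \<in> {C. 0 \<le> C \<and> (\<forall>\<xi>. q (br \<eta> \<xi>) \<le> C * q \<xi>)}" for \<eta>
    using q_br[of \<eta>] \<delta> by simp
  have op_lower: "op \<eta> \<le> C" if "0 \<le> C" "\<And>\<xi>. q (br \<eta> \<xi>) \<le> C * q \<xi>" for \<eta> C
    unfolding op_def using that by (intro cINF_lower2[where x = C]) (auto intro: bdd_belowI[of _ 0])
  have op_nonneg: "0 \<le> op \<eta>" for \<eta>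
    unfolding op_def using op_mem[of \<eta>] by (intro cINF_greatest) auto
  have op_bound: "q (br \<eta> \<xi>) \<le> op \<eta> * q \<xi>" for \<eta> \<xi>
  proof (cases "q \<xi> = 0")
    case True
    then show ?thesis
      using q_br[of \<eta> \<xi>] by simp
  next
    case False
    then have "0 < q \<xi>"
      using q_nonneg[of \<xi>] by simp
    then have "q (br \<eta> \<xi>) / q \<xi> \<le> op \<eta>"
      unfolding op_def using op_mem[of \<eta>]
      by (intro cINF_greatest) (auto simp: divide_le_eq)
    with \<open>0 < q \<xi>\<close> show ?thesis
      by (simp add: divide_le_eq)
  qed
  have op_le: "op \<eta> \<le> \<delta> * norm \<eta>" for \<eta>
    using op_mem[of \<eta>] by (intro op_lower) auto
  have op_br: "op (br \<xi> \<eta>) \<le> 2 * (op \<xi> * op \<eta>)" for \<xi> \<eta>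
  proof (rule op_lower)
    fix \<zeta>
    have "br (br \<xi> \<eta>) \<zeta> = br \<xi> (br \<eta> \<zeta>) - br \<eta> (br \<xi> \<zeta>)"
      by (simp add: br_derivation[of \<xi> \<eta> \<zeta>])
    then have "q (br (br \<xi> \<eta>) \<zeta>) \<le> q (br \<xi> (br \<eta> \<zeta>)) + q (br \<eta> (br \<xi> \<zeta>))"
      by (simp add: q_diff)
    also have "\<dots> \<le> op \<xi> * (op \<eta> * q \<zeta>) + op \<eta> * (op \<xi> * q \<zeta>)"
      by (intro add_mono order_trans[OF op_bound] mult_left_mono op_bound op_nonneg)
    finally show "q (br (br \<xi> \<eta>) \<zeta>) \<le> 2 * (op \<xi> * op \<eta>) * q \<zeta>"
      by (simp add: algebra_simps)
  qed (simp add: op_nonneg)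
  \<comment> \<open>The divisors A and \<delta> are the constants of \<open>q_le\<close> and
    \<open>op_le\<close>, so both parts are at most \<open>norm \<xi>\<close>.\<close>
  define N where "N \<xi> = max (q \<xi> / A) (op \<xi> / \<delta>)" for \<xi>
  have N: "q \<xi> \<le> A * N \<xi>" "op \<xi> \<le> \<delta> * N \<xi>" "0 \<le> N \<xi>" for \<xi>
  proof -
    have "q \<xi> / A \<le> N \<xi>" "op \<xi> / \<delta> \<le> N \<xi>"
      by (simp_all add: N_def)
    then show "q \<xi> \<le> A * N \<xi>" "op \<xi> \<le> \<delta> * N \<xi>"
      using A \<delta> by (simp_all add: divide_le_eq mult.commute)
    show "0 \<le> N \<xi>"
      using q_nonneg[of \<xi>] A by (simp add: N_def le_max_iff_disj)
  qed
  show thesis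
  proof (rule that[OF A, of N])
    fix \<xi> \<eta>
    show "0 \<le> N \<xi>"
      by (rule N)
    show "N \<xi> \<le> norm \<xi>"
      using q_le[of \<xi>] op_le[of \<xi>] A \<delta> by (simp add: N_def divide_le_eq mult.commute)
    show "norm \<xi> \<le> A * N \<xi>"
      using q_norm[of \<xi>] N(1)[of \<xi>] by linarith
    have "q (br \<xi> \<eta>) \<le> op \<xi> * q \<eta>"
      by (rule op_bound)
    \<comment> \<open>Only one factor is measured by \<open>q\<close>, so the single A cancels
      against the divisor of \<open>q\<close> in \<open>N\<close>.\<close>
    also have "\<dots> \<le> (\<delta> * N \<xi>) * (A * N \<eta>)"
      using N \<delta> by (intro mult_mono q_nonneg) simp_all
    finally have 1: "q (br \<xi> \<eta>) / A \<le> \<delta> * (N \<xi> * N \<eta>)"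
      using A by (simp add: divide_le_eq algebra_simps)
    have "op (br \<xi> \<eta>) \<le> 2 * (op \<xi> * op \<eta>)"
      by (rule op_br)
    also have "\<dots> \<le> 2 * ((\<delta> * N \<xi>) * (\<delta> * N \<eta>))"
      using N \<delta> by (intro mult_left_mono mult_mono op_nonneg) simp_all
    finally have 2: "op (br \<xi> \<eta>) / \<delta> \<le> 2 * \<delta> * (N \<xi> * N \<eta>)"
      using \<delta> by (simp add: divide_le_eq algebra_simps)
    have "0 \<le> N \<xi> * N \<eta>"
      by (simp add: N)
    then have "\<delta> * (N \<xi> * N \<eta>) \<le> \<epsilon> * (N \<xi> * N \<eta>)" "2 * \<delta> * (N \<xi> * N \<eta>) \<le> \<epsilon> * (N \<xi> * N \<eta>)"
      using \<delta> by (intro mult_right_mono; simp)+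
    then show "N (br \<xi> \<eta>) \<le> \<epsilon> * N \<xi> * N \<eta>"
      using 1 2 by (simp add: N_def[of "br \<xi> \<eta>"] mult.assoc)
  qed
qed


section \<open>Estimates for products in the enveloping algebra\<close>

text \<open>The quotient (m + c)! / m! increases with m.\<close>

lemma fact_mult_le:
  assumes "m \<le> d"
  shows "fact d * fact (m + c) \<le> (fact (d + c) * fact m :: real)"
  using assms
proof (induction d rule: dec_induct)
  case (step d)
  have "fact (Suc d) * fact (m + c) = real (Suc d) * (fact d * fact (m + c))"
    by simp
  also have "\<dots> \<le> real (Suc (d + c)) * (fact (d + c) * fact m)"
    by (rule mult_mono[OF _ step.IH]) simp_all
  finally show ?case
    by simp
qed (simp add: mult.commute)

lemma fact_add_le: "fact (k + l) \<le> (2 ^ (k + l) * (fact k * fact l) :: real)"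
proof -
  have "fact k * fact l * ((k + l) choose k) = fact (k + l)"
    using binomial_fact_lemma[of k "k + l"] by simp
  moreover have "(k + l) choose k \<le> 2 ^ (k + l)"
    by (rule binomial_le_pow2)
  ultimately have "fact (k + l) \<le> (2 ^ (k + l) * (fact k * fact l) :: nat)"
    by (metis mult.commute mult_le_mono1)
  then have "real (fact (k + l)) \<le> real (2 ^ (k + l) * (fact k * fact l))"
    by (simp only: of_nat_le_iff)
  then show ?thesis by simp
qed

context
  fixes N :: "'a \<Rightarrow> real" and \<tau> :: real
  assumes N_nonneg: "\<And>\<xi>. 0 \<le> N \<xi>" and \<tau>_pos: "0 < \<tau>"
    and N_br: "\<And>\<xi> \<eta>. N (br \<xi> \<eta>) \<le> \<tau> / 2 * N \<xi> * N \<eta>"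
begin

text \<open>The shift \<open>i\<close> counts the left multiplications still to come:
  \<open>lmul\<close> is bounded from the weight \<open>Suc i\<close> to the weight
  \<open>i\<close>, so no factorial is lost from step to step.\<close>

definition fweight :: "nat \<Rightarrow> 'a list \<Rightarrow> real"
  where "fweight i w = fact (length w + i) * \<tau> ^ length w * wprod N w"

lemma fweight_nonneg: "0 \<le> fweight i w"
  using \<tau>_pos by (simp add: fweight_def wprod_nonneg N_nonneg)

lemma fweight_mset: "mset u = mset v \<Longrightarrow> fweight i u = fweight i v"
  using mset_eq_length[of u v] wprod_mset[of u v N] by (simp add: fweight_def)

lemma N_foldr_br: "N (foldr br w \<xi>) \<le> (\<tau> / 2) ^ length w * (wprod N w * N \<xi>)"
proof (induction w)
  case (Cons a w)
  have "N (foldr br (a # w) \<xi>) \<le> (\<tau> / 2 * N a) * N (foldr br w \<xi>)"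
    using N_br[of a] by simp
  also have "\<dots> \<le> (\<tau> / 2 * N a) * ((\<tau> / 2) ^ length w * (wprod N w * N \<xi>))"
    using \<tau>_pos by (intro mult_left_mono Cons) (simp add: N_nonneg)
  finally show ?case
    by (simp add: algebra_simps)
qed simp

lemma sum_half_powers: "(\<Sum>j\<le>d. (1 / 2) ^ j) \<le> (2 :: real)"
proof -
  have "(\<Sum>j\<le>d. (1 / 2 :: real) ^ j) = 2 - (1 / 2) ^ d"
    by (induction d) simp_all
  then show ?thesis by simp
qed

text \<open>A consumed letter is charged \<tau> / 2 by the bracket instead of \<tau> by the weight,
  which leaves \<open>(1 / 2) ^ j\<close>. The factor k! / (k - j)! is paid for by the shorter word,
  through \<open>fact_mult_le\<close> with \<open>m = k - j\<close> and \<open>c = Suc i\<close>.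
  The geometric sum contributes the 2.\<close>

lemma wnorm_bern_word: "wnorm (fweight i) (bern_word \<xi> w) \<le> 2 * \<tau> * N \<xi> * fweight (Suc i) w"
proof -
  let ?d = "length w"
  have "wnorm (fweight i) (bern_word \<xi> w) \<le>
      (\<Sum>j\<le>?d. (fact ?d / fact (?d - j) * \<bar>bern j\<bar>) * fweight i (foldr br (take j w) \<xi> # drop j w))"
  proof -
    have "norm (of_real (fact ?d / fact (?d - j) * bern j) :: 'k) = fact ?d / fact (?d - j) * \<bar>bern j\<bar>" for j
      unfolding norm_of_real by (simp add: abs_mult)
    then show ?thesis
      unfolding bern_word_def
      by (intro order_trans[OF wnorm_sum[OF fweight_nonneg]]) (simp only: wnorm_scal wnorm_fword order_refl)
  qed
  also have "\<dots> \<le> (\<Sum>j\<le>?d. (1 / 2) ^ j * (\<tau> * N \<xi> * fweight (Suc i) w))"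
  proof (rule sum_mono)
    fix j assume "j \<in> {..?d}"
    then have j: "j \<le> ?d" by simp
    have split: "wprod N w = wprod N (take j w) * wprod N (drop j w)"
      by (metis append_take_drop_id map_append prod_list.append)
    have pow: "\<tau> ^ Suc (?d - j) * (\<tau> / 2) ^ j = \<tau> * \<tau> ^ ?d * (1 / 2) ^ j"
      using j by (simp add: power_divide power_add[symmetric])
    have "fweight i (foldr br (take j w) \<xi> # drop j w)
        = fact (Suc (?d - j) + i) * \<tau> ^ Suc (?d - j) * (N (foldr br (take j w) \<xi>) * wprod N (drop j w))"
      by (simp add: fweight_def)
    also have "\<dots> \<le> fact (Suc (?d - j) + i) * \<tau> ^ Suc (?d - j) *
        (((\<tau> / 2) ^ j * (wprod N (take j w) * N \<xi>)) * wprod N (drop j w))"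
    proof -
      have "length (take j w) = j"
        using j by simp
      then have "N (foldr br (take j w) \<xi>) \<le> (\<tau> / 2) ^ j * (wprod N (take j w) * N \<xi>)"
        using N_foldr_br[of "take j w" \<xi>] by simp
      then show ?thesis
        using \<tau>_pos by (intro mult_left_mono mult_right_mono) (simp_all add: wprod_nonneg N_nonneg)
    qed
    also have "\<dots> = fact (Suc (?d - j) + i) * (\<tau> ^ Suc (?d - j) * (\<tau> / 2) ^ j) * (N \<xi> * wprod N w)"
      by (simp only: split mult_ac)
    finally have weight: "fweight i (foldr br (take j w) \<xi> # drop j w)
        \<le> fact (Suc (?d - j) + i) * (\<tau> * \<tau> ^ ?d * (1 / 2) ^ j) * (N \<xi> * wprod N w)"
      unfolding pow .
    have "fact ?d * fact (?d - j + Suc i) \<le> (fact (?d + Suc i) * fact (?d - j) :: real)"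
      by (rule fact_mult_le) simp
    then have fact: "fact ?d / fact (?d - j) * fact (Suc (?d - j) + i) \<le> (fact (?d + Suc i) :: real)"
      by (simp add: divide_le_eq del: fact_Suc)
    have "(fact ?d / fact (?d - j) * \<bar>bern j\<bar>) * fweight i (foldr br (take j w) \<xi> # drop j w)
        \<le> (fact ?d / fact (?d - j) * 1) * (fact (Suc (?d - j) + i) * (\<tau> * \<tau> ^ ?d * (1 / 2) ^ j) * (N \<xi> * wprod N w))"
      by (intro mult_mono mult_left_mono abs_bern_le_1 weight fweight_nonneg) simp_all
    also have "\<dots> = (fact ?d / fact (?d - j) * fact (Suc (?d - j) + i)) * ((\<tau> * \<tau> ^ ?d * (1 / 2) ^ j) * (N \<xi> * wprod N w))"
      by (simp only: mult_ac mult_1_right)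
    also have "\<dots> \<le> fact (?d + Suc i) * ((\<tau> * \<tau> ^ ?d * (1 / 2) ^ j) * (N \<xi> * wprod N w))"
      using \<tau>_pos by (intro mult_right_mono fact) (simp add: wprod_nonneg N_nonneg)
    also have "\<dots> = (1 / 2) ^ j * (\<tau> * N \<xi> * fweight (Suc i) w)"
      by (simp only: fweight_def mult_ac)
    finally show "(fact ?d / fact (?d - j) * \<bar>bern j\<bar>) * fweight i (foldr br (take j w) \<xi> # drop j w)
        \<le> (1 / 2) ^ j * (\<tau> * N \<xi> * fweight (Suc i) w)" .
  qed
  also have "\<dots> = (\<Sum>j\<le>?d. (1 / 2) ^ j) * (\<tau> * N \<xi> * fweight (Suc i) w)"
    by (rule sum_distrib_right[symmetric])
  also have "\<dots> \<le> 2 * (\<tau> * N \<xi> * fweight (Suc i) w)"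
    using \<tau>_pos by (intro mult_right_mono sum_half_powers) (simp add: fweight_nonneg N_nonneg)
  finally show ?thesis
    by (simp add: mult.assoc)
qed

lemma wnorm_lmul: "wnorm (fweight i) (lmul \<xi> p) \<le> 2 * \<tau> * N \<xi> * wnorm (fweight (Suc i)) p"
proof -
  have nn: "0 \<le> 2 * \<tau> * N \<xi>"
    using \<tau>_pos by (simp add: N_nonneg)
  have "wnorm (fweight i) (lmul \<xi> p) \<le> wnorm (fweight i) (ext (bern_word \<xi>) (Sym p))"
    unfolding lmul_def by (intro wnorm_Sym fweight_nonneg fweight_mset)
  also have "\<dots> \<le> 2 * \<tau> * N \<xi> * wnorm (fweight (Suc i)) (Sym p)"
    by (intro wnorm_lin[OF lin_ext] fweight_nonneg) (simp add: wnorm_bern_word)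
  also have "\<dots> \<le> 2 * \<tau> * N \<xi> * wnorm (fweight (Suc i)) p"
    by (intro mult_left_mono nn wnorm_Sym fweight_nonneg fweight_mset)
  finally show ?thesis .
qed

lemma wnorm_foldr_lmul:
  "wnorm (fweight i) (foldr lmul u p) \<le> (2 * \<tau>) ^ length u * wprod N u * wnorm (fweight (i + length u)) p"
proof (induction u arbitrary: i)
  case (Cons a u)
  have "wnorm (fweight i) (foldr lmul (a # u) p) \<le> 2 * \<tau> * N a * wnorm (fweight (Suc i)) (foldr lmul u p)"
    using wnorm_lmul[of i a] by simp
  also have "\<dots> \<le> 2 * \<tau> * N a * ((2 * \<tau>) ^ length u * wprod N u * wnorm (fweight (Suc i + length u)) p)"
    using \<tau>_pos by (intro mult_left_mono Cons) (simp add: N_nonneg)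
  finally show ?case
    by (simp add: algebra_simps)
qed simp

lemma wnorm_rep: "wnorm (fweight 0) (rep p) \<le> wnorm (\<lambda>w. fact (length w) * (2 * \<tau>) ^ length w * wprod N w) p"
proof -
  have "wnorm (fweight 0) (rep_word w) \<le> fact (length w) * (2 * \<tau>) ^ length w * wprod N w" for w
    using wnorm_foldr_lmul[of 0 w 1] wnorm_fword[of "fweight (length w)" "[]", where 'b = 'k]
    by (simp add: rep_word_def fweight_def algebra_simps del: wnorm_fword)
  then show ?thesis
    using wnorm_lin[OF lin_ext, of "fweight 0" rep_word 1] fweight_nonneg by simp
qed

text \<open>One factor 2 per letter comes from \<open>wnorm_rep\<close>, the other from separating
  (k + l)! into k! l!; together they turn \<tau> into 4 \<tau>.\<close>

lemma wnorm_rep_mult: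
  assumes N_le: "\<And>\<xi>. N \<xi> \<le> norm \<xi>"
  shows "wnorm (fweight 0) (rep (Sym p * Sym q)) \<le>
    wnorm (\<lambda>w. fact (length w) * (4 * \<tau>) ^ length w * wprod norm w) p *
    wnorm (\<lambda>w. fact (length w) * (4 * \<tau>) ^ length w * wprod norm w) q"
proof -
  let ?U = "\<lambda>w. fact (length w) * (2 * \<tau>) ^ length w * wprod N w"
  let ?V = "\<lambda>w. fact (length w) * (4 * \<tau>) ^ length w * wprod norm w"
  have V_nonneg: "0 \<le> ?V w" for w
    using \<tau>_pos by (simp add: wprod_nonneg)
  have V_mset: "?V u = ?V v" if "mset u = mset v" for u v
    using that mset_eq_length[of u v] wprod_mset[of u v norm] by simp
  have U_V: "?U (u @ v) \<le> ?V u * ?V v" for u v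
  proof -
    let ?k = "length u" and ?l = "length v"
    have wprod: "wprod N (u @ v) \<le> wprod norm u * wprod norm v"
      using wprod_mono[of N 1 norm "u @ v"] N_nonneg N_le by simp
    have "?U (u @ v) = (fact (?k + ?l) * (2 * \<tau>) ^ (?k + ?l)) * wprod N (u @ v)"
      by simp
    also have "\<dots> \<le> (2 ^ (?k + ?l) * (fact ?k * fact ?l) * (2 * \<tau>) ^ (?k + ?l)) * (wprod norm u * wprod norm v)"
      using \<tau>_pos by (intro mult_mono fact_add_le wprod mult_right_mono) (simp_all add: wprod_nonneg N_nonneg)
    also have "\<dots> = (fact ?k * fact ?l * (2 * (2 * \<tau>)) ^ (?k + ?l)) * (wprod norm u * wprod norm v)"
      by (simp only: power_mult_distrib mult_ac)
    also have "\<dots> = ?V u * ?V v"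
      by (simp add: power_add mult_ac)
    finally show ?thesis .
  qed
  have "wnorm (fweight 0) (rep (Sym p * Sym q)) \<le> wnorm ?U (Sym p * Sym q)"
    by (rule wnorm_rep)
  also have "\<dots> \<le> wnorm ?V (Sym p) * wnorm ?V (Sym q)"
    using \<tau>_pos by (intro wnorm_mult U_V V_nonneg) (simp add: wprod_nonneg N_nonneg)
  also have "\<dots> \<le> wnorm ?V p * wnorm ?V q"
    by (intro mult_mono wnorm_Sym V_nonneg V_mset wnorm_nonneg) auto
  finally show ?thesis .
qed

end

end


section \<open>The seminorms\<close>

definition weight_seq :: "(nat \<Rightarrow> real) \<Rightarrow> nat \<Rightarrow> real"
  where "weight_seq \<alpha> n = (if n = 0 then 1 else \<alpha> n)"

lemma proj_norm_conv:
  "proj_norm n x = Inf (wnorm (wprod norm) ` {p \<in> x. \<forall>w\<in>words p. length w = n})"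
  unfolding proj_norm_def wnorm_def by (rule arg_cong[where f = Inf]) (auto simp: image_iff)

lemma bdd_below_wnorm: "bdd_below (wnorm (wprod norm) ` S)"
  by (rule bdd_belowI[of _ 0]) (auto intro!: wnorm_nonneg wprod_nonneg)

lemma proj_norm_le:
  assumes "p \<in> x" "\<And>w. w \<in> words p \<Longrightarrow> length w = n"
  shows "proj_norm n x \<le> wnorm (wprod norm) p"
  unfolding proj_norm_conv using assms by (intro cInf_lower bdd_below_wnorm) auto

context
  fixes sc :: "'k::real_normed_field \<Rightarrow> 'a::real_normed_vector \<Rightarrow> 'a"
begin

lemma class_mem: "p \<in> tensor_class sc p"
  by (simp add: tensor_class_conv)

lemma proj_norm_zero: "proj_norm n (tensor_class sc 0) = 0"
proof (rule antisym)
  show "proj_norm n (tensor_class sc 0) \<le> 0"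
    using proj_norm_le[OF class_mem, of 0 n] by simp
  have "0 \<in> {p \<in> tensor_class sc 0. \<forall>w\<in>words p. length w = n}"
    by (simp add: class_mem)
  then show "0 \<le> proj_norm n (tensor_class sc 0)"
    unfolding proj_norm_conv
    by (intro cInf_greatest) (auto intro!: wnorm_nonneg wprod_nonneg)
qed

lemma fproj_eq_0: "(\<And>w. w \<in> words p \<Longrightarrow> length w \<le> N) \<Longrightarrow> N < n \<Longrightarrow> fproj n p = (0 :: ('a, 'k) free_alg)"
  by (rule poly_mapping_eqI) (auto simp: lookup_fproj in_keys_iff dest: leD)

lemma scaled_seminorm_class:
  assumes "\<And>w. w \<in> words p \<Longrightarrow> length w \<le> N"
  shows "scaled_seminorm sc c \<alpha> (tensor_class sc p) =
    (\<Sum>n\<le>N. fact n / weight_seq \<alpha> n * c ^ n * proj_norm n (tensor_class sc (fproj n p)))"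
  unfolding scaled_seminorm_def weight_seq_def[symmetric] tensor_proj_class
  by (rule suminf_finite) (auto simp: fproj_eq_0[OF assms] proj_norm_zero not_le)

lemma weighted_seminorm_eq_scaled: "weighted_seminorm sc \<alpha> x = scaled_seminorm sc 1 \<alpha> x"
  by (simp add: weighted_seminorm_def scaled_seminorm_def)

lemma weighted_seminorm_le:
  assumes "\<And>n. 0 < weight_seq \<alpha> n"
  shows "weighted_seminorm sc \<alpha> (tensor_class sc p) \<le>
    wnorm (\<lambda>w. fact (length w) / weight_seq \<alpha> (length w) * wprod norm w) p"
proof -
  obtain N where N: "\<And>w. w \<in> words p \<Longrightarrow> length w \<le> N"
    using keys_lengths_bounded[of p] by blast
  have "weighted_seminorm sc \<alpha> (tensor_class sc p) =
      (\<Sum>n\<le>N. fact n / weight_seq \<alpha> n * proj_norm n (tensor_class sc (fproj n p)))"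
    by (simp add: weighted_seminorm_eq_scaled scaled_seminorm_class[OF N])
  also have "\<dots> \<le> (\<Sum>n\<le>N. fact n / weight_seq \<alpha> n * wnorm (wprod norm) (fproj n p))"
    using assms
    by (intro sum_mono mult_left_mono proj_norm_le class_mem) (auto simp: keys_fproj less_imp_le)
  also have "\<dots> = (\<Sum>n\<le>N. wnorm (\<lambda>w. fact (length w) / weight_seq \<alpha> (length w) * wprod norm w) (fproj n p))"
    by (intro sum.cong refl wnorm_fproj_cong[symmetric]) simp
  also have "\<dots> = wnorm (\<lambda>w. fact (length w) / weight_seq \<alpha> (length w) * wprod norm w) p"
    by (rule wnorm_eq_sum_fproj[OF N, symmetric])
  finally show ?thesis .
qed

lemma scaled_seminorm_nonneg:
  assumes "\<And>n. 0 < weight_seq \<beta> n" "0 < c" "x \<in> carrier (tensor_algebra sc)"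
  shows "0 \<le> scaled_seminorm sc c \<beta> x"
proof -
  obtain p where x: "x = tensor_class sc p"
    using assms(3) by (auto simp: carrier_tensor_algebra)
  obtain N where N: "\<And>w. w \<in> words p \<Longrightarrow> length w \<le> N"
    using keys_lengths_bounded[of p] by blast
  have "0 \<le> proj_norm n (tensor_class sc (fproj n p))" for n
  proof -
    have "fproj n p \<in> {q \<in> tensor_class sc (fproj n p). \<forall>w\<in>words q. length w = n}"
      by (simp add: class_mem keys_fproj)
    then show ?thesis
      unfolding proj_norm_conv
      by (intro cInf_greatest) (auto intro!: wnorm_nonneg wprod_nonneg)
  qed
  then show ?thesis
    using assms(1,2) by (simp add: x scaled_seminorm_class[OF N] sum_nonneg less_imp_le)
qed

text \<open>The infima of all degrees are approached simultaneously by choosing a representative in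
  each degree and adding them up. The bound holds for every \<open>M \<ge> N\<close> so that two
  tensors can later share one cutoff.\<close>

lemma ex_representative:
  assumes \<beta>: "\<And>n. 0 < weight_seq \<beta> n" and c: "0 < c" and x: "x \<in> carrier (tensor_algebra sc)" and \<delta>: "0 < \<delta>"
  shows "\<exists>p N. x = tensor_class sc p \<and> (\<forall>w\<in>words p. length w \<le> N) \<and>
    (\<forall>M\<ge>N. (\<Sum>n\<le>M. fact n / weight_seq \<beta> n * c ^ n * wnorm (wprod norm) (fproj n p))
      \<le> scaled_seminorm sc c \<beta> x + \<delta>)"
proof -
  obtain p0 where x: "x = tensor_class sc p0"
    using x by (auto simp: carrier_tensor_algebra)
  obtain N where N: "\<And>w. w \<in> words p0 \<Longrightarrow> length w \<le> N"
    using keys_lengths_bounded[of p0] by blast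
  let ?K = "\<lambda>n. fact n / weight_seq \<beta> n * c ^ n"
  have K: "0 < ?K n" for n
    using \<beta> c by simp
  \<comment> \<open>The slack is divided among N + 1 degrees and by the weight of each, so that the
    weighted sum of the errors is \<delta>.\<close>
  have "\<exists>r. r \<in> tensor_class sc (fproj n p0) \<and> (\<forall>w\<in>words r. length w = n) \<and>
      wnorm (wprod norm) r < proj_norm n (tensor_class sc (fproj n p0)) + \<delta> / (real (Suc N) * ?K n)" for n
  proof -
    let ?S = "{q \<in> tensor_class sc (fproj n p0). \<forall>w\<in>words q. length w = n}"
    have "fproj n p0 \<in> ?S"
      by (simp add: class_mem keys_fproj)
    then have ne: "wnorm (wprod norm) ` ?S \<noteq> {}"
      by blast
    have "0 < \<delta> / (real (Suc N) * ?K n)"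
      by (intro divide_pos_pos mult_pos_pos \<delta> K) simp
    then have less: "Inf (wnorm (wprod norm) ` ?S) < proj_norm n (tensor_class sc (fproj n p0)) + \<delta> / (real (Suc N) * ?K n)"
      unfolding proj_norm_conv[symmetric] by linarith
    obtain v where v: "v \<in> wnorm (wprod norm) ` ?S"
      "v < proj_norm n (tensor_class sc (fproj n p0)) + \<delta> / (real (Suc N) * ?K n)"
      using cInf_lessD[OF ne less] ..
    obtain r where "v = wnorm (wprod norm) r" "r \<in> ?S"
      using v(1) ..
    with v(2) show ?thesis
      by (intro exI[of _ r]) simp
  qed
  then obtain r where r: "\<And>n. r n \<in> tensor_class sc (fproj n p0)"
    "\<And>n w. w \<in> words (r n) \<Longrightarrow> length w = n"
    "\<And>n. wnorm (wprod norm) (r n) < proj_norm n (tensor_class sc (fproj n p0)) + \<delta> / (real (Suc N) * ?K n)"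
    by metis
  define p where "p = (\<Sum>n\<le>N. r n)"
  have lookup_r: "coef (r m) w = 0" if "length w \<noteq> m" for m w
    using r(2)[of w m] that by (auto simp: in_keys_iff)
  have fproj_p: "fproj n p = r n" if "n \<le> N" for n
  proof (rule poly_mapping_eqI)
    fix w
    show "coef (fproj n p) w = coef (r n) w"
    proof (cases "length w = n")
      case True
      have "coef p w = (\<Sum>m\<le>N. if m = n then coef (r n) w else 0)"
        unfolding p_def lookup_sum using True lookup_r by (intro sum.cong) auto
      with True that show ?thesis
        by (simp add: lookup_fproj)
    qed (simp add: lookup_fproj lookup_r)
  qed
  have keys_p: "length w \<le> N" if "w \<in> words p" for w
  proof (rule ccontr)
    assume "\<not> length w \<le> N"
    then have "coef p w = 0"
      unfolding p_def lookup_sum by (intro sum.neutral) (auto simp: lookup_r)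
    with that show False
      by (simp add: in_keys_iff)
  qed
  have "cg sc p (\<Sum>n\<le>N. fproj n p0)"
    unfolding p_def by (rule cg_sum) (use r(1) in \<open>simp add: tensor_class_conv\<close>)
  then have x_p: "x = tensor_class sc p"
    by (simp add: x sum_fproj[OF N] tensor_class_eq_iff cg_sym)
  have "(\<Sum>n\<le>N. ?K n * wnorm (wprod norm) (fproj n p)) \<le>
      (\<Sum>n\<le>N. ?K n * (proj_norm n (tensor_class sc (fproj n p0)) + \<delta> / (real (Suc N) * ?K n)))"
  proof (intro sum_mono mult_left_mono)
    fix n assume "n \<in> {..N}"
    then show "wnorm (wprod norm) (fproj n p) \<le> proj_norm n (tensor_class sc (fproj n p0)) + \<delta> / (real (Suc N) * ?K n)"
      using r(3)[of n] fproj_p by simp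
  qed (use K in \<open>simp add: less_imp_le\<close>)
  also have "\<dots> = (\<Sum>n\<le>N. ?K n * proj_norm n (tensor_class sc (fproj n p0))) + (\<Sum>n\<le>N. \<delta> / real (Suc N))"
  proof -
    have "k * (a + \<delta> / (m * k)) = k * a + \<delta> / m" if "0 < k" for k m a :: real
      using that by (simp add: distrib_left)
    from this[OF K] show ?thesis
      by (simp only: sum.distrib)
  qed
  also have "\<dots> = scaled_seminorm sc c \<beta> x + \<delta>"
    by (simp add: x scaled_seminorm_class[OF N])
  finally have bound: "(\<Sum>n\<le>N. ?K n * wnorm (wprod norm) (fproj n p)) \<le> scaled_seminorm sc c \<beta> x + \<delta>" .
  have zero: "fproj n p = 0" if "N < n" for n
    by (rule fproj_eq_0[OF _ that]) (rule keys_p)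
  have "(\<Sum>n\<le>M. ?K n * wnorm (wprod norm) (fproj n p)) \<le> scaled_seminorm sc c \<beta> x + \<delta>" if "N \<le> M" for M
  proof -
    have "(\<Sum>n\<le>M. ?K n * wnorm (wprod norm) (fproj n p)) = (\<Sum>n\<le>N. ?K n * wnorm (wprod norm) (fproj n p))"
    proof (rule sum.mono_neutral_right)
      show "\<forall>n\<in>{..M} - {..N}. ?K n * wnorm (wprod norm) (fproj n p) = 0"
        by (simp add: zero)
    qed (use that in auto)
    then show ?thesis
      using bound by simp
  qed
  with x_p keys_p show ?thesis
    by (intro exI[of _ p] exI[of _ N] conjI ballI allI impI)
qed

end


section \<open>The choice of the sequence\<close>

lemma filterlim_nat_Max_bounded:
  fixes D g :: "nat \<Rightarrow> real"
  assumes g: "mono g" "filterlim g at_top sequentially" and D: "D 0 \<le> g 0"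
  defines "\<phi> \<equiv> \<lambda>m. Max {i. i \<le> m \<and> D i \<le> g m}"
  shows "D (\<phi> m) \<le> g m" "mono \<phi>" "filterlim \<phi> at_top sequentially"
proof -
  let ?S = "\<lambda>m. {i. i \<le> m \<and> D i \<le> g m}"
  have fin: "finite (?S m)" for m
    by (rule finite_subset[of _ "{..m}"]) auto
  have zero: "0 \<in> ?S m" for m
    using D monoD[OF g(1), of 0 m] by simp
  show "D (\<phi> m) \<le> g m"
    using Max_in[OF fin, of m] zero[of m] by (auto simp: \<phi>_def)
  show "mono \<phi>"
  proof (rule monoI)
    fix m n :: nat assume "m \<le> n"
    then show "\<phi> m \<le> \<phi> n"
      unfolding \<phi>_def using zero[of m] monoD[OF g(1), of m n] fin
      by (intro Max_mono) auto
  qed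
  show "filterlim \<phi> at_top sequentially"
    unfolding filterlim_at_top
  proof
    fix i
    have "\<forall>\<^sub>F m in sequentially. D i \<le> g m"
      using g(2) by (simp add: filterlim_at_top)
    then show "\<forall>\<^sub>F m in sequentially. i \<le> \<phi> m"
      using eventually_ge_at_top[of i]
    proof eventually_elim
      case (elim m)
      then show ?case
        unfolding \<phi>_def by (intro Max_ge fin) simp
    qed
  qed
qed

text \<open>The growth of \<open>ln (\<alpha> n) / n\<close> beats any fixed base for large r, and D
  takes care of the remaining r. The comparison uses \<open>B + 1\<close>, whose logarithm makes
  sense for B = 0 too.\<close>

lemma rapidly_increasing_dominates:
  assumes "\<alpha> \<in> rapidly_increasing br" "0 \<le> B"
  obtains D where "1 \<le> D" "\<And>r. B ^ r \<le> D * weight_seq \<alpha> r"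
proof -
  have \<alpha>1: "\<And>n. 1 \<le> n \<Longrightarrow> 1 < \<alpha> n" and lim: "filterlim (\<lambda>n. ln (\<alpha> n) / real n) at_top sequentially"
    using assms(1) by (auto simp: rapidly_increasing_def)
  have ws: "1 \<le> weight_seq \<alpha> n" for n
    using \<alpha>1[of n] by (cases "n = 0") (auto simp: weight_seq_def)
  have "\<forall>\<^sub>F n in sequentially. ln (B + 1) \<le> ln (\<alpha> n) / real n"
    using lim by (simp add: filterlim_at_top)
  then obtain n0 where n0: "\<And>n. n \<ge> n0 \<Longrightarrow> ln (B + 1) \<le> ln (\<alpha> n) / real n"
    by (auto simp: eventually_sequentially)
  define D where "D = 1 + (\<Sum>r\<le>n0. B ^ r)"
  have D: "1 \<le> D"
    using assms(2) by (simp add: D_def sum_nonneg)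
  moreover have "B ^ r \<le> D * weight_seq \<alpha> r" for r
  proof (cases "r \<le> n0")
    case True
    then have "B ^ r \<le> (\<Sum>r\<le>n0. B ^ r)"
      using assms(2) by (intro member_le_sum) auto
    then have "B ^ r \<le> D * 1"
      by (simp add: D_def)
    also have "\<dots> \<le> D * weight_seq \<alpha> r"
      using D ws by (intro mult_left_mono) auto
    finally show ?thesis .
  next
    case False
    then have "ln ((B + 1) ^ r) \<le> ln (\<alpha> r)"
      using n0[of r] assms(2) by (simp add: ln_realpow pos_le_divide_eq mult.commute)
    then have "(B + 1) ^ r \<le> \<alpha> r"
      using assms(2) \<alpha>1[of r] False by (subst (asm) ln_le_cancel_iff) auto
    moreover have "B ^ r \<le> (B + 1) ^ r"
      using assms(2) by (intro power_mono) auto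
    ultimately have "B ^ r \<le> 1 * weight_seq \<alpha> r"
      using False by (simp add: weight_seq_def)
    also have "\<dots> \<le> D * weight_seq \<alpha> r"
      using D ws[of r] by (intro mult_right_mono) auto
    finally show ?thesis .
  qed
  ultimately show thesis
    by (rule that)
qed

context banach_lie_algebra
begin

text \<open>
  With gauges of arbitrarily small bracket constant, every exponential rate \<open>exp (- i)\<close> is available,
  at the price of a constant \<open>D\<close>.
\<close>

lemma ex_rep_mult_bound:
  assumes nil: "uniformly_top_nilpotent br" and \<alpha>: "\<alpha> \<in> rapidly_increasing br"
  shows "\<exists>D\<ge>1. \<forall>p q. wnorm (\<lambda>w. fact (length w) / weight_seq \<alpha> (length w) * wprod norm w) (rep (Sym p * Sym q)) \<le>
    D * (wnorm (\<lambda>w. fact (length w) * exp (- real i) ^ length w * wprod norm w) p *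
      wnorm (\<lambda>w. fact (length w) * exp (- real i) ^ length w * wprod norm w) q)"
proof -
  \<comment> \<open>Chosen so that the factor \<open>4 * \<tau>\<close> of
    \<open>wnorm_rep_mult\<close> is the desired rate.\<close>
  define \<tau> where "\<tau> = exp (- real i) / 4"
  have \<tau>: "0 < \<tau>" "4 * \<tau> = exp (- real i)"
    by (simp_all add: \<tau>_def)
  obtain N A where A: "1 \<le> A" and N: "\<And>\<xi>. 0 \<le> N \<xi>" "\<And>\<xi>. N \<xi> \<le> norm \<xi>" "\<And>\<xi>. norm \<xi> \<le> A * N \<xi>"
    and N_br: "\<And>\<xi> \<eta>. N (br \<xi> \<eta>) \<le> \<tau> / 2 * N \<xi> * N \<eta>"
    by (rule bracket_gauge[OF nil half_gt_zero[OF \<tau>(1)]]) (rule that)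
  \<comment> \<open>In degree r, returning from the gauge to the norm costs \<open>A ^ r\<close> and
    removing the weight costs \<open>\<tau> ^ r\<close> in the denominator.\<close>
  obtain D where D: "1 \<le> D" "\<And>r. (A / \<tau>) ^ r \<le> D * weight_seq \<alpha> r"
    using rapidly_increasing_dominates[OF \<alpha>, of "A / \<tau>"] A \<tau>(1) by auto
  have ws: "0 < weight_seq \<alpha> n" for n
    using \<alpha> by (auto simp: weight_seq_def rapidly_increasing_def intro: less_trans[OF zero_less_one])
  have weight: "fact (length w) / weight_seq \<alpha> (length w) * wprod norm w \<le> D * fweight N \<tau> 0 w" for w
  proof -
    let ?n = "length w"
    have "A ^ ?n / weight_seq \<alpha> ?n \<le> D * \<tau> ^ ?n"
      using D(2)[of ?n] ws[of ?n] \<tau>(1) by (simp add: power_divide field_simps)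
    then have *: "A ^ ?n / weight_seq \<alpha> ?n * (fact ?n * wprod N w) \<le> D * \<tau> ^ ?n * (fact ?n * wprod N w)"
      by (rule mult_right_mono) (simp add: wprod_nonneg N)
    have "fact ?n / weight_seq \<alpha> ?n * wprod norm w \<le> fact ?n / weight_seq \<alpha> ?n * (A ^ ?n * wprod N w)"
      using A ws[of ?n] N by (intro mult_left_mono wprod_mono) simp_all
    also have "\<dots> = A ^ ?n / weight_seq \<alpha> ?n * (fact ?n * wprod N w)"
      by simp
    also note *
    finally show ?thesis
      by (simp add: fweight_def[OF N(1) \<tau>(1) N_br] mult_ac)
  qed
  have "wnorm (\<lambda>w. fact (length w) / weight_seq \<alpha> (length w) * wprod norm w) (rep (Sym p * Sym q)) \<le>
      D * (wnorm (\<lambda>w. fact (length w) * exp (- real i) ^ length w * wprod norm w) p *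
        wnorm (\<lambda>w. fact (length w) * exp (- real i) ^ length w * wprod norm w) q)" for p q
  proof -
    have "wnorm (\<lambda>w. fact (length w) / weight_seq \<alpha> (length w) * wprod norm w) (rep (Sym p * Sym q))
        \<le> D * wnorm (fweight N \<tau> 0) (rep (Sym p * Sym q))"
      using ws by (intro wnorm_mono weight) (simp add: wprod_nonneg less_imp_le)
    also have "\<dots> \<le> D * (wnorm (\<lambda>w. fact (length w) * exp (- real i) ^ length w * wprod norm w) p *
        wnorm (\<lambda>w. fact (length w) * exp (- real i) ^ length w * wprod norm w) q)"
      using wnorm_rep_mult[OF N(1) \<tau>(1) N_br N(2), of p q] D(1) unfolding \<tau>(2)
      by (intro mult_left_mono) simp_all
    finally show ?thesis .
  qed
  with D(1) show ?thesis by blast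
qed

text \<open>Projections do not increase the norm, there are k + l + 1 terms, and the maximum with 1
  bounds all powers of z by the highest one.\<close>

lemma wnorm_fstar_le:
  assumes W: "\<And>w. 0 \<le> W w"
  shows "wnorm W (fstar z k l p q) \<le> (2 * max 1 (norm z)) ^ (k + l) * wnorm W (rep (Sym p * Sym q))"
proof -
  let ?\<zeta> = "max 1 (norm z)" and ?r = "rep (Sym p * Sym q)"
  have "wnorm W (fstar z k l p q) \<le> (\<Sum>n\<in>{0..k + l}. wnorm W (fscal (z ^ n) * fproj (k + l - n) ?r))"
    unfolding fstar_def by (rule wnorm_sum[OF W])
  also have "\<dots> \<le> (\<Sum>n\<in>{0..k + l}. ?\<zeta> ^ (k + l) * wnorm W ?r)"
  proof (rule sum_mono)
    fix n assume "n \<in> {0..k + l}"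
    then have "norm z ^ n \<le> ?\<zeta> ^ (k + l)"
      by (intro order_trans[OF power_mono power_increasing]) auto
    then show "wnorm W (fscal (z ^ n) * fproj (k + l - n) ?r) \<le> ?\<zeta> ^ (k + l) * wnorm W ?r"
      unfolding wnorm_scal norm_power
      by (intro mult_mono wnorm_fproj_le wnorm_nonneg W) auto
  qed
  also have "\<dots> = real (Suc (k + l)) * (?\<zeta> ^ (k + l) * wnorm W ?r)"
    by simp
  also have "\<dots> \<le> 2 ^ (k + l) * (?\<zeta> ^ (k + l) * wnorm W ?r)"
  proof (rule mult_right_mono)
    have "Suc (k + l) \<le> 2 ^ (k + l)"
      by (rule Suc_leI[OF less_exp])
    then have "real (Suc (k + l)) \<le> real (2 ^ (k + l))"
      by (simp only: of_nat_le_iff)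
    then show "real (Suc (k + l)) \<le> 2 ^ (k + l)"
      by simp
  qed (simp add: wnorm_nonneg W)
  finally show ?thesis
    by (simp only: power_mult_distrib mult.assoc)
qed

lemma fproj_0_fscal: "\<exists>a. fproj 0 p = fscal a"
proof (induction p rule: free_algebra_induct)
  case zero
  show ?case
    by (rule exI[of _ 0]) (simp add: lin_0[OF lin_fproj])
next
  case (add p q)
  then show ?case
    by (metis fscal_add lin_addD[OF lin_fproj])
next
  case (scal c p)
  then show ?case
    by (metis fscal_mult lin_scalD[OF lin_fproj])
next
  case (word w)
  show ?case
  proof (cases w)
    case Nil
    then show ?thesis
      using fproj_fword[of 0 w] by (intro exI[of _ 1]) simp
  next
    case (Cons a v)
    then show ?thesis
      by (intro exI[of _ 0]) (simp add: fproj_fword)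
  qed
qed

text \<open>The star product of constants, which has to be known exactly since \<open>c ^ 0\<close>
  cannot absorb any factor.\<close>

lemma fstar_fscal: "fstar z 0 0 (fscal a) (fscal b) = fscal (a * b)"
proof -
  have "Sym (fscal c) = (fscal c :: ('a, 'k) free_alg)" for c
    using lin_scalD[OF lin_ext, of fsym c 1] by simp
  moreover have "rep (fscal c) = fscal c" for c
    using lin_scalD[OF lin_ext, of rep_word c 1] by simp
  moreover have "fproj 0 (1 :: ('a, 'k) free_alg) = 1"
    using fproj_fword[of 0 "[] :: 'a list", where 'b = 'k] by simp
  then have "fproj 0 (fscal c :: ('a, 'k) free_alg) = fscal c" for c
    using lin_scalD[OF lin_fproj, of 0 c "1 :: ('a, 'k) free_alg"] by simp
  ultimately show ?thesis
    by (simp add: fstar_def fscal_mult[symmetric])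
qed

end


section \<open>Continuity of the Gutt star product\<close>

theorem proposition6p4p6:
  fixes sc :: "'k::real_normed_field \<Rightarrow> 'a::banach \<Rightarrow> 'a"
    and br :: "'a \<Rightarrow> 'a \<Rightarrow> 'a"
    and \<alpha> :: "nat \<Rightarrow> real"
    and z :: 'k
  assumes "banach_lie_algebra sc br"
    and "uniformly_top_nilpotent br"
    and "\<forall>n\<ge>1. 0 < omega br n"
    and "\<alpha> \<in> rapidly_increasing br"
  shows "\<exists>\<beta>\<in>rapidly_increasing br. \<exists>c>0.
    \<forall>x\<in>carrier (tensor_algebra sc). \<forall>y\<in>carrier (tensor_algebra sc).
      weighted_seminorm sc \<alpha> (gutt_star sc br z x y)
        \<le> scaled_seminorm sc c \<beta> x * scaled_seminorm sc c \<beta> y"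
proof -
  interpret banach_lie_algebra sc br by fact
  have \<alpha>1: "\<And>n. 1 \<le> n \<Longrightarrow> 1 < \<alpha> n" and \<alpha>_lim: "filterlim (\<lambda>n. ln (\<alpha> n) / real n) at_top sequentially"
    using assms(4) by (auto simp: rapidly_increasing_def)
  obtain c' where c': "0 < c'" "\<And>n. 1 \<le> n \<Longrightarrow> \<alpha> n \<le> c' ^ n * char_seq br n"
    using assms(4) by (auto simp: rapidly_increasing_def)
  let ?W = "\<lambda>w :: 'a list. fact (length w) / weight_seq \<alpha> (length w) * wprod norm w"
  let ?V = "\<lambda>i (w :: 'a list). fact (length w) * exp (- real i) ^ length w * wprod norm w"
  let ?\<nu> = "wnorm (wprod norm) :: (('a, 'k) free_alg) \<Rightarrow> real"
  define R where "R i d \<longleftrightarrow> (\<forall>p q. wnorm ?W (rep (Sym p * Sym q)) \<le> d * (wnorm (?V i) p * wnorm (?V i) q))" for i d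
  have "\<exists>d. 1 \<le> d \<and> R i d" for i
    using ex_rep_mult_bound[OF assms(2,4), of i] unfolding R_def .
  then obtain D where D: "\<And>i. 1 \<le> D i" and R: "\<And>i. R i (D i)"
    by metis

  \<comment> \<open>The constant \<open>D (\<phi> m)\<close> may cost at most an exponential in m,
    which c can absorb; the factor \<open>D 0\<close> makes the rate 0 always admissible.\<close>
  define g where "g m = D 0 * exp (real m)" for m
  define \<phi> where "\<phi> m = Max {i. i \<le> m \<and> D i \<le> g m}" for m
  have "mono g"
    using D[of 0] by (auto simp: g_def intro!: monoI mult_left_mono)
  moreover have "filterlim g at_top sequentially"
    unfolding g_def
    using D[of 0] by (intro filterlim_tendsto_pos_mult_at_top[OF tendsto_const]
        filterlim_compose[OF exp_at_top filterlim_real_sequentially]) simp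
  moreover have "D 0 \<le> g 0"
    by (simp add: g_def)
  ultimately have \<phi>: "\<And>m. D (\<phi> m) \<le> g m" "mono \<phi>" "filterlim \<phi> at_top sequentially"
    unfolding \<phi>_def by (rule filterlim_nat_Max_bounded)+

  define b where "b m = exp (real m * real (\<phi> m))" for m
  \<comment> \<open>The minimum with \<alpha> inherits the bound by the characteristic sequence. The
    factor \<open>exp (real n)\<close> keeps the values above 1 even while
    \<open>\<phi> n = 0\<close>.\<close>
  define \<beta> where "\<beta> n = min (\<alpha> n) (exp (real n) * b n)" for n
  have \<beta>1: "1 < \<beta> n" if "1 \<le> n" for n
  proof -
    have "exp (0 :: real) < exp (real n + real n * real (\<phi> n))"
      using that by (subst exp_less_cancel_iff) (simp add: add_pos_nonneg)
    then show ?thesis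
      using \<alpha>1[OF that] by (simp add: \<beta>_def b_def exp_add)
  qed
  have ws\<alpha>: "0 < weight_seq \<alpha> n" and ws\<beta>: "0 < weight_seq \<beta> n" for n
    using \<alpha>1[of n] \<beta>1[of n] by (cases "n = 0"; simp add: weight_seq_def)+
  have \<beta>_lim: "filterlim (\<lambda>n. ln (\<beta> n) / real n) at_top sequentially"
    unfolding filterlim_at_top
  proof
    fix Z :: real
    have "\<forall>\<^sub>F n in sequentially. Z \<le> ln (\<alpha> n) / real n"
      using \<alpha>_lim by (simp add: filterlim_at_top)
    moreover have "\<forall>\<^sub>F n in sequentially. nat \<lceil>Z\<rceil> \<le> \<phi> n"
      using \<phi>(3) unfolding filterlim_at_top ..
    ultimately show "\<forall>\<^sub>F n in sequentially. Z \<le> ln (\<beta> n) / real n"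
      using eventually_ge_at_top[of 1]
    proof eventually_elim
      case (elim n)
      have "Z \<le> real (\<phi> n)"
        using elim(2) by linarith
      moreover have "ln (exp (real n) * b n) / real n = 1 + real (\<phi> n)"
        using elim(3) by (simp add: b_def exp_add[symmetric] add_divide_distrib)
      ultimately have "Z \<le> ln (exp (real n) * b n) / real n"
        by linarith
      with elim(1) show ?case
        by (simp add: \<beta>_def min_def)
    qed
  qed
  have "\<beta> n \<le> c' ^ n * char_seq br n" if "1 \<le> n" for n
    using c'(2)[OF that] by (simp add: \<beta>_def)
  with \<beta>1 \<beta>_lim c'(1) have \<beta>: "\<beta> \<in> rapidly_increasing br"
    by (auto simp: rapidly_increasing_def)

  \<comment> \<open>As \<phi> is monotone, the rate chosen for the total degree k + l serves both
    factors. This is what splits a bound in k + l into a product.\<close>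
  have b_mult: "b k * b l \<le> b (k + l)" for k l
  proof -
    have "real k * real (\<phi> k) + real l * real (\<phi> l) \<le> real k * real (\<phi> (k + l)) + real l * real (\<phi> (k + l))"
      using monoD[OF \<phi>(2), of k "k + l"] monoD[OF \<phi>(2), of l "k + l"]
      by (intro add_mono mult_left_mono) simp_all
    then show ?thesis
      by (simp add: b_def exp_add[symmetric] distrib_right)
  qed
  have b_pos: "0 < b k" for k
    by (simp add: b_def)
  have b_\<beta>: "1 / b k \<le> exp (real k) / weight_seq \<beta> k" for k
  proof (cases "k = 0")
    case False
    have "\<beta> k \<le> exp (real k) * b k"
      by (simp add: \<beta>_def)
    then show ?thesis
      using False ws\<beta>[of k] b_pos[of k] by (simp add: weight_seq_def field_simps)
  qed (simp add: weight_seq_def b_def)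

  \<comment> \<open>\<open>2 * max 1 (norm z)\<close> comes from \<open>wnorm_fstar_le\<close>, one
    \<open>exp 1\<close> per degree from \<open>g\<close>, another from \<open>b_\<beta>\<close>,
    and \<open>D 0\<close> from \<open>g\<close>.\<close>
  define c where "c = 2 * max 1 (norm z) * (D 0 * exp 2)"
  have c: "0 < c"
    using D[of 0] by (simp add: c_def)
  have wprod_nn: "0 \<le> wprod norm w" for w :: "'a list"
    by (simp add: wprod_nonneg)
  have W_nn: "0 \<le> ?W w" for w
    using ws\<alpha>[of "length w"] wprod_nn[of w] by simp
  define S where "S k p = fact k / weight_seq \<beta> k * c ^ k * ?\<nu> (fproj k p)" for k p
  have bound: "wnorm ?W (fstar z k l (fproj k p) (fproj l q)) \<le> S k p * S l q" for k l p q
  proof (cases "k + l = 0")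
    case True
    obtain a a' where "fproj 0 p = fscal a" "fproj 0 q = fscal a'"
      using fproj_0_fscal by metis
    with True show ?thesis
      by (simp add: S_def fstar_fscal weight_seq_def norm_mult)
  next
    case False
    \<comment> \<open>The gauge is selected according to the total degree of this pair of
      components.\<close>
    define m i where "m = k + l" and "i = \<phi> m"
    have V: "wnorm (?V i) (fproj k p) = fact k * exp (- real i) ^ k * ?\<nu> (fproj k p)" for k p
      by (rule wnorm_fproj_cong) simp
    have "D i * exp (- real i) ^ m \<le> g m * exp (- real i) ^ m"
      using \<phi>(1)[of m] by (intro mult_right_mono) (simp_all add: i_def)
    also have "\<dots> = D 0 * exp (real m) * (1 / b m)"
      by (simp add: g_def b_def i_def exp_of_nat_mult[symmetric] exp_minus field_simps)
    also have "\<dots> \<le> D 0 * exp (real m) * (1 / (b k * b l))"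
      using D[of 0] b_mult[of k l] b_pos
      by (intro mult_left_mono divide_left_mono) (simp_all add: m_def)
    also have "1 / (b k * b l) = 1 / b k * (1 / b l)"
      by simp
    \<comment> \<open>Raising \<open>D 0\<close> to the power m lets \<open>c ^ (k + l)\<close>
      absorb it; this uses \<open>D 0 \<ge> 1\<close> and m > 0, the reason for treating constants
      separately.\<close>
    also have "D 0 * exp (real m) * (1 / b k * (1 / b l)) \<le>
        D 0 ^ m * exp (real m) * ((exp (real k) / weight_seq \<beta> k) * (exp (real l) / weight_seq \<beta> l))"
      using D[of 0] False b_pos ws\<beta>
      by (intro mult_mono b_\<beta> self_le_power) (simp_all add: m_def less_imp_le)
    also have "\<dots> = (D 0 * exp 2) ^ m / (weight_seq \<beta> k * weight_seq \<beta> l)"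
      by (simp add: power_mult_distrib exp_of_nat_mult[symmetric] m_def exp_add[symmetric] algebra_simps)
    finally have decay: "D i * exp (- real i) ^ m \<le> (D 0 * exp 2) ^ m / (weight_seq \<beta> k * weight_seq \<beta> l)" .
    have "wnorm ?W (fstar z k l (fproj k p) (fproj l q))
        \<le> (2 * max 1 (norm z)) ^ m * wnorm ?W (rep (Sym (fproj k p) * Sym (fproj l q)))"
      unfolding m_def by (rule wnorm_fstar_le[OF W_nn])
    also have "\<dots> \<le> (2 * max 1 (norm z)) ^ m * (D i * (wnorm (?V i) (fproj k p) * wnorm (?V i) (fproj l q)))"
      by (intro mult_left_mono R[unfolded R_def, rule_format]) simp
    also have "\<dots> = (2 * max 1 (norm z)) ^ m * (D i * exp (- real i) ^ m *
        (fact k * ?\<nu> (fproj k p) * (fact l * ?\<nu> (fproj l q))))"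
      unfolding V m_def power_add by (simp only: mult_ac)
    also have "\<dots> \<le> (2 * max 1 (norm z)) ^ m * ((D 0 * exp 2) ^ m / (weight_seq \<beta> k * weight_seq \<beta> l) *
        (fact k * ?\<nu> (fproj k p) * (fact l * ?\<nu> (fproj l q))))"
      by (intro mult_left_mono mult_right_mono decay) (simp_all add: wnorm_nonneg wprod_nn)
    also have "\<dots> = S k p * S l q"
      by (simp add: S_def c_def m_def power_mult_distrib power_add)
    finally show ?thesis .
  qed

  have "weighted_seminorm sc \<alpha> (gutt_star sc br z x y) \<le> scaled_seminorm sc c \<beta> x * scaled_seminorm sc c \<beta> y"
    if x: "x \<in> carrier (tensor_algebra sc)" and y: "y \<in> carrier (tensor_algebra sc)" for x y
  proof -
    let ?a = "scaled_seminorm sc c \<beta> x" and ?b = "scaled_seminorm sc c \<beta> y"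
    \<comment> \<open>Representatives attain the seminorms only up to \<delta>, which tends to 0
      from the right afterwards.\<close>
    have le: "weighted_seminorm sc \<alpha> (gutt_star sc br z x y) \<le> (?a + \<delta>) * (?b + \<delta>)" if \<delta>: "0 < \<delta>" for \<delta>
    proof -
      obtain p N1 where p: "x = tensor_class sc p" "\<And>w. w \<in> words p \<Longrightarrow> length w \<le> N1"
        "\<And>M. N1 \<le> M \<Longrightarrow> (\<Sum>n\<le>M. S n p) \<le> ?a + \<delta>"
        using ex_representative[OF ws\<beta> c x \<delta>] unfolding S_def by blast
      obtain q N2 where q: "y = tensor_class sc q" "\<And>w. w \<in> words q \<Longrightarrow> length w \<le> N2"
        "\<And>M. N2 \<le> M \<Longrightarrow> (\<Sum>n\<le>M. S n q) \<le> ?b + \<delta>"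
        using ex_representative[OF ws\<beta> c y \<delta>] unfolding S_def by blast
      define M where "M = max N1 N2"
      have S_nn: "0 \<le> S n r" for n r
        using ws\<beta>[of n] c by (simp add: S_def wnorm_nonneg wprod_nn)
      have "gutt_star sc br z x y = tensor_class sc (\<Sum>k\<le>M. \<Sum>l\<le>M. fstar z k l (fproj k p) (fproj l q))"
        unfolding p(1) q(1) using p(2) q(2)
        by (intro gutt_star_class) (fastforce simp: M_def)+
      then have "weighted_seminorm sc \<alpha> (gutt_star sc br z x y)
          \<le> wnorm ?W (\<Sum>k\<le>M. \<Sum>l\<le>M. fstar z k l (fproj k p) (fproj l q))"
        using weighted_seminorm_le[OF ws\<alpha>] by simp
      also have "\<dots> \<le> (\<Sum>k\<le>M. \<Sum>l\<le>M. wnorm ?W (fstar z k l (fproj k p) (fproj l q)))"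
        by (intro order_trans[OF wnorm_sum[OF W_nn]] sum_mono wnorm_sum W_nn)
      also have "\<dots> \<le> (\<Sum>k\<le>M. \<Sum>l\<le>M. S k p * S l q)"
        by (intro sum_mono bound)
      also have "\<dots> = (\<Sum>k\<le>M. S k p) * (\<Sum>l\<le>M. S l q)"
        by (rule sum_product[symmetric])
      also have "\<dots> \<le> (?a + \<delta>) * (?b + \<delta>)"
        using p(3)[of M] q(3)[of M] \<delta> scaled_seminorm_nonneg[OF ws\<beta> c x]
        by (intro mult_mono) (simp_all add: M_def sum_nonneg S_nn)
      finally show ?thesis .
    qed
    have lim: "((\<lambda>\<delta>. (?a + \<delta>) * (?b + \<delta>)) \<longlongrightarrow> (?a + 0) * (?b + 0)) (at_right 0)"
      by (intro tendsto_intros)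
    have "\<forall>\<^sub>F \<delta> in at_right 0. weighted_seminorm sc \<alpha> (gutt_star sc br z x y) \<le> (?a + \<delta>) * (?b + \<delta>)"
      by (rule eventually_at_rightI[of 0 1]) (simp_all add: le)
    from tendsto_lowerbound[OF lim this trivial_limit_at_right_real] show ?thesis
      by simp
  qed
  with \<beta> c show ?thesis by blast
qed

end
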